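(* Let $n\in[1,3)$ and set $\alpha=\frac{4}{n+3}$. For a constant $D\ge 0$, consider the problem of finding a real constant $B\ge 0$ and a function $H\in C^1([0,1])\cap C^3((0,1))$ with $H>0$ on $[0,1)$ such that \begin{align*} H^{n-1}\,\tfrac{d^3H}{dx^3} &= B^2 x \quad\text{for } x\in(0,1),\\ \tfrac{dH}{dx}(0)&=0,\qquad H(1)=0,\\ \Big(\tfrac{dH}{dx}(1)\Big)^2 &= D^2 B^{2\alpha},\\ \int_0^1 H(x)\,dx &= 1 . \end{align*} Then for every $D\ge 0$ this problem has a unique solution $(B_D,H_D)$. Moreover, $B_0>0$ (so $(B_0,H_0)$ is the unique solution for $D=0$), and as $D\to+\infty$, $$D\,B_D^{\alpha}\to 3 \qquad\text{and}\qquad H_D(x)\to \tfrac32(1-x^2)\ \text{ in } C([0,1]).$$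
   Context: This is the self-similar profile problem for the thin-film equation $\partial_t h+\partial_y(h^n\partial_y^3 h)=0$ with contact-line friction law $(\partial_y h)^2=D^2(\pm\dot s_\pm)^\alpha$ at the free boundary, in the balanced case $\alpha=4/(n+3)$; $H$ is the (even, rescaled) film profile on its support $[-1,1]$, restricted to $[0,1]$, and $B$ is an unknown constant determining the spreading rate $s(t)=((n+4)B^2t)^{1/(n+4)}$. Limits as $D\to+\infty$ are taken along the family of unique solutions $(B_D,H_D)$. *)

theory Defs
  imports "HOL-Analysis.Analysis"
begin

definition tf_alpha :: "real \<Rightarrow> real" where
  "tf_alpha n = 4 / (n + 3)"

definition tf_solution :: "real \<Rightarrow> real \<Rightarrow> real \<Rightarrow> (real \<Rightarrow> real) \<Rightarrow> bool" where
  "tf_solution n D B H \<longleftrightarrow>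
     B \<ge> 0 \<and>
     (\<forall>x\<in>{0..<1}. H x > 0) \<and>
     (\<exists>H1 H2 H3.
        (\<forall>x\<in>{0..1}. (H has_real_derivative H1 x) (at x within {0..1})) \<and>
        continuous_on {0..1} H1 \<and>
        (\<forall>x\<in>{0<..<1}. (H1 has_real_derivative H2 x) (at x)) \<and>
        (\<forall>x\<in>{0<..<1}. (H2 has_real_derivative H3 x) (at x)) \<and>
        continuous_on {0<..<1} H3 \<and>
        (\<forall>x\<in>{0<..<1}. H x powr (n - 1) * H3 x = B\<^sup>2 * x) \<and>
        H1 0 = 0 \<and>
        (H1 1)\<^sup>2 = D\<^sup>2 * B powr (2 * tf_alpha n)) \<and>
     H 1 = 0 \<and>
     (H has_integral 1) {0..1}"

end

theory Submission
  imports Defs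
begin

text \<open>
  Scaling space and height turns the problem into the initial value problem
  \<open>v''' = x v^(1-n)\<close>, \<open>v(0) = 1\<close>, \<open>v'(0) = 0\<close>, \<open>v''(0) = -b\<close>: if \<open>v\<close> reaches zero at \<open>X\<close> without turning
  upwards before, then with \<open>m\<close> its integral over \<open>[0,X]\<close>, \<open>A = X/m\<close> and \<open>B = A^(n/2) X^2\<close> the function
  \<open>A v(X x)\<close> solves the problem for \<open>D = -v'(X) m^(-(3-n)/(n+3)) X^(-2/(n+3))\<close>, and all solutions arise
  in this way.

  Uniqueness: use the height \<open>u = v(x)\<close> as the independent variable. The unknowns
  \<open>p(u) = v'(x)^2\<close> and \<open>x(u)\<close> satisfy \<open>p'' = -2 x p^(-1/2) u^(1-n)\<close>, \<open>x' = -p^(-1/2)\<close>, which is a cooperative system: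
  a larger \<open>b\<close> gives a larger \<open>p\<close> and a smaller \<open>x\<close> at every height. Hence \<open>-v'(X)\<close> increases while
  \<open>X\<close> and \<open>m\<close> decrease, and \<open>D\<close> is strictly increasing in \<open>b\<close>.

  Existence: let \<open>b*\<close> be the supremum of all \<open>b\<close> whose solution turns upwards. The energy
  \<open>E = v'^2/2 - v v''\<close> satisfies \<open>E' = -x v^(2-n)\<close>; as long as \<open>v' \<le> -c x\<close> its loss is at most
  \<open>v^(3-n)/(c(3-n))\<close>, which is small near a contact point because \<open>n < 3\<close>. So a contact with negative slope
  is stable under perturbation of \<open>b\<close>. This yields \<open>D = 0\<close> at \<open>b*\<close> and the continuity of \<open>D\<close> on \<open>[b*,\<infinity>)\<close>,
  and the intermediate value theorem applies.

  Large \<open>D\<close>: put \<open>\<gamma> = D B^\<alpha>\<close>. By convexity \<open>H \<ge> \<gamma>(1 - x^2)/2\<close>, so \<open>H''' \<le> B^2 (\<gamma>(1-x)/2)^(1-n)\<close>, which has a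
  bounded third antiderivative as \<open>n < 3\<close>. Therefore \<open>H - \<gamma>(1 - x^2)/2\<close> is of order
  \<open>B^2 \<gamma>^(1-n) = \<gamma>^((5-n)/2) D^(-(n+3)/2)\<close>, and the unit mass forces \<open>\<gamma>\<close> to tend to 3.
\<close>

section \<open>Calculus on the real line\<close>

lemma mono_of_deriv_nonneg:
  fixes f f' :: "real \<Rightarrow> real"
  assumes "a \<le> b" "continuous_on {a..b} f"
    "\<And>x. a < x \<Longrightarrow> x < b \<Longrightarrow> (f has_real_derivative f' x) (at x)"
    "\<And>x. a < x \<Longrightarrow> x < b \<Longrightarrow> 0 \<le> f' x"
  shows "f a \<le> f b"
  using DERIV_nonneg_imp_increasing_open[OF assms(1), of f] assms(2,3,4) by blast

lemma strict_mono_of_deriv_pos: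
  fixes f f' :: "real \<Rightarrow> real"
  assumes "a < b" "continuous_on {a..b} f"
    "\<And>x. a < x \<Longrightarrow> x < b \<Longrightarrow> (f has_real_derivative f' x) (at x)"
    "\<And>x. a < x \<Longrightarrow> x < b \<Longrightarrow> 0 < f' x"
  shows "f a < f b"
  using DERIV_pos_imp_increasing_open[OF assms(1), of f] assms(2,3,4) by blast

lemma antimono_of_deriv_nonpos:
  fixes f f' :: "real \<Rightarrow> real"
  assumes "a \<le> b" "continuous_on {a..b} f"
    "\<And>x. a < x \<Longrightarrow> x < b \<Longrightarrow> (f has_real_derivative f' x) (at x)"
    "\<And>x. a < x \<Longrightarrow> x < b \<Longrightarrow> f' x \<le> 0"
  shows "f b \<le> f a"
  using DERIV_nonpos_imp_decreasing_open[OF assms(1), of f] assms(2,3,4) by blast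

lemma strict_antimono_of_deriv_neg:
  fixes f f' :: "real \<Rightarrow> real"
  assumes "a < b" "continuous_on {a..b} f"
    "\<And>x. a < x \<Longrightarrow> x < b \<Longrightarrow> (f has_real_derivative f' x) (at x)"
    "\<And>x. a < x \<Longrightarrow> x < b \<Longrightarrow> f' x < 0"
  shows "f b < f a"
  using DERIV_neg_imp_decreasing_open[OF assms(1), of f] assms(2,3,4) by blast

text \<open>The set where \<open>f\<close> is nonnegative is compact, so it has a least element, and
  the intermediate value theorem rules out a positive value there. Continuation arguments use this
  to isolate the first violation of a strict inequality.\<close>

lemma first_zero:
  fixes f :: "real \<Rightarrow> real"
  assumes "a \<le> b" "continuous_on {a..b} f" "f a < 0" "0 \<le> f b"
  obtains r where "a < r" "r \<le> b" "f r = 0" "\<And>x. x \<in> {a..<r} \<Longrightarrow> f x < 0"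
proof -
  define S where "S = {x\<in>{a..b}. 0 \<le> f x}"
  have "S = {a..b} \<inter> f -` {0..}" by (auto simp: S_def)
  then have "closed S"
    using continuous_closed_preimage[OF assms(2), of "{0..}"] by simp
  moreover have "bounded S"
    by (rule bounded_subset[OF bounded_closed_interval[of a b]]) (auto simp: S_def)
  ultimately have "compact S" by (simp add: compact_eq_bounded_closed)
  moreover have "b \<in> S" using assms by (auto simp: S_def)
  ultimately obtain r where r: "r \<in> S" "\<And>x. x \<in> S \<Longrightarrow> r \<le> x"
    using compact_attains_inf[of S] by blast
  have r0: "a < r" using r(1) assms by (cases "r = a") (auto simp: S_def)
  have "r \<le> b" "0 \<le> f r" using r(1) by (auto simp: S_def)
  then have "\<exists>y\<ge>a. y \<le> r \<and> f y = 0"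
    using r0 assms(3) by (intro IVT') (auto intro: continuous_on_subset[OF assms(2)])
  then obtain y where y: "a \<le> y" "y \<le> r" "f y = 0" by blast
  then have "y \<in> S" using r(1) by (auto simp: S_def)
  then have "f r = 0" using r(2) y by force
  then show ?thesis using that[of r] r r0 by (force simp: S_def not_less)
qed

lemma le_at_endpoint:
  fixes f g :: "real \<Rightarrow> real"
  assumes "a < r" "continuous_on {a..r} f" "continuous_on {a..r} g"
    "\<And>x. a < x \<Longrightarrow> x < r \<Longrightarrow> f x \<le> g x"
  shows "f r \<le> g r"
proof (rule tendsto_le[of "at_left r"])
  show "(g \<longlongrightarrow> g r) (at_left r)" "(f \<longlongrightarrow> f r) (at_left r)"
    using assms by (auto intro: continuous_on_Icc_at_leftD)
  show "\<forall>\<^sub>F x in at_left r. f x \<le> g x"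
    using assms(1,4) by (auto simp: eventually_at_left[OF assms(1)])
qed simp

lemma eq_at_endpoint:
  fixes f g :: "real \<Rightarrow> real"
  assumes "a < r" "continuous_on {a..r} f" "continuous_on {a..r} g"
    "\<And>x. a < x \<Longrightarrow> x < r \<Longrightarrow> f x = g x"
  shows "f r = g r"
  using le_at_endpoint[of a r f g] le_at_endpoint[of a r g f] assms by (intro antisym) auto

lemma continuous_on_Ico_if_Icc:
  fixes f :: "real \<Rightarrow> real"
  assumes "\<And>y. a \<le> y \<Longrightarrow> y < X \<Longrightarrow> continuous_on {a..y} f"
  shows "continuous_on {a..<X} f"
  unfolding continuous_on_eq_continuous_within
proof
  fix x assume x: "x \<in> {a..<X}"
  define y where "y = (x + X) / 2"
  have y: "x < y" "y < X" using x by (auto simp: y_def)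
  have "continuous (at x within {a..y}) f"
    using assms[of y] x y by (auto simp: continuous_on_eq_continuous_within)
  moreover have "at x within {a..y} = at x within {a..<X}"
    by (rule at_within_nhd[of x "{..<y}"]) (use x y in auto)
  ultimately show "continuous (at x within {a..<X}) f" by simp
qed

text \<open>The derivative \<open>(1 - n) * z powr (-n)\<close> is largest in modulus at the left
  end \<open>e\<close>, and the mean value inequality applies.\<close>

lemma powr_lipschitz:
  fixes s t e n :: real
  assumes "1 \<le> n" "0 < e" "e \<le> s" "e \<le> t"
  shows "\<bar>s powr (1 - n) - t powr (1 - n)\<bar> \<le> (n - 1) * e powr (-n) * \<bar>s - t\<bar>"
proof -
  have "norm (s powr (1 - n) - t powr (1 - n)) \<le> ((n - 1) * e powr (-n)) * norm (s - t)"
  proof (rule field_differentiable_bound[where S = "{e..}" and f' = "\<lambda>z. (1 - n) * z powr (1 - n - 1)"])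
    fix z assume z: "z \<in> {e..}"
    show "((\<lambda>z. z powr (1 - n)) has_field_derivative (1 - n) * z powr (1 - n - 1)) (at z within {e..})"
      using z assms by (intro has_field_derivative_at_within[OF has_real_derivative_powr]) auto
    have "z powr (-n) \<le> e powr (-n)"
      using z assms by (intro powr_mono2') auto
    then show "norm ((1 - n) * z powr (1 - n - 1)) \<le> (n - 1) * e powr (-n)"
      using assms by (auto simp: abs_mult intro!: mult_left_mono)
  qed (use assms in auto)
  then show ?thesis by simp
qed

text \<open>By the fundamental theorem \<open>f\<close> is \<open>f a\<close> plus the integral of
  the continuous \<open>g\<close>, which is differentiable at the end points too. This supplies the
  one-sided derivatives that \<open>tf_solution\<close> asks for at 0 and 1.\<close>

lemma has_real_derivative_closed_interval:
  fixes f g :: "real \<Rightarrow> real"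
  assumes ab: "a < b" and cf: "continuous_on {a..b} f" and cg: "continuous_on {a..b} g"
    and d: "\<And>x. a < x \<Longrightarrow> x < b \<Longrightarrow> (f has_real_derivative g x) (at x)"
    and x: "x \<in> {a..b}"
  shows "(f has_real_derivative g x) (at x within {a..b})"
proof -
  have eq: "f a + integral {a..y} g = f y" if y: "y \<in> {a..b}" for y
  proof -
    have "(g has_integral (f y - f a)) {a..y}"
    proof (rule fundamental_theorem_of_calculus_interior)
      show "continuous_on {a..y} f" using cf y by (auto intro: continuous_on_subset)
      show "(f has_vector_derivative g z) (at z)" if "z \<in> {a<..<y}" for z
        using d[of z] that y by (simp flip: has_real_derivative_iff_has_vector_derivative)
    qed (use y in auto)
    then show ?thesis by (simp add: integral_unique)
  qed
  have "((\<lambda>y. f a + integral {a..y} g) has_real_derivative 0 + g x) (at x within {a..b})"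
    by (intro DERIV_add DERIV_const integral_has_real_derivative[OF cg x])
  then show ?thesis
    using has_field_derivative_transform_within[OF _ zero_less_one x eq] by simp
qed

text \<open>A positive interior value would force a positive slope somewhere to its left and a
  negative one to its right, while \<open>f'\<close> cannot decrease. Derivatives are taken in the
  interior only, because the later applications have second derivatives that may be singular at an
  end point.\<close>

lemma nonpos_if_convex:
  fixes f f' f'' :: "real \<Rightarrow> real"
  assumes cont: "continuous_on {a..b} f"
    and d: "\<And>x. a < x \<Longrightarrow> x < b \<Longrightarrow> (f has_real_derivative f' x) (at x)"
    and d1: "\<And>x. a < x \<Longrightarrow> x < b \<Longrightarrow> (f' has_real_derivative f'' x) (at x)"
    and f'': "\<And>x. a < x \<Longrightarrow> x < b \<Longrightarrow> 0 \<le> f'' x"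
    and ends: "f a \<le> 0" "f b \<le> 0" and x: "x \<in> {a..b}"
  shows "f x \<le> 0"
proof (rule ccontr)
  assume fx: "\<not> f x \<le> 0"
  then have ax: "a < x" "x < b" using x ends by (auto simp: less_le)
  have "\<exists>y. a < y \<and> y < x \<and> 0 < f' y"
  proof (rule ccontr)
    assume "\<not> ?thesis"
    then have *: "f' y \<le> 0" if "a < y" "y < x" for y using that by force
    have "f x \<le> f a"
    proof (rule antimono_of_deriv_nonpos[where f = f and f' = f'])
      show "continuous_on {a..x} f" using cont ax by (auto intro: continuous_on_subset)
    qed (use * ax d in auto)
    then show False using fx ends by simp
  qed
  then obtain y where y: "a < y" "y < x" "0 < f' y" by blast
  have "\<exists>z. x < z \<and> z < b \<and> f' z < 0"
  proof (rule ccontr)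
    assume "\<not> ?thesis"
    then have *: "0 \<le> f' y" if "x < y" "y < b" for y using that by force
    have "f x \<le> f b"
    proof (rule mono_of_deriv_nonneg[where f = f and f' = f'])
      show "continuous_on {x..b} f" using cont ax by (auto intro: continuous_on_subset)
    qed (use * ax d in auto)
    then show False using fx ends by simp
  qed
  then obtain z where z: "x < z" "z < b" "f' z < 0" by blast
  have "f' y \<le> f' z"
  proof (rule mono_of_deriv_nonneg[where f = f' and f' = f''])
    have "continuous (at u within {y..z}) f'" if "u \<in> {y..z}" for u
      using DERIV_isCont[OF d1[of u]] that y z by (auto intro: continuous_at_imp_continuous_at_within)
    then show "continuous_on {y..z} f'" by (simp add: continuous_on_eq_continuous_within)
  qed (use y z d1 f'' in auto)
  then show False using y z by simp
qed

section \<open>Third-order initial value problems with a Lipschitz nonlinearity\<close>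

text \<open>Measured against the weight \<open>exp (K * s)\<close>, one integration gains a factor
  \<open>1 / K\<close>. This is what makes Picard iteration contract on an interval of any
  length.\<close>

lemma integral_exp_bound:
  fixes f1 f2 :: "real \<Rightarrow> real"
  assumes "0 < K" "0 \<le> x" "x \<le> R" "continuous_on {0..R} f1" "continuous_on {0..R} f2"
    and "\<And>s. s \<in> {0..R} \<Longrightarrow> \<bar>f1 s - f2 s\<bar> \<le> C * exp (K * s)"
  shows "\<bar>integral {0..x} f1 - integral {0..x} f2\<bar> \<le> C / K * exp (K * x)"
proof -
  have C: "0 \<le> C" using assms(6)[of 0] assms(2,3) by auto
  have c: "continuous_on {0..x} f1" "continuous_on {0..x} f2"
    using assms by (auto intro: continuous_on_subset)
  have i: "f1 integrable_on {0..x}" "f2 integrable_on {0..x}"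
    using c by (auto intro: integrable_continuous_real)
  have "((\<lambda>s. C / K * exp (K * s)) has_real_derivative C * exp (K * s)) (at s within {0..x})" for s
    using assms(1) by (auto intro!: derivative_eq_intros)
  then have E: "((\<lambda>s. C * exp (K * s)) has_integral C / K * exp (K * x) - C / K * exp (K * 0)) {0..x}"
    unfolding has_real_derivative_iff_has_vector_derivative
    by (intro fundamental_theorem_of_calculus[OF assms(2)])
  have "norm (integral {0..x} (\<lambda>s. f1 s - f2 s)) \<le> integral {0..x} (\<lambda>s. C * exp (K * s))"
  proof (rule integral_norm_bound_integral)
    show "(\<lambda>s. f1 s - f2 s) integrable_on {0..x}" by (rule integrable_diff[OF i])
    show "(\<lambda>s. C * exp (K * s)) integrable_on {0..x}" using E by (rule has_integral_integrable)
    show "norm (f1 s - f2 s) \<le> C * exp (K * s)" if "s \<in> {0..x}" for s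
      using assms(6)[of s] that assms(3) by simp
  qed
  also have "\<dots> = C / K * exp (K * x) - C / K" using integral_unique[OF E] by simp
  also have "\<dots> \<le> C / K * exp (K * x)" using C assms(1) by simp
  finally show ?thesis unfolding integral_diff[OF i] by simp
qed

text \<open>Picard iteration on the whole interval at once: in the sup norm weighted by
  \<open>exp (- K * x)\<close> the threefold integral operator has Lipschitz constant
  \<open>R * L / K^3\<close>, which a large \<open>K\<close> brings down to 1/2.\<close>

lemma lipschitz_ivp_exists:
  fixes g :: "real \<Rightarrow> real" and b R L :: real
  assumes R: "0 < R" and L: "0 \<le> L"
    and lip: "\<And>s t. \<bar>g s - g t\<bar> \<le> L * \<bar>s - t\<bar>"
  obtains v v1 v2 where "v 0 = 1" "v1 0 = 0" "v2 0 = - b"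
    "\<And>x. x \<in> {0..R} \<Longrightarrow> (v has_real_derivative v1 x) (at x within {0..R})"
    "\<And>x. x \<in> {0..R} \<Longrightarrow> (v1 has_real_derivative v2 x) (at x within {0..R})"
    "\<And>x. x \<in> {0..R} \<Longrightarrow> (v2 has_real_derivative x * g (v x)) (at x within {0..R})"
proof -
  \<comment> \<open>Being at least 1, \<open>K\<close> satisfies
    \<open>K^3 \<ge> K \<ge> 2 * R * L\<close>.\<close>
  define K where "K = 1 + 2 * R * L"
  have K: "1 \<le> K" using R L by (simp add: K_def)
  have K3: "2 * R * L \<le> K * K * K"
  proof -
    have "2 * R * L \<le> K * 1 * 1" by (simp add: K_def)
    also have "\<dots> \<le> K * K * K" using K by (intro mult_mono) auto
    finally show ?thesis .
  qed
  have contg: "continuous_on UNIV g"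
  proof (rule continuous_on_iff[THEN iffD2], intro ballI allI impI)
    fix x e :: real assume "e > 0"
    then have "dist x' x < e / (L + 1) \<Longrightarrow> dist (g x') (g x) < e" for x'
    proof -
      assume d: "dist x' x < e / (L + 1)"
      have "\<bar>g x' - g x\<bar> \<le> L * \<bar>x' - x\<bar>" by (rule lip)
      also have "\<dots> \<le> (L + 1) * \<bar>x' - x\<bar>" by (simp add: algebra_simps)
      also have "\<dots> < e" using d L by (simp add: dist_real_def field_simps)
      finally show ?thesis by (simp add: dist_real_def)
    qed
    then show "\<exists>d>0. \<forall>x'\<in>UNIV. dist x' x < d \<longrightarrow> dist (g x') (g x) < e"
      using \<open>e > 0\<close> L by (intro exI[of _ "e / (L + 1)"]) auto
  qed
  define I where "I = (\<lambda>(h::real\<Rightarrow>real) x. integral {0..x} h)"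
  have I_0: "I h 0 = 0" for h by (simp add: I_def)
  have I_deriv: "(I h has_real_derivative h x) (at x within {0..R})"
    if "continuous_on {0..R} h" "x \<in> {0..R}" for h x
    unfolding I_def by (rule integral_has_real_derivative[OF that])
  have I_cont: "continuous_on {0..R} (I h)" if "continuous_on {0..R} h" for h
    using I_deriv[OF that] by (rule DERIV_continuous_on)
  have I_bound: "\<bar>I f1 x - I f2 x\<bar> \<le> C / K * exp (K * x)"
    if "x \<in> {0..R}" "continuous_on {0..R} f1" "continuous_on {0..R} f2"
      "\<And>s. s \<in> {0..R} \<Longrightarrow> \<bar>f1 s - f2 s\<bar> \<le> C * exp (K * s)" for f1 f2 C x
    unfolding I_def by (rule integral_exp_bound[where R = R]) (use that K in auto)
  \<comment> \<open>The unknown is the weighted function \<open>w x = exp (- K * x) * v x\<close>,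
    so that the plain sup norm on bounded continuous functions is the weighted norm of
    \<open>v\<close>.\<close>
  define f where "f = (\<lambda>w s. s * g (exp (K * s) * apply_bcontfun w s))"
  have f_cont: "continuous_on {0..R} (f w)" for w
    unfolding f_def by (intro continuous_intros continuous_on_compose2[OF contg]) auto
  define F where "F = (\<lambda>w y. exp (- K * y) * (1 - b * y\<^sup>2 / 2 + I (I (I (f w))) y))"
  have F_cont: "continuous_on {0..R} (F w)" for w
    unfolding F_def by (intro continuous_intros I_cont f_cont) auto
  \<comment> \<open>Clamping the argument to \<open>{0..R}\<close> extends the image to a bounded
    continuous function on the whole line, so that the fixed point theorem applies to the type of
    such functions.\<close>
  define T0 where "T0 = (\<lambda>w x. F w (max 0 (min x R)))"
  have T0: "T0 w \<in> bcontfun" for w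
  proof -
    have c: "continuous_on UNIV (T0 w)"
      unfolding T0_def using R
      by (intro continuous_on_compose2[OF F_cont] continuous_intros) auto
    have "bounded (F w ` {0..R})"
      by (intro compact_imp_bounded compact_continuous_image F_cont) auto
    then obtain M where "\<And>y. y \<in> {0..R} \<Longrightarrow> norm (F w y) \<le> M"
      unfolding bounded_iff by blast
    then have "norm (T0 w x) \<le> M" for x using R by (simp add: T0_def)
    with c show ?thesis by (rule bcontfun_normI)
  qed
  define T where "T = (\<lambda>w. Bcontfun (T0 w))"
  have T_apply: "apply_bcontfun (T w) x = T0 w x" for w x
    unfolding T_def by (simp add: Bcontfun_inverse T0)
  have contr: "dist (T w) (T w') \<le> 1/2 * dist w w'" for w w'
  proof (rule dist_bound)
    fix x
    define y where "y = max 0 (min x R)"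
    have y: "0 \<le> y" "y \<le> R" using R by (auto simp: y_def)
    have "\<bar>f w s - f w' s\<bar> \<le> (R * L * dist w w') * exp (K * s)" if s: "s \<in> {0..R}" for s
    proof -
      have "\<bar>f w s - f w' s\<bar> = s * \<bar>g (exp (K * s) * w s) - g (exp (K * s) * w' s)\<bar>"
        using s by (simp add: f_def abs_mult flip: right_diff_distrib)
      also have "\<dots> \<le> R * (L * \<bar>exp (K * s) * w s - exp (K * s) * w' s\<bar>)"
        using s by (intro mult_mono lip) auto
      also have "\<bar>exp (K * s) * w s - exp (K * s) * w' s\<bar> = exp (K * s) * dist (w s) (w' s)"
        by (simp add: dist_real_def abs_mult flip: right_diff_distrib)
      also have "R * (L * (exp (K * s) * dist (w s) (w' s))) \<le> R * (L * (exp (K * s) * dist w w'))"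
        using R L by (intro mult_left_mono dist_bounded) auto
      finally show ?thesis by (simp add: mult_ac)
    qed
    note b0 = this
    note b1 = I_bound[OF _ f_cont f_cont b0]
    note b2 = I_bound[OF _ I_cont[OF f_cont] I_cont[OF f_cont] b1]
    note b3 = I_bound[OF _ I_cont[OF I_cont[OF f_cont]] I_cont[OF I_cont[OF f_cont]] b2, of y]
    have yR: "y \<in> {0..R}" using y by simp
    have "dist (T w x) (T w' x) = \<bar>F w y - F w' y\<bar>"
      unfolding T_apply T0_def dist_real_def y_def ..
    also have "F w y - F w' y = exp (- K * y) * (I (I (I (f w))) y - I (I (I (f w'))) y)"
      unfolding F_def by algebra
    also have "\<bar>\<dots>\<bar> = exp (- K * y) * \<bar>I (I (I (f w))) y - I (I (I (f w'))) y\<bar>"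
      by (simp add: abs_mult)
    also have "\<dots> \<le> exp (- K * y) * ((R * L * dist w w' / K / K / K) * exp (K * y))"
      by (rule mult_left_mono[OF _ exp_ge_zero]) (rule b3[OF yR])
    also have "\<dots> = (R * L * dist w w' / K / K / K) * (exp (- K * y) * exp (K * y))"
      by (simp only: mult_ac)
    also have "exp (- K * y) * exp (K * y) = 1"
      by (simp flip: exp_add)
    also have "(R * L * dist w w' / K / K / K) * 1 = (R * L / (K * K * K)) * dist w w'"
      by simp
    also have "\<dots> \<le> 1/2 * dist w w'"
    proof (rule mult_right_mono)
      have "0 < K * K * K" using K by simp
      then show "R * L / (K * K * K) \<le> 1/2" using K3 by (simp add: pos_divide_le_eq)
    qed simp
    finally show "dist (T w x) (T w' x) \<le> 1/2 * dist w w'" .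
  qed
  have "\<exists>!w. T w = w"
    by (rule banach_fix_type[of "1/2"]) (use contr in auto)
  then obtain w where w: "T w = w" by blast
  define v where "v = (\<lambda>x. 1 - b * x\<^sup>2 / 2 + I (I (I (f w))) x)"
  have wv: "exp (K * x) * w x = v x" if "x \<in> {0..R}" for x
  proof -
    have "w x = T0 w x" using T_apply[of w x] w by simp
    then show ?thesis using that by (simp add: T0_def F_def v_def exp_minus)
  qed
  show ?thesis
  proof (rule that[of v "\<lambda>x. - b * x + I (I (f w)) x" "\<lambda>x. - b + I (f w) x"])
    show "v 0 = 1" unfolding v_def I_0 by simp
    show "- b * 0 + I (I (f w)) 0 = 0" unfolding I_0 by simp
    show "- b + I (f w) 0 = - b" unfolding I_0 by simp
    fix x assume x: "x \<in> {0..R}"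
    note d3 = I_deriv[OF I_cont[OF I_cont[OF f_cont[of w]]] x]
    note d2 = I_deriv[OF I_cont[OF f_cont[of w]] x]
    note d1 = I_deriv[OF f_cont[of w] x]
    have p2: "((\<lambda>x. 1 - b * x\<^sup>2 / 2) has_real_derivative - b * x) (at x within {0..R})"
      by (auto intro!: derivative_eq_intros)
    show "(v has_real_derivative - b * x + I (I (f w)) x) (at x within {0..R})"
      unfolding v_def by (rule DERIV_add[OF p2 d3])
    have p1: "((\<lambda>x. - b * x) has_real_derivative - b) (at x within {0..R})"
      by (auto intro!: derivative_eq_intros)
    show "((\<lambda>x. - b * x + I (I (f w)) x) has_real_derivative - b + I (f w) x) (at x within {0..R})"
      by (rule DERIV_add[OF p1 d2])
    have "f w x = x * g (v x)" using wv[OF x] by (simp add: f_def)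
    with DERIV_add[OF DERIV_const[of "- b"] d1]
    show "((\<lambda>x. - b + I (f w) x) has_real_derivative x * g (v x)) (at x within {0..R})" by simp
  qed
qed

section \<open>Solutions normalised by their value at the centre\<close>

text \<open>The functions \<open>v1\<close> and \<open>v2\<close> are the first two derivatives. The
  interval is half open because \<open>v\<close> may vanish at \<open>r\<close> and make the
  right-hand side singular; at 0 the initial values are attained through continuity instead of
  one-sided derivatives.\<close>

definition tsol :: "real \<Rightarrow> real \<Rightarrow> real \<Rightarrow> (real \<Rightarrow> real) \<Rightarrow> (real \<Rightarrow> real) \<Rightarrow> (real \<Rightarrow> real) \<Rightarrow> bool" where
  "tsol n b r v v1 v2 \<longleftrightarrow> 0 < r \<and> v 0 = 1 \<and> v1 0 = 0 \<and> v2 0 = - b \<and>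
     continuous_on {0..<r} v \<and> continuous_on {0..<r} v1 \<and> continuous_on {0..<r} v2 \<and>
     (\<forall>x\<in>{0..<r}. 0 < v x) \<and>
     (\<forall>x\<in>{0<..<r}. (v has_real_derivative v1 x) (at x)) \<and>
     (\<forall>x\<in>{0<..<r}. (v1 has_real_derivative v2 x) (at x)) \<and>
     (\<forall>x\<in>{0<..<r}. (v2 has_real_derivative x * v x powr (1 - n)) (at x))"

lemma tsolD:
  assumes "tsol n b r v v1 v2"
  shows "0 < r" "v 0 = 1" "v1 0 = 0" "v2 0 = - b"
    "\<And>x. 0 \<le> x \<Longrightarrow> x < r \<Longrightarrow> 0 < v x"
    "\<And>x. 0 < x \<Longrightarrow> x < r \<Longrightarrow> (v has_real_derivative v1 x) (at x)"
    "\<And>x. 0 < x \<Longrightarrow> x < r \<Longrightarrow> (v1 has_real_derivative v2 x) (at x)"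
    "\<And>x. 0 < x \<Longrightarrow> x < r \<Longrightarrow> (v2 has_real_derivative x * v x powr (1 - n)) (at x)"
  using assms unfolding tsol_def by auto

lemma tsol_cont:
  assumes "tsol n b r v v1 v2" "0 \<le> a" "c < r"
  shows "continuous_on {a..c} v" "continuous_on {a..c} v1" "continuous_on {a..c} v2"
  using assms unfolding tsol_def by (auto intro: continuous_on_subset)

lemma tsol_restrict:
  assumes "tsol n b r v v1 v2" "0 < r'" "r' \<le> r"
  shows "tsol n b r' v v1 v2"
  using assms unfolding tsol_def by (auto intro: continuous_on_subset)

lemma tsol_v2_strict_mono:
  assumes "tsol n b r v v1 v2" "0 \<le> x" "x < y" "y < r"
  shows "v2 x < v2 y"
proof (rule strict_mono_of_deriv_pos[OF assms(3)])
  show "continuous_on {x..y} v2" using tsol_cont[OF assms(1)] assms by auto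
  fix z assume "x < z" "z < y"
  then have z: "0 < z" "z < r" using assms by auto
  then show "(v2 has_real_derivative z * v z powr (1 - n)) (at z)" using tsolD(8)[OF assms(1)] by auto
  show "0 < z * v z powr (1 - n)" using z tsolD(5)[OF assms(1), of z] by auto
qed

lemma tsol_v2_ge:
  assumes "tsol n b r v v1 v2" "0 \<le> x" "x < r"
  shows "- b \<le> v2 x"
  using tsol_v2_strict_mono[OF assms(1), of 0 x] assms tsolD(4)[OF assms(1)]
  by (cases "x = 0") auto

lemma tsol_v1_plus_mono:
  assumes "tsol n b r v v1 v2" "0 \<le> x" "x \<le> y" "y < r"
  shows "v1 x + b * x \<le> v1 y + b * y"
proof (rule mono_of_deriv_nonneg[OF assms(3), where f = "\<lambda>x. v1 x + b * x" and f' = "\<lambda>x. v2 x + b"])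
  show "continuous_on {x..y} (\<lambda>x. v1 x + b * x)"
    using tsol_cont[OF assms(1)] assms by (intro continuous_intros) auto
  fix z assume "x < z" "z < y"
  then have z: "0 < z" "z < r" using assms by auto
  show "((\<lambda>x. v1 x + b * x) has_real_derivative v2 z + b) (at z)"
    using tsolD(7)[OF assms(1) z] by (auto intro!: derivative_eq_intros)
  show "0 \<le> v2 z + b" using tsol_v2_ge[OF assms(1), of z] z by auto
qed

lemma tsol_v1_ge:
  assumes "tsol n b r v v1 v2" "0 \<le> x" "x < r"
  shows "- b * x \<le> v1 x"
  using tsol_v1_plus_mono[OF assms(1), of 0 x] assms tsolD(3)[OF assms(1)] by auto

text \<open>Since \<open>v2\<close> increases, \<open>v1\<close> is convex and lies above its
  tangents.\<close>

lemma tsol_v1_chord: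
  assumes "tsol n b r v v1 v2" "0 \<le> x" "x \<le> y" "y < r"
  shows "v1 x + v2 x * (y - x) \<le> v1 y"
proof -
  have "v1 x - v2 x * x \<le> v1 y - v2 x * y"
  proof (rule mono_of_deriv_nonneg[OF assms(3), where f = "\<lambda>z. v1 z - v2 x * z" and f' = "\<lambda>z. v2 z - v2 x"])
    show "continuous_on {x..y} (\<lambda>z. v1 z - v2 x * z)"
      using tsol_cont[OF assms(1)] assms by (intro continuous_intros) auto
    fix z assume xz: "x < z" "z < y"
    then have z: "0 < z" "z < r" using assms by auto
    show "((\<lambda>z. v1 z - v2 x * z) has_real_derivative v2 z - v2 x) (at z)"
      using tsolD(7)[OF assms(1) z] by (auto intro!: derivative_eq_intros)
    show "0 \<le> v2 z - v2 x" using tsol_v2_strict_mono[OF assms(1), of x z] z xz assms by auto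
  qed
  then show ?thesis by (simp add: algebra_simps)
qed

text \<open>As \<open>v1\<close> starts at 0, a positive value means that \<open>v2\<close> was
  positive somewhere before; \<open>v2\<close> increases, so from then on \<open>v1\<close> can only
  grow.\<close>

lemma tsol_v1_stays_pos:
  assumes s: "tsol n b r v v1 v2" and "0 \<le> x" "x \<le> y" "y < r" "0 < v1 x"
  shows "0 < v1 y"
proof -
  have x: "0 < x" using assms tsolD(3)[OF s] by (cases "x = 0") auto
  have "\<exists>z. 0 < z \<and> z < x \<and> 0 < v2 z"
  proof (rule ccontr)
    assume "\<not> (\<exists>z. 0 < z \<and> z < x \<and> 0 < v2 z)"
    then have neg: "v2 z \<le> 0" if "0 < z" "z < x" for z using that not_less by blast
    have "v1 x \<le> v1 0"
    proof (rule antimono_of_deriv_nonpos[where f = v1 and f' = v2])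
      show "continuous_on {0..x} v1" using tsol_cont(2)[OF s] assms by auto
      show "(v1 has_real_derivative v2 z) (at z)" if "0 < z" "z < x" for z
        using tsolD(7)[OF s, of z] that assms by auto
    qed (use x neg in auto)
    then show False using assms tsolD(3)[OF s] by simp
  qed
  then obtain z where z: "0 < z" "z < x" "0 < v2 z" by blast
  then have "0 < v2 x" using tsol_v2_strict_mono[OF s, of z x] z assms by auto
  then have "0 \<le> v2 x * (y - x)" using assms by auto
  then show ?thesis using tsol_v1_chord[OF s, of x y] assms by linarith
qed

text \<open>Only the values on \<open>{0..<r}\<close> matter. This allows solutions to be glued
  together and \<open>v1\<close> to be redefined at the contact point.\<close>

lemma tsol_cong:
  assumes s: "tsol n b r v v1 v2"
    and eq: "\<And>x. 0 \<le> x \<Longrightarrow> x < r \<Longrightarrow> w x = v x" "\<And>x. 0 \<le> x \<Longrightarrow> x < r \<Longrightarrow> w1 x = v1 x"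
      "\<And>x. 0 \<le> x \<Longrightarrow> x < r \<Longrightarrow> w2 x = v2 x"
  shows "tsol n b r w w1 w2"
proof -
  have tr: "(g has_real_derivative D) (at x)"
    if "(f has_real_derivative D) (at x)" "0 < x" "x < r" "\<And>x. 0 \<le> x \<Longrightarrow> x < r \<Longrightarrow> g x = f x"
    for f g :: "real \<Rightarrow> real" and D x
    by (rule has_field_derivative_transform_within_open[OF that(1), of "{0<..<r}"]) (use that in auto)
  have c: "continuous_on {0..<r} w = continuous_on {0..<r} v"
    "continuous_on {0..<r} w1 = continuous_on {0..<r} v1" "continuous_on {0..<r} w2 = continuous_on {0..<r} v2"
    by (intro continuous_on_cong; simp add: eq)+
  have "(w has_real_derivative w1 x) (at x)" "(w1 has_real_derivative w2 x) (at x)"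
    "(w2 has_real_derivative x * w x powr (1 - n)) (at x)" if "0 < x" "x < r" for x
    using tr[OF tsolD(6)[OF s that] that eq(1)] tr[OF tsolD(7)[OF s that] that eq(2)]
      tr[OF tsolD(8)[OF s that] that eq(3)] that eq[of x] by auto
  then show ?thesis using s c eq unfolding tsol_def by auto
qed

lemma tf_solutionE:
  assumes "tf_solution n D B H"
  obtains H1 H2 H3 where "\<And>x. 0 \<le> x \<Longrightarrow> x < 1 \<Longrightarrow> 0 < H x"
    "\<And>x. 0 \<le> x \<Longrightarrow> x \<le> 1 \<Longrightarrow> (H has_real_derivative H1 x) (at x within {0..1})"
    "continuous_on {0..1} H1"
    "\<And>x. 0 < x \<Longrightarrow> x < 1 \<Longrightarrow> (H1 has_real_derivative H2 x) (at x)"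
    "\<And>x. 0 < x \<Longrightarrow> x < 1 \<Longrightarrow> (H2 has_real_derivative H3 x) (at x)"
    "\<And>x. 0 < x \<Longrightarrow> x < 1 \<Longrightarrow> H x powr (n - 1) * H3 x = B\<^sup>2 * x"
    "H1 0 = 0" "(H1 1)\<^sup>2 = D\<^sup>2 * B powr (2 * tf_alpha n)" "H 1 = 0"
    "(H has_integral 1) {0..1}"
proof -
  from assms obtain H1 H2 H3 where
    "(\<forall>x\<in>{0..1}. (H has_real_derivative H1 x) (at x within {0..1})) \<and>
     continuous_on {0..1} H1 \<and>
     (\<forall>x\<in>{0<..<1}. (H1 has_real_derivative H2 x) (at x)) \<and>
     (\<forall>x\<in>{0<..<1}. (H2 has_real_derivative H3 x) (at x)) \<and>
     continuous_on {0<..<1} H3 \<and>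
     (\<forall>x\<in>{0<..<1}. H x powr (n - 1) * H3 x = B\<^sup>2 * x) \<and>
     H1 0 = 0 \<and> (H1 1)\<^sup>2 = D\<^sup>2 * B powr (2 * tf_alpha n)"
    unfolding tf_solution_def by blast
  then show ?thesis
    by (intro that[of H1 H2 H3]) (use assms in \<open>auto simp: tf_solution_def\<close>)
qed

lemma tf_solutionI:
  assumes "0 \<le> B" "\<And>x. 0 \<le> x \<Longrightarrow> x < 1 \<Longrightarrow> 0 < H x"
    "\<And>x. 0 \<le> x \<Longrightarrow> x \<le> 1 \<Longrightarrow> (H has_real_derivative P x) (at x within {0..1})"
    "continuous_on {0..1} P"
    "\<And>x. 0 < x \<Longrightarrow> x < 1 \<Longrightarrow> (P has_real_derivative Q x) (at x)"
    "\<And>x. 0 < x \<Longrightarrow> x < 1 \<Longrightarrow> (Q has_real_derivative R x) (at x)"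
    "continuous_on {0<..<1} R"
    "\<And>x. 0 < x \<Longrightarrow> x < 1 \<Longrightarrow> H x powr (n - 1) * R x = B\<^sup>2 * x"
    "P 0 = 0" "(P 1)\<^sup>2 = D\<^sup>2 * B powr (2 * tf_alpha n)" "H 1 = 0"
    "(H has_integral 1) {0..1}"
  shows "tf_solution n D B H"
proof -
  have "\<forall>x\<in>{0..<1}. 0 < H x" "\<forall>x\<in>{0..1}. (H has_real_derivative P x) (at x within {0..1})"
    "\<forall>x\<in>{0<..<1}. (P has_real_derivative Q x) (at x)"
    "\<forall>x\<in>{0<..<1}. (Q has_real_derivative R x) (at x)"
    "\<forall>x\<in>{0<..<1}. H x powr (n - 1) * R x = B\<^sup>2 * x"
    using assms by auto
  with assms(1,4,7,9-12) show ?thesis unfolding tf_solution_def by blast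
qed

section \<open>Well-posedness of the initial value problem while the height stays positive\<close>

locale thin_film =
  fixes n :: real
  assumes n1: "1 \<le> n" and n3: "n < 3"
begin

text \<open>The Gronwall factor \<open>exp (K * r)\<close> with \<open>K = 2 + r * L\<close>, where
  \<open>L\<close> is the Lipschitz constant of \<open>s powr (1 - n)\<close> on
  \<open>s \<ge> e\<close>.\<close>

definition gron :: "real \<Rightarrow> real \<Rightarrow> real" where
  "gron r e = exp ((2 + r * ((n - 1) * e powr (-n))) * r)"

lemma gron_ge_1: "0 < r \<Longrightarrow> 1 \<le> gron r e"
  using n1 by (auto simp: gron_def)

text \<open>Let \<open>N\<close> be the squared Euclidean distance of the two states
  \<open>(v, v1, v2)\<close> and \<open>(w, w1, w2)\<close>. Young's inequality and the Lipschitz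
  bound give \<open>N' \<le> K * N\<close>, so \<open>exp (- K * x) * N x\<close> decreases from its
  initial value, the squared difference of the curvatures.\<close>

lemma tsol_gronwall:
  assumes s: "tsol n b r v v1 v2" "tsol n c r w w1 w2" and e: "0 < e"
    and cont: "continuous_on {0..r} v" "continuous_on {0..r} v1" "continuous_on {0..r} v2"
      "continuous_on {0..r} w" "continuous_on {0..r} w1" "continuous_on {0..r} w2"
    and ge: "\<And>x. x \<in> {0..<r} \<Longrightarrow> e \<le> v x" "\<And>x. x \<in> {0..<r} \<Longrightarrow> e \<le> w x"
    and x: "x \<in> {0..r}"
  shows "\<bar>v x - w x\<bar> \<le> gron r e * \<bar>b - c\<bar>" "\<bar>v1 x - w1 x\<bar> \<le> gron r e * \<bar>b - c\<bar>"
    "\<bar>v2 x - w2 x\<bar> \<le> gron r e * \<bar>b - c\<bar>"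
proof -
  define L where "L = (n - 1) * e powr (-n)"
  define K where "K = 2 + r * L"
  define N where "N = (\<lambda>x. (v x - w x)\<^sup>2 + (v1 x - w1 x)\<^sup>2 + (v2 x - w2 x)\<^sup>2)"
  define N' where "N' = (\<lambda>x. 2 * (v x - w x) * (v1 x - w1 x) + 2 * (v1 x - w1 x) * (v2 x - w2 x)
     + 2 * (v2 x - w2 x) * (x * (v x powr (1 - n) - w x powr (1 - n))))"
  have r: "0 < r" using tsolD(1)[OF s(1)] .
  have L: "0 \<le> L" using n1 by (simp add: L_def)
  have N'_le: "N' z \<le> K * N z" if z: "0 < z" "z < r" for z
  proof -
    have "\<bar>z * (v z powr (1 - n) - w z powr (1 - n))\<bar> \<le> r * (L * \<bar>v z - w z\<bar>)"
      unfolding abs_mult L_def using z n1 e ge by (intro mult_mono powr_lipschitz) auto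
    then have "2 * (v2 z - w2 z) * (z * (v z powr (1 - n) - w z powr (1 - n))) \<le> 2 * \<bar>v2 z - w2 z\<bar> * (r * (L * \<bar>v z - w z\<bar>))"
      using abs_ge_self[of "2 * (v2 z - w2 z) * (z * (v z powr (1 - n) - w z powr (1 - n)))"]
        mult_left_mono[of "\<bar>z * (v z powr (1 - n) - w z powr (1 - n))\<bar>" "r * (L * \<bar>v z - w z\<bar>)" "2 * \<bar>v2 z - w2 z\<bar>"]
      unfolding abs_mult by simp
    also have "\<dots> = r * L * (2 * \<bar>v2 z - w2 z\<bar> * \<bar>v z - w z\<bar>)" by simp
    also have "\<dots> \<le> r * L * (\<bar>v2 z - w2 z\<bar>\<^sup>2 + \<bar>v z - w z\<bar>\<^sup>2)"
      using r L by (intro mult_left_mono sum_squares_bound) auto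
    also have "\<dots> \<le> r * L * N z"
      using r L by (intro mult_left_mono) (auto simp: N_def)
    finally have 1: "2 * (v2 z - w2 z) * (z * (v z powr (1 - n) - w z powr (1 - n))) \<le> r * L * N z" .
    have sq: "2 * p * q + 2 * q * s \<le> 2 * (p\<^sup>2 + q\<^sup>2 + s\<^sup>2)" for p q s :: real
      using sum_squares_bound[of p q] sum_squares_bound[of q s] zero_le_power2[of p] zero_le_power2[of s]
      by (simp only: distrib_left)
    have "2 * (v z - w z) * (v1 z - w1 z) + 2 * (v1 z - w1 z) * (v2 z - w2 z) \<le> 2 * N z"
      unfolding N_def by (rule sq)
    with 1 show ?thesis by (simp add: N'_def K_def algebra_simps)
  qed
  have "exp (- K * x) * N x \<le> exp (- K * 0) * N 0"
  proof (rule antimono_of_deriv_nonpos[where f = "\<lambda>z. exp (- K * z) * N z" and f' = "\<lambda>z. exp (- K * z) * (N' z - K * N z)"])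
    show "0 \<le> x" using x by simp
    show "continuous_on {0..x} (\<lambda>z. exp (- K * z) * N z)"
      unfolding N_def using x by (intro continuous_intros; auto intro: continuous_on_subset cont)
    fix z assume "0 < z" "z < x"
    then have z: "0 < z" "z < r" using x by auto
    note d = tsolD(6,7,8)[OF s(1) z] tsolD(6,7,8)[OF s(2) z]
    have sq: "((\<lambda>x. (f x)\<^sup>2) has_real_derivative 2 * f z * D) (at z)"
      if "(f has_real_derivative D) (at z)" for f D
      using DERIV_power[OF that, of 2] by (simp add: mult_ac)
    have "(N has_real_derivative N' z) (at z)"
      unfolding N_def N'_def right_diff_distrib[of z]
      by (intro DERIV_add sq DERIV_diff d)
    then show "((\<lambda>z. exp (- K * z) * N z) has_real_derivative exp (- K * z) * (N' z - K * N z)) (at z)"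
      using DERIV_mult[of "\<lambda>z. exp (- K * z)" "exp (- K * z) * (- K)" z UNIV N "N' z"]
        DERIV_chain2[OF DERIV_exp DERIV_cmult_Id[of "- K" z UNIV]]
      by (simp add: algebra_simps)
    show "exp (- K * z) * (N' z - K * N z) \<le> 0"
      using N'_le[OF z] by (simp add: mult_le_0_iff)
  qed
  moreover have "N 0 = (b - c)\<^sup>2"
    using tsolD(2,3,4)[OF s(1)] tsolD(2,3,4)[OF s(2)] by (simp add: N_def power2_commute)
  ultimately have "N x \<le> exp (K * x) * (b - c)\<^sup>2"
    by (simp add: exp_minus field_simps)
  also have "\<dots> \<le> gron r e * (b - c)\<^sup>2"
    unfolding gron_def K_def L_def using x n1 r by (intro mult_right_mono) (auto intro!: mult_left_mono)
  \<comment> \<open>As \<open>gron r e \<ge> 1\<close>, squaring the factor only enlarges the bound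
    and turns it into a perfect square, ready for taking roots.\<close>
  also have "\<dots> \<le> (gron r e * gron r e) * (b - c)\<^sup>2"
    using gron_ge_1[OF r, of e] by (intro mult_right_mono) auto
  also have "\<dots> = (gron r e * \<bar>b - c\<bar>)\<^sup>2" by (simp add: power2_eq_square)
  finally have *: "N x \<le> (gron r e * \<bar>b - c\<bar>)\<^sup>2" .
  have M: "0 \<le> gron r e * \<bar>b - c\<bar>" using gron_ge_1[OF r, of e] by auto
  have "a\<^sup>2 \<le> N x \<Longrightarrow> \<bar>a\<bar> \<le> gron r e * \<bar>b - c\<bar>" for a
    using * M by (metis abs_le_square_iff abs_of_nonneg order_trans)
  then show "\<bar>v x - w x\<bar> \<le> gron r e * \<bar>b - c\<bar>" "\<bar>v1 x - w1 x\<bar> \<le> gron r e * \<bar>b - c\<bar>"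
    "\<bar>v2 x - w2 x\<bar> \<le> gron r e * \<bar>b - c\<bar>"
    by (auto simp: N_def)
qed

text \<open>On a compact subinterval reaching beyond \<open>x\<close> both solutions have a positive
  minimum, so the Gronwall estimate applies with equal curvatures.\<close>

lemma tsol_unique:
  assumes s: "tsol n b r v v1 v2" "tsol n b r w w1 w2" and x: "0 \<le> x" "x < r"
  shows "v x = w x" "v1 x = w1 x" "v2 x = w2 x"
proof -
  define y where "y = (x + r) / 2"
  have y: "x < y" "y < r" "0 < y" using x by (auto simp: y_def)
  have s': "tsol n b y v v1 v2" "tsol n b y w w1 w2"
    using s y by (auto intro: tsol_restrict)
  have "\<exists>e1>0. \<forall>z\<in>{0..y}. e1 \<le> u z" if u: "tsol n b r u u1 u2" for u u1 u2
  proof -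
    obtain z where z: "z \<in> {0..y}" "\<forall>z'\<in>{0..y}. u z \<le> u z'"
      using continuous_attains_inf[of "{0..y}" u] tsol_cont(1)[OF u, of 0 y] y by auto
    then have "0 < u z" using tsolD(5)[OF u, of z] y by auto
    then show ?thesis using z by auto
  qed
  from this[OF s(1)] this[OF s(2)] obtain e1 e2 where
    e: "0 < e1" "\<forall>z\<in>{0..y}. e1 \<le> v z" "0 < e2" "\<forall>z\<in>{0..y}. e2 \<le> w z" by blast
  have "min e1 e2 \<le> v z" "min e1 e2 \<le> w z" if "z \<in> {0..<y}" for z
    using e that by (auto simp: min_le_iff_disj)
  note g = tsol_gronwall[OF s', of "min e1 e2" x, OF _ tsol_cont[OF s(1), of 0 y] tsol_cont[OF s(2), of 0 y] this]
  show "v x = w x" "v1 x = w1 x" "v2 x = w2 x"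
    using g e y x by auto
qed

text \<open>Cutting the nonlinearity off below height \<open>e\<close> makes it globally Lipschitz.
  The solution of the truncated problem solves the original one until it first reaches height
  \<open>e\<close>.\<close>

lemma tsol_exists:
  assumes e: "0 < e" "e < 1" and R: "0 < R"
  obtains r v v1 v2 where "tsol n b r v v1 v2" "r \<le> R" "\<And>x. x \<in> {0..<r} \<Longrightarrow> e \<le> v x"
    "continuous_on {0..r} v" "continuous_on {0..r} v1" "continuous_on {0..r} v2"
    "r = R \<or> v r = e"
proof -
  define g where "g = (\<lambda>s. max s e powr (1 - n))"
  have "\<bar>g s - g t\<bar> \<le> ((n - 1) * e powr (-n)) * \<bar>s - t\<bar>" for s t
  proof -
    have "\<bar>g s - g t\<bar> \<le> (n - 1) * e powr (-n) * \<bar>max s e - max t e\<bar>"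
      unfolding g_def using n1 e by (intro powr_lipschitz) auto
    also have "\<dots> \<le> (n - 1) * e powr (-n) * \<bar>s - t\<bar>"
      using n1 by (intro mult_left_mono) auto
    finally show ?thesis .
  qed
  moreover have "0 \<le> (n - 1) * e powr (-n)" using n1 by auto
  ultimately obtain v v1 v2 where v: "v 0 = 1" "v1 0 = 0" "v2 0 = - b"
    and d: "\<And>x. x \<in> {0..R} \<Longrightarrow> (v has_real_derivative v1 x) (at x within {0..R})"
      "\<And>x. x \<in> {0..R} \<Longrightarrow> (v1 has_real_derivative v2 x) (at x within {0..R})"
      "\<And>x. x \<in> {0..R} \<Longrightarrow> (v2 has_real_derivative x * g (v x)) (at x within {0..R})"
    using lipschitz_ivp_exists[OF R, of _ g b] by metis
  have cont: "continuous_on {0..R} v" "continuous_on {0..R} v1" "continuous_on {0..R} v2"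
    using DERIV_continuous_on[OF d(1)] DERIV_continuous_on[OF d(2)] DERIV_continuous_on[OF d(3)] by auto
  have "\<exists>r. 0 < r \<and> r \<le> R \<and> (\<forall>x\<in>{0..<r}. e < v x) \<and> (r = R \<or> v r = e)"
  proof (cases "\<forall>x\<in>{0..R}. e < v x")
    case True
    then show ?thesis using R by (intro exI[of _ R]) auto
  next
    case False
    then obtain y where y: "0 \<le> y" "y \<le> R" "v y \<le> e" by (auto simp: not_less)
    have "continuous_on {0..y} (\<lambda>x. e - v x)"
      using y by (intro continuous_intros) (auto intro: continuous_on_subset[OF cont(1)])
    then obtain r where "0 < r" "r \<le> y" "e - v r = 0" "\<And>x. x \<in> {0..<r} \<Longrightarrow> e - v x < 0"
      using first_zero[of 0 y "\<lambda>x. e - v x"] y v e by auto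
    then show ?thesis using y by (intro exI[of _ r]) auto
  qed
  then obtain r where r: "0 < r" "r \<le> R" "\<And>x. x \<in> {0..<r} \<Longrightarrow> e < v x" "r = R \<or> v r = e" by blast
  have at: "at x within {0..R} = at x" if "0 < x" "x < r" for x
    using that r by (intro at_within_interior) auto
  have "tsol n b r v v1 v2"
    unfolding tsol_def
  proof (intro conjI ballI)
    show "continuous_on {0..<r} v" "continuous_on {0..<r} v1" "continuous_on {0..<r} v2"
      using cont r by (auto intro: continuous_on_subset)
    show "0 < v x" if "x \<in> {0..<r}" for x using r(3)[OF that] e by simp
    fix x assume "x \<in> {0<..<r}"
    then have x: "0 < x" "x < r" "x \<in> {0..R}" "e < v x" using r by auto
    show "(v has_real_derivative v1 x) (at x)" "(v1 has_real_derivative v2 x) (at x)"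
      using d[OF x(3)] at[OF x(1,2)] by auto
    show "(v2 has_real_derivative x * v x powr (1 - n)) (at x)"
      using d(3)[OF x(3)] at[OF x(1,2)] x by (auto simp: g_def max_def)
  qed (use r v in auto)
  moreover have "continuous_on {0..r} v" "continuous_on {0..r} v1" "continuous_on {0..r} v2"
    using cont r by (auto intro: continuous_on_subset)
  moreover have "e \<le> v x" if "x \<in> {0..<r}" for x using r(3)[OF that] by simp
  ultimately show ?thesis using that[of r v v1 v2] r(2,4) by blast
qed

text \<open>On a slightly longer interval \<open>{0..R}\<close> the given solution stays above
  \<open>2 * e\<close>. Solutions for nearby \<open>c\<close> are constructed with cut-off height
  \<open>e\<close>, and the Gronwall factor for \<open>{0..R}\<close> bounds their distance from
  \<open>v\<close>.\<close>

lemma tsol_cont_dep: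
  assumes s: "tsol n b r0 v v1 v2" and x0: "0 < x0" "x0 < r0" and eta: "0 < \<eta>"
  obtains \<delta> where "0 < \<delta>"
    "\<And>c. \<bar>c - b\<bar> < \<delta> \<Longrightarrow> \<exists>r w w1 w2. x0 < r \<and> tsol n c r w w1 w2 \<and>
       (\<forall>x\<in>{0..x0}. \<bar>w x - v x\<bar> < \<eta> \<and> \<bar>w1 x - v1 x\<bar> < \<eta> \<and> \<bar>w2 x - v2 x\<bar> < \<eta>)"
proof -
  define R where "R = (x0 + r0) / 2"
  have R: "x0 < R" "R < r0" "0 < R" using x0 by (auto simp: R_def)
  obtain z where z: "z \<in> {0..R}" "\<forall>z'\<in>{0..R}. v z \<le> v z'"
    using continuous_attains_inf[of "{0..R}" v] tsol_cont(1)[OF s, of 0 R] R by auto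
  define e where "e = v z / 2"
  have vz: "0 < v z" "v z \<le> 1" using z R tsolD(5)[OF s, of z] tsolD(2)[OF s] by force+
  have e: "0 < e" "e < 1" using vz by (auto simp: e_def)
  have ve: "2 * e \<le> v y" if "y \<in> {0..R}" for y using z that by (auto simp: e_def)
  define M where "M = gron R e"
  have M: "1 \<le> M" unfolding M_def using R by (intro gron_ge_1) auto
  define d where "d = min \<eta> e / M"
  have d0: "0 < d" using eta e M by (auto simp: d_def)
  show ?thesis
  proof (rule that[OF d0])
    fix c assume c: "\<bar>c - b\<bar> < d"
    then have Mc: "M * \<bar>c - b\<bar> < \<eta>" "M * \<bar>c - b\<bar> < e"
      using M by (auto simp: d_def field_simps)
    obtain r w w1 w2 where w: "tsol n c r w w1 w2" "r \<le> R" "\<And>x. x \<in> {0..<r} \<Longrightarrow> e \<le> w x"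
      "continuous_on {0..r} w" "continuous_on {0..r} w1" "continuous_on {0..r} w2" "r = R \<or> w r = e"
      using tsol_exists[OF e R(3)] by metis
    have r: "0 < r" using tsolD(1)[OF w(1)] .
    have s': "tsol n b r v v1 v2" using s w R r by (auto intro: tsol_restrict)
    have ge: "e \<le> v x" if "x \<in> {0..<r}" for x using ve[of x] that w(2) e by auto
    have "r < r0" using w R by auto
    note g = tsol_gronwall[OF w(1) s' e(1) w(4,5,6) tsol_cont[OF s order_refl \<open>r < r0\<close>] w(3) ge]
    have gM: "gron r e \<le> M"
      unfolding M_def gron_def using w(2) r n1 by (auto intro!: mult_mono add_mono)
    have gc: "gron r e * \<bar>c - b\<bar> \<le> M * \<bar>c - b\<bar>" using gM by (intro mult_right_mono) auto
    \<comment> \<open>Stopping early would put \<open>w\<close> at height \<open>e\<close> while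
      \<open>v\<close> is at least \<open>2 * e\<close>, but the two differ by less than
      \<open>e\<close>.\<close>
    have "r = R"
    proof (rule ccontr)
      assume "r \<noteq> R"
      then have "w r = e" using w by auto
      moreover have "\<bar>w r - v r\<bar> < e" using g(1)[of r] gc Mc r by force
      moreover have "2 * e \<le> v r" using ve[of r] r w by auto
      ultimately show False by auto
    qed
    then have "\<bar>w x - v x\<bar> < \<eta> \<and> \<bar>w1 x - v1 x\<bar> < \<eta> \<and> \<bar>w2 x - v2 x\<bar> < \<eta>" if "x \<in> {0..x0}" for x
      using g[of x] gc Mc that R by force
    then show "\<exists>r w w1 w2. x0 < r \<and> tsol n c r w w1 w2 \<and>
       (\<forall>x\<in>{0..x0}. \<bar>w x - v x\<bar> < \<eta> \<and> \<bar>w1 x - v1 x\<bar> < \<eta> \<and> \<bar>w2 x - v2 x\<bar> < \<eta>)"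
      using w(1) R \<open>r = R\<close> by blast
  qed
qed

section \<open>The energy barrier that keeps solutions steep\<close>

text \<open>Consider the first point \<open>x1\<close> where \<open>v1\<close> touches the line
  \<open>- c * x\<close>. Up to there the loss of the energy \<open>v1^2 / 2 - v * v2\<close> is
  paid for by the decrease of \<open>v powr (3 - n) / (c * (3 - n))\<close>. At \<open>x1\<close>
  the energy is at most \<open>c^2 * x1^2 / 2 + c * v x1\<close>, which is too little by the
  hypothesis at \<open>x0\<close>.\<close>

lemma tsol_energy_barrier:
  assumes s: "tsol n b r v v1 v2" and x0: "0 < x0" "x0 < r" and c: "0 < c"
    and start: "v1 x0 < - c * x0"
    and energy: "v x0 powr (3 - n) / (c * (3 - n)) + c\<^sup>2 * x0\<^sup>2 / 2 + c * v x0 < (v1 x0)\<^sup>2 / 2 - v x0 * v2 x0"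
    and x: "x0 \<le> x" "x < r"
  shows "v1 x < - c * x"
proof (rule ccontr)
  assume "\<not> v1 x < - c * x"
  moreover have "continuous_on {x0..x} (\<lambda>x. v1 x + c * x)"
    using x0 x by (intro continuous_intros tsol_cont[OF s]) auto
  ultimately obtain x1 where x1: "x0 < x1" "x1 \<le> x" "v1 x1 + c * x1 = 0"
    and lt: "\<And>y. y \<in> {x0..<x1} \<Longrightarrow> v1 y + c * y < 0"
    using first_zero[of x0 x "\<lambda>x. v1 x + c * x"] start x(1) by (auto simp: not_less)
  have r: "0 < x1" "x1 < r" using x1 x0 x by auto
  \<comment> \<open>The function \<open>v1 x + c * x\<close> reaches 0 from below at
    \<open>x1\<close>, so its derivative there is not negative.\<close>
  have v2: "- c \<le> v2 x1"
  proof (rule ccontr)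
    assume "\<not> - c \<le> v2 x1"
    moreover have "((\<lambda>x. v1 x + c * x) has_real_derivative v2 x1 + c) (at x1)"
      using tsolD(7)[OF s r] by (auto intro!: derivative_eq_intros)
    ultimately obtain d where d: "0 < d" "\<And>h. 0 < h \<Longrightarrow> h < d \<Longrightarrow> v1 x1 + c * x1 < v1 (x1 - h) + c * (x1 - h)"
      using DERIV_neg_dec_left[of "\<lambda>x. v1 x + c * x" "v2 x1 + c" x1] by auto
    define h where "h = min d (x1 - x0) / 2"
    have h: "0 < h" "h < d" "h \<le> (x1 - x0) / 2" using d x1 by (auto simp: h_def)
    then have "x1 - h \<in> {x0..<x1}" using x1(1) by simp
    then show False using d(2)[of h] h lt[of "x1 - h"] x1(3) by auto
  qed
  have pos: "0 < v y" if "x0 \<le> y" "y \<le> x1" for y using tsolD(5)[OF s, of y] that x0 r by auto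
  \<comment> \<open>Energy minus its largest possible future loss; it increases precisely as long as
    \<open>v1 y \<le> - c * y\<close>.\<close>
  define J where "J = (\<lambda>x. (v1 x)\<^sup>2 / 2 - v x * v2 x - v x powr (3 - n) / (c * (3 - n)))"
  have "J x0 \<le> J x1"
  proof (rule mono_of_deriv_nonneg[where f = J and f' = "\<lambda>y. v y powr (2 - n) * (- v1 y / c - y)"])
    show "continuous_on {x0..x1} J"
      unfolding J_def using c n3 pos x0 r
      by (intro continuous_intros tsol_cont[OF s]) (auto simp: less_imp_neq[THEN not_sym])
    fix y assume y': "x0 < y" "y < x1"
    then have y: "0 < y" "y < r" "0 < v y" using x0 r pos[of y] by auto
    note d = tsolD(6,7,8)[OF s y(1,2)]
    have sq: "((\<lambda>x. (v1 x)\<^sup>2 / 2) has_real_derivative v1 y * v2 y) (at y)"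
      using DERIV_cdivide[OF DERIV_power[OF d(2), of 2], of 2] by (simp add: mult_ac)
    have pw: "((\<lambda>x. v x powr (3 - n) / (c * (3 - n))) has_real_derivative v y powr (2 - n) * v1 y / c) (at y)"
      using DERIV_cdivide[OF DERIV_chain2[OF has_real_derivative_powr[OF y(3), of "3 - n"] d(1)], of "c * (3 - n)"] n3 c
      by simp
    have eq: "v y powr (2 - n) = v y * v y powr (1 - n)"
      using powr_mult_base[of "v y" "1 - n"] y by simp
    show "(J has_real_derivative v y powr (2 - n) * (- v1 y / c - y)) (at y)"
      unfolding J_def
      by (rule DERIV_cong[OF DERIV_diff[OF DERIV_diff[OF sq DERIV_mult[OF d(1) d(3)]] pw]])
        (simp add: eq algebra_simps)
    have "v1 y + c * y < 0" using lt[of y] y' by auto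
    then show "0 \<le> v y powr (2 - n) * (- v1 y / c - y)"
      using c by (intro mult_nonneg_nonneg) (auto simp: field_simps)
  qed (use x1 in auto)
  moreover have "0 \<le> v x1 powr (3 - n) / (c * (3 - n))" using c n3 by auto
  moreover have "(v1 x1)\<^sup>2 = c\<^sup>2 * x1\<^sup>2"
    using x1(3) by (metis add.commute add.right_neutral add_diff_cancel_left' diff_0 power2_minus power_mult_distrib)
  moreover have "- v x1 * v2 x1 \<le> c * v x1"
    using mult_left_mono[OF v2, of "v x1"] pos[of x1] x1 by (simp add: mult_ac)
  ultimately have "(v1 x0)\<^sup>2 / 2 - v x0 * v2 x0 - v x0 powr (3 - n) / (c * (3 - n)) \<le> c\<^sup>2 * x1\<^sup>2 / 2 + c * v x1"
    unfolding J_def by linarith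
  \<comment> \<open>The bound on the energy at \<open>x1\<close> is moved back to \<open>x0\<close>:
    it is \<open>c\<close> times a quantity that decreases while \<open>v1\<close> lies below the
    line.\<close>
  moreover have "v x1 + c * x1\<^sup>2 / 2 \<le> v x0 + c * x0\<^sup>2 / 2"
  proof (rule antimono_of_deriv_nonpos[where f = "\<lambda>x. v x + c * x\<^sup>2 / 2" and f' = "\<lambda>x. v1 x + c * x"])
    show "continuous_on {x0..x1} (\<lambda>x. v x + c * x\<^sup>2 / 2)"
      using x0 r by (intro continuous_intros tsol_cont[OF s]) auto
    fix y assume y': "x0 < y" "y < x1"
    then have y: "0 < y" "y < r" using x0 r by auto
    show "((\<lambda>x. v x + c * x\<^sup>2 / 2) has_real_derivative v1 y + c * y) (at y)"
      using tsolD(6)[OF s y] by (auto intro!: derivative_eq_intros)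
    show "v1 y + c * y \<le> 0" using lt[of y] y' by auto
  qed (use x1 in auto)
  then have "c * (v x1 + c * x1\<^sup>2 / 2) \<le> c * (v x0 + c * x0\<^sup>2 / 2)" using c by (intro mult_left_mono) auto
  then have "c\<^sup>2 * x1\<^sup>2 / 2 + c * v x1 \<le> c\<^sup>2 * x0\<^sup>2 / 2 + c * v x0"
    by (simp add: algebra_simps power2_eq_square)
  ultimately show False using energy by linarith
qed

text \<open>At the centre the energy is \<open>b\<close> and \<open>v = 1\<close>, so the condition
  of the barrier reads \<open>1 / (c * (3 - n)) + c < b\<close> in the limit. By continuity it holds
  at a small \<open>x0 > 0\<close>; the barrier cannot start at 0 itself, where \<open>v1\<close>
  equals \<open>- c * x\<close>.\<close>

lemma tsol_steep:
  assumes s: "tsol n b r v v1 v2" and c: "0 < c" and b: "1 / (c * (3 - n)) + c < b"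
    and x: "0 < x" "x < r"
  shows "v1 x < - c * x"
proof -
  define G where "G = (\<lambda>x0. (v1 x0)\<^sup>2 / 2 - v x0 * v2 x0 - (v x0 powr (3 - n) / (c * (3 - n)) + c\<^sup>2 * x0\<^sup>2 / 2 + c * v x0))"
  \<comment> \<open>Positivity of \<open>M\<close> combines the energy condition with
    \<open>v2 < - c\<close>; the latter makes \<open>v1\<close> drop below the line
    \<open>- c * x\<close>.\<close>
  define M where "M = (\<lambda>x0. min (G x0) (- (v2 x0 + c)))"
  have pos: "0 < v y" if "0 \<le> y" "y \<le> x" for y using tsolD(5)[OF s, of y] that x by auto
  have "continuous_on {0..x} M"
    unfolding M_def G_def using c n3 pos x
    by (intro continuous_intros tsol_cont[OF s]) (auto simp: less_imp_neq[THEN not_sym])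
  moreover have "0 < 1 / (c * (3 - n))" using c n3 by simp
  then have "0 < M 0" using b tsolD(2,3,4)[OF s] by (auto simp: M_def G_def)
  ultimately have "\<exists>d>0. \<forall>y\<in>{0..x}. dist y 0 < d \<longrightarrow> dist (M y) (M 0) < M 0"
    using x unfolding continuous_on_iff by force
  then obtain d where d: "0 < d" "\<And>y. 0 \<le> y \<Longrightarrow> y \<le> x \<Longrightarrow> y < d \<Longrightarrow> 0 < M y"
    by (force simp: dist_real_def abs_if split: if_splits)
  define x0 where "x0 = min d x / 2"
  have x0: "0 < x0" "x0 < d" "x0 < x" using d x by (auto simp: x0_def)
  have "v1 x0 + c * x0 < v1 0 + c * 0"
  proof (rule strict_antimono_of_deriv_neg[where f = "\<lambda>x. v1 x + c * x" and f' = "\<lambda>x. v2 x + c"])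
    show "continuous_on {0..x0} (\<lambda>x. v1 x + c * x)"
      using x0 x by (intro continuous_intros tsol_cont[OF s]) auto
    fix y assume y': "0 < y" "y < x0"
    then show "((\<lambda>x. v1 x + c * x) has_real_derivative v2 y + c) (at y)"
      using tsolD(7)[OF s, of y] x0 x by (auto intro!: derivative_eq_intros)
    show "v2 y + c < 0" using d(2)[of y] y' x0 by (auto simp: M_def)
  qed (use x0 in auto)
  then have "v1 x0 < - c * x0" using tsolD(3)[OF s] by simp
  moreover have "0 < G x0" using d(2)[of x0] x0 by (auto simp: M_def)
  ultimately show ?thesis
    using tsol_energy_barrier[OF s x0(1) _ c, of x] x0 x by (auto simp: G_def)
qed

section \<open>Profiles up to the contact point\<close>

text \<open>The alternative to a contact point: profiles exist for exactly those \<open>b\<close>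
  for which this fails (\<open>not_rebounds_prof\<close>, \<open>prof_not_rebounds\<close>).\<close>

definition rebounds :: "real \<Rightarrow> bool" where
  "rebounds b \<longleftrightarrow> (\<exists>r v v1 v2 x. tsol n b r v v1 v2 \<and> 0 \<le> x \<and> x < r \<and> 0 < v1 x)"

lemma not_rebounds_v1:
  assumes "\<not> rebounds b" "tsol n b r v v1 v2" "0 \<le> x" "x < r"
  shows "v1 x \<le> 0"
  using assms unfolding rebounds_def by (meson not_less)

lemma tsol_v1_pos_if_nonpos:
  assumes s: "tsol n b r v v1 v2" and b: "b \<le> 0" and x: "0 < x" "x < r"
  shows "0 < v1 x"
proof -
  have "0 < v2 (x / 2)" using tsol_v2_strict_mono[OF s, of 0 "x / 2"] tsolD(4)[OF s] b x by auto
  then have "0 < v2 (x / 2) * (x - x / 2)" using x by auto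
  moreover have "0 \<le> - b * (x / 2)" using b x by (auto simp: mult_nonpos_nonneg)
  ultimately show ?thesis
    using tsol_v1_chord[OF s, of "x / 2" x] tsol_v1_ge[OF s, of "x / 2"] x by linarith
qed

lemma rebounds_nonpos:
  assumes "b \<le> 0" shows "rebounds b"
proof -
  obtain r v v1 v2 where s: "tsol n b r v v1 v2"
    by (rule tsol_exists[of "1/2" 1 b]) auto
  have "0 < v1 (r / 2)" using tsol_v1_pos_if_nonpos[OF s assms, of "r / 2"] tsolD(1)[OF s] by auto
  then show ?thesis unfolding rebounds_def using s tsolD(1)[OF s]
    by (intro exI[of _ r] exI[of _ v] exI[of _ v1] exI[of _ v2] exI[of _ "r / 2"]) auto
qed

lemma tsol_antimono:
  assumes s: "tsol n b r v v1 v2" and le: "\<And>z. x < z \<Longrightarrow> z < y \<Longrightarrow> v1 z \<le> 0"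
    and xy: "0 \<le> x" "x \<le> y" "y < r"
  shows "v y \<le> v x"
proof (rule antimono_of_deriv_nonpos[where f = v and f' = v1])
  show "continuous_on {x..y} v" using tsol_cont(1)[OF s] xy by auto
  show "(v has_real_derivative v1 z) (at z)" if "x < z" "z < y" for z
    using tsolD(6)[OF s, of z] that xy by auto
qed (use xy le in auto)

text \<open>Without a rebound \<open>v \<le> 1\<close>, so the third derivative is at least
  \<open>x\<close>. Two integrations give \<open>v1 x \<ge> x^3 / 6 - b * x\<close>, which is
  positive once \<open>x^2 > 6 * b\<close>, in particular at \<open>x = 6 * b + 1\<close>.\<close>

lemma not_rebounds_length:
  assumes nr: "\<not> rebounds b" and s: "tsol n b r v v1 v2"
  shows "r \<le> 6 * b + 1"
proof (rule ccontr)
  assume *: "\<not> r \<le> 6 * b + 1"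
  have b: "0 < b" using rebounds_nonpos[of b] nr by (meson not_less)
  define x where "x = 6 * b + 1"
  have x: "0 < x" "x < r" using * b by (auto simp: x_def)
  note neg = not_rebounds_v1[OF nr s]
  have v1: "v y \<le> 1" if "0 \<le> y" "y < r" for y
    using tsol_antimono[OF s, of 0 y] neg that tsolD(2)[OF s] by auto
  have v2: "- b + y\<^sup>2 / 2 \<le> v2 y" if y: "0 \<le> y" "y < r" for y
  proof -
    have "v2 0 - 0\<^sup>2 / 2 \<le> v2 y - y\<^sup>2 / 2"
    proof (rule mono_of_deriv_nonneg[where f = "\<lambda>y. v2 y - y\<^sup>2 / 2" and f' = "\<lambda>y. y * v y powr (1 - n) - y"])
      show "continuous_on {0..y} (\<lambda>y. v2 y - y\<^sup>2 / 2)"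
        using y by (intro continuous_intros tsol_cont[OF s]) auto
      fix z assume z: "0 < z" "z < y"
      show "((\<lambda>y. v2 y - y\<^sup>2 / 2) has_real_derivative z * v z powr (1 - n) - z) (at z)"
        using tsolD(8)[OF s, of z] z y by (auto intro!: derivative_eq_intros)
      have "1 powr (1 - n) \<le> v z powr (1 - n)"
        using tsolD(5)[OF s, of z] v1[of z] z y n1 by (intro powr_mono2') auto
      then show "0 \<le> z * v z powr (1 - n) - z" using z by simp
    qed (use y in auto)
    then show ?thesis using tsolD(4)[OF s] by simp
  qed
  have "v1 0 + b * 0 - 0 ^ 3 / 6 \<le> v1 x + b * x - x ^ 3 / 6"
  proof (rule mono_of_deriv_nonneg[where f = "\<lambda>y. v1 y + b * y - y ^ 3 / 6" and f' = "\<lambda>y. v2 y + b - y\<^sup>2 / 2"])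
    show "continuous_on {0..x} (\<lambda>y. v1 y + b * y - y ^ 3 / 6)"
      using x by (intro continuous_intros tsol_cont[OF s]) auto
    fix z assume z: "0 < z" "z < x"
    show "((\<lambda>y. v1 y + b * y - y ^ 3 / 6) has_real_derivative v2 z + b - z\<^sup>2 / 2) (at z)"
      using tsolD(7)[OF s, of z] z x by (auto intro!: derivative_eq_intros)
    show "0 \<le> v2 z + b - z\<^sup>2 / 2" using v2[of z] z x by auto
  qed (use x in auto)
  moreover have "x * (x\<^sup>2 - 6 * b) / 6 = x ^ 3 / 6 - b * x"
    by (simp add: power2_eq_square power3_eq_cube field_simps)
  moreover have "0 < x * (x\<^sup>2 - 6 * b) / 6"
    using x b by (auto simp: x_def power2_eq_square algebra_simps intro!: mult_pos_pos add_pos_pos)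
  ultimately have "0 < v1 x" using tsolD(3)[OF s] by simp
  then show False using neg[of x] x by auto
qed

text \<open>Solutions together with their contact point \<open>X\<close>. Continuity up to
  \<open>X\<close> is asked of \<open>v\<close> and \<open>v1\<close> but not of \<open>v2\<close>,
  which may blow up there.\<close>

definition prof :: "real \<Rightarrow> real \<Rightarrow> (real \<Rightarrow> real) \<Rightarrow> (real \<Rightarrow> real) \<Rightarrow> (real \<Rightarrow> real) \<Rightarrow> bool" where
  "prof b X v v1 v2 \<longleftrightarrow> tsol n b X v v1 v2 \<and> continuous_on {0..X} v \<and> continuous_on {0..X} v1 \<and> v X = 0"

text \<open>Solve down to the heights \<open>e k\<close>, which tend to 0. By uniqueness these
  solutions extend each other, and their lengths increase to a finite \<open>X\<close>. Monotonicity
  of \<open>v\<close> gives the limit 0 at \<open>X\<close>; \<open>v1 + b * x\<close> is increasing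
  and bounded above, so \<open>v1\<close> has a limit as well.\<close>

lemma not_rebounds_prof:
  assumes nr: "\<not> rebounds b"
  obtains X v v1 v2 where "prof b X v v1 v2"
proof -
  define e where "e = (\<lambda>k::nat. 1 / (real k + 2))"
  have e: "0 < e k" "e k < 1" "e (Suc k) < e k" for k
    by (auto simp: e_def divide_simps)
  have b: "0 < b" using rebounds_nonpos[of b] nr by (meson not_less)
  \<comment> \<open>The existence interval \<open>6 * b + 2\<close> exceeds the a priori length
    \<open>6 * b + 1\<close>, so the solution must stop by reaching height
    \<open>e k\<close>.\<close>
  have "\<exists>r v v1 v2. tsol n b r v v1 v2 \<and> (\<forall>x\<in>{0..<r}. e k \<le> v x) \<and> continuous_on {0..r} v \<and> v r = e k" for k
  proof -
    obtain r v v1 v2 where s: "tsol n b r v v1 v2" "r \<le> 6 * b + 2" "\<And>x. x \<in> {0..<r} \<Longrightarrow> e k \<le> v x"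
      "continuous_on {0..r} v" "r = 6 * b + 2 \<or> v r = e k"
      by (rule tsol_exists[OF e(1)[of k] e(2)[of k], of "6 * b + 2" b]) (use b in auto)
    moreover have "r \<noteq> 6 * b + 2" using not_rebounds_length[OF nr s(1)] by auto
    ultimately show ?thesis by blast
  qed
  then obtain r V V1 V2 where s: "\<And>k. tsol n b (r k) (V k) (V1 k) (V2 k)"
    and ge: "\<And>k x. 0 \<le> x \<Longrightarrow> x < r k \<Longrightarrow> e k \<le> V k x"
    and cont: "\<And>k. continuous_on {0..r k} (V k)" and hit: "\<And>k. V k (r k) = e k"
    by (metis atLeastLessThan_iff)
  have r0: "0 < r k" for k using tsolD(1)[OF s] .
  have agree: "V j x = V k x" "V1 j x = V1 k x" "V2 j x = V2 k x" if "0 \<le> x" "x < r j" "x < r k" for j k x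
    using tsol_unique[OF tsol_restrict[OF s[of j], of "min (r j) (r k)"] tsol_restrict[OF s[of k], of "min (r j) (r k)"], of x]
      r0 that by auto
  have r_less: "r k < r (Suc k)" for k
  proof (rule ccontr)
    assume "\<not> r k < r (Suc k)"
    then have le: "r (Suc k) \<le> r k" by simp
    have "e k \<le> V (Suc k) (r (Suc k))"
    proof (rule le_at_endpoint[of 0 _ "\<lambda>_. e k" "V (Suc k)"])
      fix x assume x: "0 < x" "x < r (Suc k)"
      then show "e k \<le> V (Suc k) x" using ge[of x k] agree(1)[of x k "Suc k"] le by auto
    qed (use r0 cont in auto)
    then show False using hit[of "Suc k"] e(3)[of k] by simp
  qed
  have bdd: "bdd_above (range r)"
    using not_rebounds_length[OF nr s] by (intro bdd_aboveI[of _ "6 * b + 1"]) auto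
  define X where "X = (SUP k. r k)"
  have rX: "r k < X" for k
    using r_less[of k] cSUP_upper[OF UNIV_I bdd, of "Suc k"] by (auto simp: X_def)
  have ex: "\<exists>k. x < r k" if "x < X" for x
    using that less_cSUP_iff[OF _ bdd] by (auto simp: X_def)
  define idx where "idx = (\<lambda>x. LEAST k. x < r k)"
  have idx: "x < r (idx x)" if "x < X" for x
    unfolding idx_def using ex[OF that] by (rule LeastI_ex)
  \<comment> \<open>At \<open>X\<close> the value is set to 0, the limit established in
    \<open>lim0\<close>.\<close>
  define v where "v = (\<lambda>x. if x < X then V (idx x) x else 0)"
  define v1 where "v1 = (\<lambda>x. V1 (idx x) x)"
  define v2 where "v2 = (\<lambda>x. V2 (idx x) x)"
  have vk: "v x = V k x" "v1 x = V1 k x" "v2 x = V2 k x" if "0 \<le> x" "x < r k" for x k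
    using agree[of x "idx x" k] idx[of x] rX[of k] that by (auto simp: v_def v1_def v2_def)
  have sk: "tsol n b (r k) v v1 v2" for k
    by (rule tsol_cong[OF s]) (use vk in auto)
  have X0: "0 < X" using r0 rX less_trans by blast
  have c: "continuous_on {0..y} v" "continuous_on {0..y} v1" "continuous_on {0..y} v2" if y: "y < X" for y
  proof -
    obtain k where "y < r k" using ex[OF y] by blast
    then show "continuous_on {0..y} v" "continuous_on {0..y} v1" "continuous_on {0..y} v2"
      using tsol_cont[OF sk] by auto
  qed
  have tX: "tsol n b X v v1 v2"
    unfolding tsol_def
  proof (intro conjI ballI)
    show "continuous_on {0..<X} v" "continuous_on {0..<X} v1" "continuous_on {0..<X} v2"
      by (intro continuous_on_Ico_if_Icc c; assumption)+
    show "0 < v x" if "x \<in> {0..<X}" for x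
      using ex[of x] tsolD(5)[OF sk, of x] that by auto
    show "(v has_real_derivative v1 x) (at x)" "(v1 has_real_derivative v2 x) (at x)"
      "(v2 has_real_derivative x * v x powr (1 - n)) (at x)" if "x \<in> {0<..<X}" for x
      using ex[of x] tsolD(6,7,8)[OF sk, of x] that by auto
  qed (use X0 tsolD(2,3,4)[OF sk] in auto)
  note neg = not_rebounds_v1[OF nr tX]
  have vr: "v (r k) = e k" for k
  proof -
    have "V (Suc k) (r k) = V k (r k)"
      by (rule eq_at_endpoint[of 0 "r k"])
        (use r0 r_less[of k] agree(1)[of _ "Suc k" k] cont in \<open>auto intro: continuous_on_subset[OF cont]\<close>)
    then show ?thesis using vk(1)[of "r k" "Suc k"] r0[of k] r_less[of k] hit by simp
  qed
  have lim0: "(v \<longlongrightarrow> 0) (at_left X)"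
  proof (rule order_tendstoI)
    fix a :: real assume "a < 0"
    show "\<forall>\<^sub>F x in at_left X. a < v x"
      unfolding eventually_at_left[OF X0]
      using tsolD(5)[OF tX] \<open>a < 0\<close> X0 by (intro exI[of _ 0]) (auto intro: less_trans)
  next
    fix a :: real assume "0 < a"
    obtain k :: nat where "1 / a < real k" using reals_Archimedean2 by blast
    then have "1 / a < real k + 2" by simp
    then have "e k < a" using \<open>0 < a\<close> by (simp add: e_def field_simps)
    moreover have "v x \<le> v (r k)" if "r k < x" "x < X" for x
      using tsol_antimono[OF tX, of "r k" x] neg that r0[of k] by auto
    ultimately show "\<forall>\<^sub>F x in at_left X. v x < a"
      unfolding eventually_at_left[OF X0] using rX[of k] vr[of k] by (intro exI[of _ "r k"]) force
  qed
  define S where "S = (\<lambda>x. v1 x + b * x) ` {0..<X}"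
  have "S \<noteq> {}" using X0 by (auto simp: S_def)
  have bddS: "bdd_above S"
    unfolding S_def
  proof (intro bdd_aboveI2[of _ _ "b * X"])
    fix x assume "x \<in> {0..<X}"
    then have "v1 x \<le> 0" "b * x \<le> b * X" using neg[of x] b by auto
    then show "v1 x + b * x \<le> b * X" by simp
  qed
  define L where "L = Sup S"
  have lim1: "((\<lambda>x. v1 x + b * x) \<longlongrightarrow> L) (at_left X)"
  proof (rule increasing_tendsto)
    show "\<forall>\<^sub>F x in at_left X. v1 x + b * x \<le> L"
      unfolding eventually_at_left[OF X0] L_def S_def
      using X0 bddS by (intro exI[of _ 0]) (auto simp: S_def intro!: cSup_upper)
    fix a assume "a < L"
    then obtain y where y: "0 \<le> y" "y < X" "a < v1 y + b * y"
      using less_cSup_iff[OF \<open>S \<noteq> {}\<close> bddS] by (auto simp: L_def S_def)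
    show "\<forall>\<^sub>F x in at_left X. a < v1 x + b * x"
      unfolding eventually_at_left[OF X0]
    proof (intro exI[of _ y] conjI allI impI)
      fix x assume "y < x" "x < X"
      then show "a < v1 x + b * x" using tsol_v1_plus_mono[OF tX, of y x] y by auto
    qed (use y in auto)
  qed
  \<comment> \<open>At \<open>X\<close> the glued \<open>v1\<close> has an arbitrary value, which is
    replaced by the limit.\<close>
  define w1 where "w1 = v1(X := L - b * X)"
  have "((\<lambda>x. (v1 x + b * x) - b * x) \<longlongrightarrow> L - b * X) (at_left X)"
    by (intro tendsto_intros lim1)
  then have lim2: "(v1 \<longlongrightarrow> w1 X) (at_left X)" by (simp add: w1_def)
  have lim2': "(w1 \<longlongrightarrow> w1 X) (at_left X)"
    by (rule Lim_transform_eventually[OF lim2]) (auto simp: w1_def eventually_at_left[OF X0] intro!: exI[of _ 0] X0)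
  have t1: "tsol n b X v w1 v2" by (rule tsol_cong[OF tX]) (auto simp: w1_def)
  have clos: "continuous_on {0..X} f" if f: "continuous_on {0..<X} f" "(f \<longlongrightarrow> f X) (at_left X)" for f :: "real \<Rightarrow> real"
  proof (rule continuous_on_IccI)
    have "continuous_on {0..X/2} f" using f X0 by (auto intro: continuous_on_subset)
    then show "(f \<longlongrightarrow> f 0) (at_right 0)" using X0 by (auto intro: continuous_on_Icc_at_rightD)
    have "continuous_on {0<..<X} f" using f by (auto intro: continuous_on_subset)
    then show "f \<midarrow>x\<rightarrow> f x" if "0 < x" "x < X" for x
      using that by (simp add: continuous_on_eq_continuous_at isCont_def)
  qed (use X0 f in auto)
  have "prof b X v w1 v2"
    unfolding prof_def
    using t1 clos[of v] clos[of w1] lim0 lim2' by (auto simp: tsol_def v_def)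
  then show ?thesis by (rule that)
qed

section \<open>Uniqueness, monotonicity and range of profiles\<close>

lemma profD:
  assumes "prof b X v v1 v2"
  shows "tsol n b X v v1 v2" "continuous_on {0..X} v" "continuous_on {0..X} v1" "v X = 0" "0 < X"
  using assms tsolD(1) unfolding prof_def by auto

text \<open>A solution positive beyond \<open>X\<close> would agree with \<open>v\<close> up to
  \<open>X\<close> and hence vanish there.\<close>

lemma tsol_prof_length:
  assumes p: "prof b X v v1 v2" and s: "tsol n b r w w1 w2"
  shows "r \<le> X"
proof (rule ccontr)
  assume "\<not> r \<le> X"
  then have r: "X < r" by simp
  have "w X = v X"
  proof (rule eq_at_endpoint[of 0 X w v])
    fix x assume "0 < x" "x < X"
    then show "w x = v x"
      using tsol_unique(1)[OF tsol_restrict[OF s, of X] profD(1)[OF p], of x] r profD(5)[OF p] by auto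
  qed (use profD[OF p] tsol_cont(1)[OF s order_refl r] in auto)
  then show False using tsolD(5)[OF s, of X] r profD(4,5)[OF p] by auto
qed

text \<open>Once positive, \<open>v1\<close> stays positive, so \<open>v\<close> would increase all
  the way to the contact point, where it is 0.\<close>

lemma prof_v1_nonpos:
  assumes p: "prof b X v v1 v2" and x: "0 \<le> x" "x < X"
  shows "v1 x \<le> 0"
proof (rule ccontr)
  assume "\<not> v1 x \<le> 0"
  then have pos: "0 < v1 x" by simp
  note s = profD(1)[OF p]
  have "v x \<le> v X"
  proof (rule mono_of_deriv_nonneg[where f = v and f' = v1])
    show "continuous_on {x..X} v" using profD(2)[OF p] x by (auto intro: continuous_on_subset)
    show "(v has_real_derivative v1 z) (at z)" "0 \<le> v1 z" if "x < z" "z < X" for z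
      using tsolD(6)[OF s, of z] tsol_v1_stays_pos[OF s x(1) _ _ pos, of z] that x by auto
  qed (use x in auto)
  then show False using tsolD(5)[OF s, of x] profD(4)[OF p] x by auto
qed

lemma prof_not_rebounds:
  assumes p: "prof b X v v1 v2"
  shows "\<not> rebounds b"
proof
  assume "rebounds b"
  then obtain r w w1 w2 x where w: "tsol n b r w w1 w2" "0 \<le> x" "x < r" "0 < w1 x"
    unfolding rebounds_def by blast
  have "r \<le> X" by (rule tsol_prof_length[OF p w(1)])
  then have "v1 x = w1 x"
    using tsol_unique(2)[OF w(1) tsol_restrict[OF profD(1)[OF p]], of x] w tsolD(1)[OF w(1)] by auto
  then show False using prof_v1_nonpos[OF p, of x] w \<open>r \<le> X\<close> by auto
qed

lemma prof_b_pos: "prof b X v v1 v2 \<Longrightarrow> 0 < b"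
  using prof_not_rebounds rebounds_nonpos by (meson not_less)

lemma prof_unique:
  assumes p: "prof b X v v1 v2" and q: "prof b Y w w1 w2"
  shows "Y = X" "\<And>x. 0 \<le> x \<Longrightarrow> x \<le> X \<Longrightarrow> w x = v x" "\<And>x. 0 \<le> x \<Longrightarrow> x \<le> X \<Longrightarrow> w1 x = v1 x"
proof -
  show YX: "Y = X"
    using tsol_prof_length[OF p profD(1)[OF q]] tsol_prof_length[OF q profD(1)[OF p]] by simp
  note u = tsol_unique[OF profD(1)[OF q] profD(1)[OF p, folded YX], unfolded YX]
  fix x assume x: "0 \<le> x" "x \<le> X"
  show "w x = v x"
  proof (cases "x = X")
    case True
    then show ?thesis using profD(4)[OF p] profD(4)[OF q] YX by simp
  qed (use u x in auto)
  show "w1 x = v1 x"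
  proof (cases "x = X")
    case True
    have "w1 X = v1 X"
      by (rule eq_at_endpoint[of 0 X w1 v1]) (use u x profD[OF p] profD[OF q] YX in auto)
    then show ?thesis using True by simp
  qed (use u x in auto)
qed

text \<open>At an interior zero of \<open>v1\<close>, a positive \<open>v2\<close> would make
  \<open>v1\<close> positive just after. If \<open>v2 x \<le> 0\<close>, then \<open>v2\<close> is
  negative before \<open>x\<close> and \<open>v1\<close> has already fallen strictly below
  0.\<close>

lemma prof_v1_neg:
  assumes p: "prof b X v v1 v2" and x: "0 < x" "x < X"
  shows "v1 x < 0"
proof (rule ccontr)
  assume "\<not> v1 x < 0"
  then have v1x: "v1 x = 0" using prof_v1_nonpos[OF p, of x] x by auto
  note s = profD(1)[OF p]
  have *: "v2 x \<le> 0"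
  proof (rule ccontr)
    assume "\<not> v2 x \<le> 0"
    then have "0 < v2 x * ((x + X) / 2 - x)" using x by (intro mult_pos_pos) auto
    then have "0 < v1 ((x + X) / 2)" using tsol_v1_chord[OF s, of x "(x + X) / 2"] v1x x by auto
    then show False using prof_v1_nonpos[OF p, of "(x + X) / 2"] x by auto
  qed
  have "v1 x < v1 0"
  proof (rule strict_antimono_of_deriv_neg[where f = v1 and f' = v2])
    show "continuous_on {0..x} v1" using tsol_cont(2)[OF s] x by auto
    show "(v1 has_real_derivative v2 z) (at z)" "v2 z < 0" if "0 < z" "z < x" for z
      using tsolD(7)[OF s, of z] tsol_v2_strict_mono[OF s, of z x] that x * by auto
  qed (use x in auto)
  then show False using v1x tsolD(3)[OF s] by simp
qed

lemma prof_strict_antimono: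
  assumes p: "prof b X v v1 v2" and x: "0 \<le> x" "x < y" "y \<le> X"
  shows "v y < v x"
proof (rule strict_antimono_of_deriv_neg[where f = v and f' = v1])
  show "continuous_on {x..y} v" using profD(2)[OF p] x by (auto intro: continuous_on_subset)
  show "(v has_real_derivative v1 z) (at z)" "v1 z < 0" if "x < z" "z < y" for z
    using tsolD(6)[OF profD(1)[OF p], of z] prof_v1_neg[OF p, of z] that x by auto
qed (use x in auto)

lemma prof_range:
  assumes p: "prof b X v v1 v2" and x: "0 \<le> x" "x \<le> X"
  shows "0 \<le> v x" "v x \<le> 1"
  using prof_strict_antimono[OF p, of x X] prof_strict_antimono[OF p, of 0 x] x
    profD(4)[OF p] tsolD(2)[OF profD(1)[OF p]]
  by (cases "x = X"; cases "x = 0"; auto)+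

lemma prof_v1_end_nonpos:
  assumes p: "prof b X v v1 v2"
  shows "v1 X \<le> 0"
  by (rule le_at_endpoint[of 0 X v1 "\<lambda>_. 0"]) (use profD[OF p] prof_v1_nonpos[OF p] in auto)

section \<open>Comparison of profiles level by level\<close>

text \<open>The position \<open>\<xi> u\<close> at which the profile has height \<open>u\<close>. It
  is differentiable only strictly between the heights 0 and 1, since \<open>v1\<close> vanishes at
  the centre and possibly at the contact point.\<close>

lemma prof_inverse:
  assumes p: "prof b X v v1 v2"
  obtains \<xi> where "continuous_on {0..1} \<xi>" "\<xi> 0 = X" "\<xi> 1 = 0"
    "\<And>x. 0 \<le> x \<Longrightarrow> x \<le> X \<Longrightarrow> \<xi> (v x) = x"
    "\<And>u. 0 < u \<Longrightarrow> u < 1 \<Longrightarrow> 0 < \<xi> u \<and> \<xi> u < X \<and> v (\<xi> u) = u"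
    "\<And>u. 0 < u \<Longrightarrow> u < 1 \<Longrightarrow> (\<xi> has_real_derivative 1 / v1 (\<xi> u)) (at u)"
proof -
  note s = profD(1)[OF p] and X = profD(5)[OF p]
  have inj: "inj_on v {0..X}"
    by (intro linorder_inj_onI) (use prof_strict_antimono[OF p] in force)+
  define \<xi> where "\<xi> = inv_into {0..X} v"
  have inv: "\<xi> (v x) = x" if "0 \<le> x" "x \<le> X" for x
    unfolding \<xi>_def using inj that by (intro inv_into_f_f) auto
  have img: "v ` {0..X} = {0..1}"
  proof
    show "v ` {0..X} \<subseteq> {0..1}" using prof_range[OF p] by auto
    show "{0..1} \<subseteq> v ` {0..X}"
    proof
      fix u :: real assume "u \<in> {0..1}"
      then have "\<exists>x\<ge>0. x \<le> X \<and> v x = u"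
        using profD[OF p] tsolD(2)[OF s] by (intro IVT2') auto
      then show "u \<in> v ` {0..X}" by auto
    qed
  qed
  have cont: "continuous_on {0..1} \<xi>"
    using continuous_on_inv[of "{0..X}" v \<xi>] profD(2)[OF p] inv img by auto
  have ends: "\<xi> 0 = X" "\<xi> 1 = 0"
    using inv[of X] inv[of 0] profD(4)[OF p] tsolD(2)[OF s] X by auto
  have mid: "0 < \<xi> u \<and> \<xi> u < X \<and> v (\<xi> u) = u" if u: "0 < u" "u < 1" for u
  proof -
    have "u \<in> v ` {0..X}" using u img by auto
    then obtain x where x: "0 \<le> x" "x \<le> X" "u = v x" by auto
    moreover have "x \<noteq> 0" "x \<noteq> X" using u x profD(4)[OF p] tsolD(2)[OF s] by auto
    ultimately show ?thesis using inv[of x] by auto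
  qed
  show ?thesis
  proof (rule that[OF cont ends inv mid])
    fix u :: real assume u: "0 < u" "u < 1"
    have "isCont \<xi> u"
      using u by (intro continuous_on_interior[OF cont]) auto
    then show "(\<xi> has_real_derivative 1 / v1 (\<xi> u)) (at u)"
      unfolding divide_inverse mult_1
      using u mid tsolD(6)[OF s, of "\<xi> u"] prof_v1_neg[OF p, of "\<xi> u"]
      by (intro DERIV_inverse_function[where f = v and a = 0 and b = 1]) auto
  qed
qed

text \<open>Descend from the common height 1. There \<open>P\<close> and \<open>D\<close> vanish and
  \<open>Q 1 = c - b < 0\<close>. As long as \<open>Q < 0\<close>, both \<open>P\<close> and
  \<open>D\<close> are positive, that is, the \<open>v\<close>-profile is steeper and narrower at
  equal height. This makes \<open>Q\<close> increasing in \<open>u\<close>, so on the way down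
  \<open>Q\<close> falls further below \<open>Q 1\<close> and never returns to 0.\<close>

lemma prof_compare:
  assumes p: "prof b X v v1 v2" and q: "prof c Y w w1 w2" and bc: "c < b"
  shows "X \<le> Y" "w1 Y > v1 X" "integral {0..X} v \<le> integral {0..Y} w"
proof -
  obtain \<xi> where xi: "continuous_on {0..1} \<xi>" "\<xi> 0 = X" "\<xi> 1 = 0"
    "\<And>x. 0 \<le> x \<Longrightarrow> x \<le> X \<Longrightarrow> \<xi> (v x) = x"
    "\<And>u. 0 < u \<Longrightarrow> u < 1 \<Longrightarrow> 0 < \<xi> u \<and> \<xi> u < X \<and> v (\<xi> u) = u"
    "\<And>u. 0 < u \<Longrightarrow> u < 1 \<Longrightarrow> (\<xi> has_real_derivative 1 / v1 (\<xi> u)) (at u)"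
    using prof_inverse[OF p] by metis
  obtain \<zeta> where ze: "continuous_on {0..1} \<zeta>" "\<zeta> 0 = Y" "\<zeta> 1 = 0"
    "\<And>x. 0 \<le> x \<Longrightarrow> x \<le> Y \<Longrightarrow> \<zeta> (w x) = x"
    "\<And>u. 0 < u \<Longrightarrow> u < 1 \<Longrightarrow> 0 < \<zeta> u \<and> \<zeta> u < Y \<and> w (\<zeta> u) = u"
    "\<And>u. 0 < u \<Longrightarrow> u < 1 \<Longrightarrow> (\<zeta> has_real_derivative 1 / w1 (\<zeta> u)) (at u)"
    using prof_inverse[OF q] by metis
  note s = profD(1)[OF p] and t = profD(1)[OF q] and X = profD(5)[OF p] and Y = profD(5)[OF q]
  \<comment> \<open>Differences at height \<open>u\<close> of the curvatures, squared slopes and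
    positions. Squaring the slope gives \<open>P' = 2 * Q\<close>, since the inverse slope from
    \<open>\<xi>'\<close> cancels.\<close>
  define Q where "Q = (\<lambda>u. v2 (\<xi> u) - w2 (\<zeta> u))"
  define P where "P = (\<lambda>u. (v1 (\<xi> u))\<^sup>2 - (w1 (\<zeta> u))\<^sup>2)"
  define D where "D = (\<lambda>u. \<zeta> u - \<xi> u)"
  have xi_in: "\<xi> u \<in> {0..X}" "\<zeta> u \<in> {0..Y}" if "u \<in> {0..1}" for u
    using that xi(2,3) xi(5)[of u] ze(2,3) ze(5)[of u] X Y
    by (cases "u = 0"; cases "u = 1"; auto)+
  have xi_in': "\<xi> u \<in> {0..<X}" "\<zeta> u \<in> {0..<Y}" if "u \<in> {0<..1}" for u
    using that xi(3) xi(5)[of u] ze(3) ze(5)[of u] X Y by (cases "u = 1"; auto)+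
  have cP: "continuous_on {0..1} P"
    unfolding P_def
    by (intro continuous_intros continuous_on_compose2[OF profD(3)[OF p] xi(1)] continuous_on_compose2[OF profD(3)[OF q] ze(1)])
      (use xi_in in auto)
  have cD: "continuous_on {0..1} D"
    unfolding D_def by (intro continuous_intros xi ze)
  have cv2: "continuous_on {0..<X} v2" "continuous_on {0..<Y} w2" using s t by (auto simp: tsol_def)
  \<comment> \<open>Height 0 is left out because the second derivatives may blow up at the contact
    points.\<close>
  have cQ: "continuous_on {0<..1} Q"
    unfolding Q_def
    by (intro continuous_intros continuous_on_compose2[OF cv2(1)] continuous_on_compose2[OF cv2(2)]
        continuous_on_subset[OF xi(1)] continuous_on_subset[OF ze(1)])
      (use xi_in' in force)+
  have neg: "v1 (\<xi> u) < 0" "w1 (\<zeta> u) < 0" if "0 < u" "u < 1" for u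
    using xi(5)[OF that] ze(5)[OF that] prof_v1_neg[OF p] prof_v1_neg[OF q] by auto
  have dP: "(P has_real_derivative 2 * Q u) (at u)" if u: "0 < u" "u < 1" for u
  proof -
    have x: "0 < \<xi> u" "\<xi> u < X" "0 < \<zeta> u" "\<zeta> u < Y" using xi(5)[OF u] ze(5)[OF u] by auto
    have a: "((\<lambda>u. (v1 (\<xi> u))\<^sup>2) has_real_derivative 2 * v2 (\<xi> u)) (at u)"
      using DERIV_power[OF DERIV_chain2[OF tsolD(7)[OF s x(1,2)] xi(6)[OF u]], of 2] neg[OF u] by simp
    have b: "((\<lambda>u. (w1 (\<zeta> u))\<^sup>2) has_real_derivative 2 * w2 (\<zeta> u)) (at u)"
      using DERIV_power[OF DERIV_chain2[OF tsolD(7)[OF t x(3,4)] ze(6)[OF u]], of 2] neg[OF u] by simp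
    show ?thesis unfolding P_def Q_def right_diff_distrib by (rule DERIV_diff[OF a b])
  qed
  have dD: "(D has_real_derivative 1 / w1 (\<zeta> u) - 1 / v1 (\<xi> u)) (at u)" if u: "0 < u" "u < 1" for u
    unfolding D_def by (rule DERIV_diff[OF ze(6)[OF u] xi(6)[OF u]])
  have dQ: "(Q has_real_derivative u powr (1 - n) * (\<xi> u / v1 (\<xi> u) - \<zeta> u / w1 (\<zeta> u))) (at u)"
    if u: "0 < u" "u < 1" for u
  proof -
    have x: "0 < \<xi> u" "\<xi> u < X" "v (\<xi> u) = u" "0 < \<zeta> u" "\<zeta> u < Y" "w (\<zeta> u) = u"
      using xi(5)[OF u] ze(5)[OF u] by auto
    show ?thesis unfolding Q_def
      by (rule DERIV_cong[OF DERIV_diff[OF DERIV_chain2[OF tsolD(8)[OF s x(1,2)] xi(6)[OF u]]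
            DERIV_chain2[OF tsolD(8)[OF t x(4,5)] ze(6)[OF u]]]])
        (simp add: x algebra_simps)
  qed
  have P1: "P 1 = 0" using xi(3) ze(3) tsolD(3)[OF s] tsolD(3)[OF t] by (simp add: P_def)
  have D1: "D 1 = 0" using xi(3) ze(3) by (simp add: D_def)
  have Q1: "Q 1 < 0" using xi(3) ze(3) tsolD(4)[OF s] tsolD(4)[OF t] bc by (simp add: Q_def)
  have Ppos: "0 < P u" if lt: "\<And>z. u < z \<Longrightarrow> z < 1 \<Longrightarrow> Q z < 0" and u: "0 \<le> u" "u < 1" for u
  proof -
    have "P 1 < P u"
    proof (rule strict_antimono_of_deriv_neg[where f = P and f' = "\<lambda>u. 2 * Q u"])
      show "continuous_on {u..1} P" using cP u by (auto intro: continuous_on_subset)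
    qed (use u dP lt in auto)
    then show ?thesis using P1 by simp
  qed
  have v1w1: "v1 (\<xi> u) < w1 (\<zeta> u)" if "0 < P u" "0 < u" "u < 1" for u
  proof -
    have "\<bar>w1 (\<zeta> u)\<bar> < \<bar>v1 (\<xi> u)\<bar>" using that(1) by (simp add: P_def abs_square_less_1 flip: abs_le_square_iff not_le)
    then show ?thesis using neg[OF that(2,3)] by linarith
  qed
  have Dpos: "0 < D u" if lt: "\<And>z. u < z \<Longrightarrow> z < 1 \<Longrightarrow> Q z < 0" and u: "0 \<le> u" "u < 1" for u
  proof -
    have "D 1 < D u"
    proof (rule strict_antimono_of_deriv_neg[where f = D and f' = "\<lambda>u. 1 / w1 (\<zeta> u) - 1 / v1 (\<xi> u)"])
      show "continuous_on {u..1} D" using cD u by (auto intro: continuous_on_subset)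
      fix z assume z: "u < z" "z < 1"
      then have z': "0 < z" "z < 1" using u by auto
      show "(D has_real_derivative 1 / w1 (\<zeta> z) - 1 / v1 (\<xi> z)) (at z)" by (rule dD[OF z'])
      have "0 < P z" using Ppos[of z] lt z z' by auto
      then show "1 / w1 (\<zeta> z) - 1 / v1 (\<xi> z) < 0"
        using frac_less2[of 1 1 "- w1 (\<zeta> z)" "- v1 (\<xi> z)"] v1w1[of z] neg[OF z'] z' by simp
    qed (use u in auto)
    then show ?thesis using D1 by simp
  qed
  have Qneg: "Q u < 0" if u: "0 < u" "u < 1" for u
  proof (rule ccontr)
    assume "\<not> Q u < 0"
    \<comment> \<open>The reflection \<open>t = 1 - u\<close> turns the descent from height 1 into a
      search for the first zero to the right.\<close>
    moreover have "continuous_on {0..1 - u} (\<lambda>t. Q (1 - t))"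
      by (intro continuous_on_compose2[OF cQ] continuous_intros) (use u in auto)
    ultimately obtain r where r: "0 < r" "r \<le> 1 - u" "Q (1 - r) = 0" "\<And>t. t \<in> {0..<r} \<Longrightarrow> Q (1 - t) < 0"
      using first_zero[of 0 "1 - u" "\<lambda>t. Q (1 - t)"] Q1 u by auto
    define a where "a = 1 - r"
    have a: "0 < a" "a < 1" "Q a = 0" using r u by (auto simp: a_def)
    have lt: "Q z < 0" if "a < z" "z < 1" for z
      using r(4)[of "1 - z"] that by (auto simp: a_def)
    have "Q a < Q 1"
    proof (rule strict_mono_of_deriv_pos[where f = Q and f' = "\<lambda>u. u powr (1 - n) * (\<xi> u / v1 (\<xi> u) - \<zeta> u / w1 (\<zeta> u))"])
      show "continuous_on {a..1} Q" using cQ a by (auto intro: continuous_on_subset)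
      fix z assume z: "a < z" "z < 1"
      then have z': "0 < z" "z < 1" using a by auto
      show "(Q has_real_derivative z powr (1 - n) * (\<xi> z / v1 (\<xi> z) - \<zeta> z / w1 (\<zeta> z))) (at z)"
        by (rule dQ[OF z'])
      have "0 < P z" "0 < D z" using Ppos[of z] Dpos[of z] lt z z' by auto
      then have "v1 (\<xi> z) < w1 (\<zeta> z)" "\<xi> z < \<zeta> z" using v1w1[of z] z' by (auto simp: D_def)
      moreover have "0 < \<xi> z" using xi(5)[OF z'] by simp
      ultimately have "\<xi> z / - v1 (\<xi> z) < \<zeta> z / - w1 (\<zeta> z)"
        using neg[OF z'] by (intro frac_less) auto
      then show "0 < z powr (1 - n) * (\<xi> z / v1 (\<xi> z) - \<zeta> z / w1 (\<zeta> z))"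
        using z' by (intro mult_pos_pos) auto
    qed (use a in auto)
    then show False using a Q1 by simp
  qed
  have "0 < P 0" "0 < D 0" using Ppos[of 0] Dpos[of 0] Qneg by auto
  then show XY: "X \<le> Y" by (simp add: D_def xi ze)
  have "\<bar>w1 Y\<bar> < \<bar>v1 X\<bar>" using \<open>0 < P 0\<close> by (simp add: P_def xi ze flip: abs_le_square_iff not_le)
  then show "w1 Y > v1 X" using prof_v1_end_nonpos[OF p] prof_v1_end_nonpos[OF q] by linarith
  \<comment> \<open>The wider profile attains the height \<open>v x\<close> only at a later point,
    and it decreases, so it is higher at \<open>x\<close>.\<close>
  have le: "v x \<le> w x" if x: "x \<in> {0..X}" for x
  proof (cases "x = 0 \<or> x = X")
    case True
    then show ?thesis
      using tsolD(2)[OF s] tsolD(2)[OF t] profD(4)[OF p] prof_range[OF q, of X] X XY by auto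
  next
    case False
    then have x: "0 < x" "x < X" using x by auto
    have u: "0 < v x" "v x < 1"
      using prof_strict_antimono[OF p, of x X] prof_strict_antimono[OF p, of 0 x] x
        profD(4)[OF p] tsolD(2)[OF s] by auto
    have "0 < D (v x)" using Dpos[of "v x"] Qneg u by auto
    then have "x < \<zeta> (v x)" using xi(4)[of x] x by (simp add: D_def)
    then have "w (\<zeta> (v x)) < w x" using prof_strict_antimono[OF q, of x "\<zeta> (v x)"] ze(5)[OF u] x by auto
    then show ?thesis using ze(5)[OF u] by simp
  qed
  have "integral {0..X} v \<le> integral {0..X} w"
    using le profD(2)[OF p] profD(2)[OF q] XY
    by (intro integral_le integrable_continuous_real) (auto intro: continuous_on_subset)
  also have "\<dots> \<le> integral {0..Y} w"
    using profD(2)[OF q] XY prof_range(1)[OF q]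
    by (intro integral_subset_le integrable_continuous_real) (auto intro: continuous_on_subset)
  finally show "integral {0..X} v \<le> integral {0..Y} w" .
qed

section \<open>The critical curvature\<close>

lemma prof_v_le:
  assumes p: "prof b X v v1 v2" and x: "0 \<le> x" "x \<le> X"
  shows "v x \<le> b * X * (X - x)"
proof -
  have "v x + b * X * x \<le> v X + b * X * X"
  proof (rule mono_of_deriv_nonneg[where f = "\<lambda>x. v x + b * X * x" and f' = "\<lambda>x. v1 x + b * X"])
    show "continuous_on {x..X} (\<lambda>x. v x + b * X * x)"
      using profD(2)[OF p] x by (intro continuous_intros) (auto intro: continuous_on_subset)
    fix z assume "x < z" "z < X"
    then have z: "0 < z" "z < X" using x by auto
    show "((\<lambda>x. v x + b * X * x) has_real_derivative v1 z + b * X) (at z)"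
      using tsolD(6)[OF profD(1)[OF p] z] by (auto intro!: derivative_eq_intros)
    have "b * z \<le> b * X" using prof_b_pos[OF p] z by auto
    then show "0 \<le> v1 z + b * X" using tsol_v1_ge[OF profD(1)[OF p], of z] z by auto
  qed (use x in auto)
  then show ?thesis using profD(4)[OF p] by (simp add: algebra_simps)
qed

lemma prof_v1_chord:
  assumes p: "prof b X v v1 v2" and x: "0 \<le> x" "x < X"
  shows "v1 x + v2 x * (X - x) \<le> v1 X"
proof (rule le_at_endpoint[of x X "\<lambda>y. v1 x + v2 x * (y - x)" v1])
  show "continuous_on {x..X} v1" using profD(3)[OF p] x by (auto intro: continuous_on_subset)
  show "continuous_on {x..X} (\<lambda>y. v1 x + v2 x * (y - x))" by (intro continuous_intros)
qed (use x tsol_v1_chord[OF profD(1)[OF p]] in auto)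

lemma prof_v1_plus_mono:
  assumes p: "prof b X v v1 v2" and x: "0 \<le> x" "x < X"
  shows "v1 x + b * x \<le> v1 X + b * X"
proof (rule le_at_endpoint[of x X "\<lambda>y. v1 x + b * x" "\<lambda>y. v1 y + b * y"])
  show "continuous_on {x..X} (\<lambda>y. v1 y + b * y)"
    using profD(3)[OF p] x by (intro continuous_intros) (auto intro: continuous_on_subset)
qed (use x tsol_v1_plus_mono[OF profD(1)[OF p]] in auto)

lemma prof_tendsto_end:
  assumes p: "prof b X v v1 v2"
  shows "(v \<longlongrightarrow> 0) (at_left X)" "(v1 \<longlongrightarrow> v1 X) (at_left X)"
  using continuous_on_Icc_at_leftD[OF profD(2,5)[OF p]] continuous_on_Icc_at_leftD[OF profD(3,5)[OF p]]
    profD(4)[OF p] by auto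

text \<open>At a contact point with slope \<open>- v1 X > 0\<close> the product \<open>v * v2\<close> tends to zero although
  \<open>v2\<close> may be unbounded: \<open>v x\<close> is at most linear in \<open>X - x\<close>, and convexity of \<open>v1\<close> bounds
  \<open>(X - x) * v2 x\<close> by an increment of \<open>v1\<close>.\<close>

lemma prof_eventually_barrier:
  assumes p: "prof b X v v1 v2" and c: "0 < c" "c * X < - v1 X"
  shows "\<forall>\<^sub>F x in at_left X. v1 x < - c * x \<and>
    v x powr (3 - n) / (c * (3 - n)) + c\<^sup>2 * x\<^sup>2 / 2 + c * v x < (v1 x)\<^sup>2 / 2 - v x * v2 x"
proof -
  note X = profD(5)[OF p] and b = prof_b_pos[OF p] and t = prof_tendsto_end[OF p]
  have ev: "\<forall>\<^sub>F x in at_left X. 0 < x \<and> x < X"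
    unfolding eventually_at_left[OF X] using X by auto
  have "((\<lambda>x. v x powr (3 - n)) \<longlongrightarrow> 0) (at_left X)"
  proof (rule tendsto_zero_powrI[OF t(1) tendsto_const])
    show "\<forall>\<^sub>F x in at_left X. 0 \<le> v x"
      using ev by eventually_elim (use prof_range(1)[OF p] in auto)
  qed (use n3 in auto)
  \<comment> \<open>In the limit all terms containing \<open>v\<close> vanish, and what remains is
    the difference of the squares of \<open>- v1 X\<close> and \<open>c * X\<close>, halved.\<close>
  then have "((\<lambda>x. (v1 x)\<^sup>2 / 2 - b * X * \<bar>v1 X - v1 x\<bar> - (v x powr (3 - n) / (c * (3 - n)) + c\<^sup>2 * x\<^sup>2 / 2 + c * v x))
     \<longlongrightarrow> (v1 X)\<^sup>2 / 2 - b * X * \<bar>v1 X - v1 X\<bar> - (0 / (c * (3 - n)) + c\<^sup>2 * X\<^sup>2 / 2 + c * 0)) (at_left X)"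
    using c n3 by (intro tendsto_intros t) auto
  moreover have "(c * X)\<^sup>2 < (- v1 X)\<^sup>2" using c X by (intro power_strict_mono) auto
  then have "0 < (v1 X)\<^sup>2 / 2 - b * X * \<bar>v1 X - v1 X\<bar> - (0 / (c * (3 - n)) + c\<^sup>2 * X\<^sup>2 / 2 + c * 0)"
    by (simp add: power_mult_distrib)
  ultimately have 1: "\<forall>\<^sub>F x in at_left X. 0 < (v1 x)\<^sup>2 / 2 - b * X * \<bar>v1 X - v1 x\<bar> - (v x powr (3 - n) / (c * (3 - n)) + c\<^sup>2 * x\<^sup>2 / 2 + c * v x)"
    by (rule order_tendstoD)
  have "((\<lambda>x. v1 x + c * x) \<longlongrightarrow> v1 X + c * X) (at_left X)" by (intro tendsto_intros t)
  then have 2: "\<forall>\<^sub>F x in at_left X. v1 x + c * x < 0" using c by (intro order_tendstoD(2)) auto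
  show ?thesis
    using 1 2 ev
  proof eventually_elim
    case (elim x)
    then have x: "0 < x" "x < X" by auto
    have "v x * v2 x \<le> b * X * \<bar>v1 X - v1 x\<bar>"
    proof (cases "v2 x \<le> 0")
      case True
      then have "v x * v2 x \<le> 0" using tsolD(5)[OF profD(1)[OF p], of x] x by (simp add: mult_le_0_iff)
      also have "\<dots> \<le> b * X * \<bar>v1 X - v1 x\<bar>" using b X by simp
      finally show ?thesis .
    next
      case False
      then have "v x * v2 x \<le> b * X * (X - x) * v2 x"
        using prof_v_le[OF p, of x] x by (intro mult_right_mono) auto
      also have "\<dots> = b * X * (v2 x * (X - x))" by simp
      also have "\<dots> \<le> b * X * \<bar>v1 X - v1 x\<bar>"
        using prof_v1_chord[OF p, of x] x b X by (intro mult_left_mono) auto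
      finally show ?thesis .
    qed
    then show ?case using elim by auto
  qed
qed

section \<open>Stability of a contact with nonzero slope\<close>

text \<open>Continuous dependence yields solutions that depend on the tolerance
  \<open>\<eta>\<close>. Uniqueness transfers every estimate to one fixed choice \<open>W\<close>,
  so that it can be stated as a limit.\<close>

lemma tsol_family:
  assumes s: "tsol n b r0 v v1 v2" and x0: "0 < x0" "x0 < r0"
  obtains \<rho> W W1 W2 where "\<forall>\<^sub>F c in nhds b. x0 < \<rho> c \<and> tsol n c (\<rho> c) (W c) (W1 c) (W2 c)"
    "((\<lambda>c. W c x0) \<longlongrightarrow> v x0) (nhds b)" "((\<lambda>c. W1 c x0) \<longlongrightarrow> v1 x0) (nhds b)" "((\<lambda>c. W2 c x0) \<longlongrightarrow> v2 x0) (nhds b)"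
proof -
  obtain \<delta>0 where d0: "0 < \<delta>0" "\<And>c. \<bar>c - b\<bar> < \<delta>0 \<Longrightarrow> \<exists>r w w1 w2. x0 < r \<and> tsol n c r w w1 w2"
    using tsol_cont_dep[OF s x0, of 1] by (metis zero_less_one)
  then obtain \<rho> W W1 W2 where W: "\<And>c. \<bar>c - b\<bar> < \<delta>0 \<Longrightarrow> x0 < \<rho> c \<and> tsol n c (\<rho> c) (W c) (W1 c) (W2 c)"
    by metis
  have near: "\<forall>\<^sub>F c in nhds b. \<bar>c - b\<bar> < \<delta>" if "0 < \<delta>" for \<delta>
    using that by (auto simp: eventually_nhds_metric dist_real_def)
  have close: "\<forall>\<^sub>F c in nhds b. dist (W c x0) (v x0) < \<eta> \<and> dist (W1 c x0) (v1 x0) < \<eta> \<and> dist (W2 c x0) (v2 x0) < \<eta>"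
    if eta: "0 < \<eta>" for \<eta>
  proof -
    obtain \<delta> where d: "0 < \<delta>" "\<And>c. \<bar>c - b\<bar> < \<delta> \<Longrightarrow> \<exists>r w w1 w2. x0 < r \<and> tsol n c r w w1 w2 \<and>
       (\<forall>x\<in>{0..x0}. \<bar>w x - v x\<bar> < \<eta> \<and> \<bar>w1 x - v1 x\<bar> < \<eta> \<and> \<bar>w2 x - v2 x\<bar> < \<eta>)"
      using tsol_cont_dep[OF s x0 eta] by metis
    show ?thesis
      using near[OF d(1)] near[OF d0(1)]
    proof eventually_elim
      case (elim c)
      obtain r w w1 w2 where w: "x0 < r" "tsol n c r w w1 w2"
         "\<bar>w x0 - v x0\<bar> < \<eta>" "\<bar>w1 x0 - v1 x0\<bar> < \<eta>" "\<bar>w2 x0 - v2 x0\<bar> < \<eta>"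
        using d(2)[OF elim(1)] x0 by force
      have "tsol n c (min r (\<rho> c)) w w1 w2" "tsol n c (min r (\<rho> c)) (W c) (W1 c) (W2 c)"
        using w W[OF elim(2)] x0 by (auto intro: tsol_restrict)
      from tsol_unique[OF this, of x0] show ?case
        using w W[OF elim(2)] x0 by (simp add: dist_real_def)
    qed
  qed
  show ?thesis
  proof (rule that[of \<rho> W W1 W2])
    show "\<forall>\<^sub>F c in nhds b. x0 < \<rho> c \<and> tsol n c (\<rho> c) (W c) (W1 c) (W2 c)"
      using near[OF d0(1)] by eventually_elim (rule W)
    show "((\<lambda>c. W c x0) \<longlongrightarrow> v x0) (nhds b)" "((\<lambda>c. W1 c x0) \<longlongrightarrow> v1 x0) (nhds b)"
      "((\<lambda>c. W2 c x0) \<longlongrightarrow> v2 x0) (nhds b)"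
      by (rule tendstoI, drule close, elim eventually_mono, blast)+
  qed
qed

text \<open>The barrier conditions are strict inequalities between values at the single point
  \<open>x0\<close>. These values depend continuously on the curvature, so the barrier persists for
  all nearby \<open>a\<close>.\<close>

lemma prof_uniform_barrier:
  assumes p: "prof b X v v1 v2" and c: "0 < c" "c * X < - v1 X"
  shows "\<forall>\<^sub>F x0 in at_left X. \<forall>\<^sub>F a in nhds b. (\<exists>r w w1 w2. tsol n a r w w1 w2 \<and> x0 < r) \<and>
    (\<forall>r w w1 w2 x. tsol n a r w w1 w2 \<longrightarrow> x0 \<le> x \<longrightarrow> x < r \<longrightarrow> w1 x < - c * x)"
proof -
  note X = profD(5)[OF p]
  have ev: "\<forall>\<^sub>F x in at_left X. 0 < x \<and> x < X"
    unfolding eventually_at_left[OF X] using X by auto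
  show ?thesis
    using prof_eventually_barrier[OF p c] ev
  proof eventually_elim
    case (elim x0)
    then have x0: "0 < x0" "x0 < X" and v1: "v1 x0 < - c * x0"
      and en: "v x0 powr (3 - n) / (c * (3 - n)) + c\<^sup>2 * x0\<^sup>2 / 2 + c * v x0 < (v1 x0)\<^sup>2 / 2 - v x0 * v2 x0"
      by auto
    obtain \<rho> W W1 W2 where W: "\<forall>\<^sub>F a in nhds b. x0 < \<rho> a \<and> tsol n a (\<rho> a) (W a) (W1 a) (W2 a)"
      "((\<lambda>a. W a x0) \<longlongrightarrow> v x0) (nhds b)" "((\<lambda>a. W1 a x0) \<longlongrightarrow> v1 x0) (nhds b)" "((\<lambda>a. W2 a x0) \<longlongrightarrow> v2 x0) (nhds b)"
      by (rule tsol_family[OF profD(1)[OF p] x0])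
    have 1: "\<forall>\<^sub>F a in nhds b. W1 a x0 < - c * x0" using W(3) v1 by (rule order_tendstoD)
    have "v x0 \<noteq> 0" using tsolD(5)[OF profD(1)[OF p], of x0] x0 by auto
    then have "((\<lambda>a. (W1 a x0)\<^sup>2 / 2 - W a x0 * W2 a x0 - (W a x0 powr (3 - n) / (c * (3 - n)) + c\<^sup>2 * x0\<^sup>2 / 2 + c * W a x0))
       \<longlongrightarrow> (v1 x0)\<^sup>2 / 2 - v x0 * v2 x0 - (v x0 powr (3 - n) / (c * (3 - n)) + c\<^sup>2 * x0\<^sup>2 / 2 + c * v x0)) (nhds b)"
      using c n3 by (intro tendsto_intros W) auto
    then have 2: "\<forall>\<^sub>F a in nhds b. 0 < (W1 a x0)\<^sup>2 / 2 - W a x0 * W2 a x0 - (W a x0 powr (3 - n) / (c * (3 - n)) + c\<^sup>2 * x0\<^sup>2 / 2 + c * W a x0)"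
      using en by (intro order_tendstoD) auto
    show ?case
      using W(1) 1 2
    proof eventually_elim
      case (elim a)
      show ?case
      proof (intro conjI allI impI)
        show "\<exists>r w w1 w2. tsol n a r w w1 w2 \<and> x0 < r" using elim by blast
        fix r w w1 w2 x assume w: "tsol n a r w w1 w2" and x: "x0 \<le> x" "x < r"
        have "tsol n a (min r (\<rho> a)) w w1 w2" "tsol n a (min r (\<rho> a)) (W a) (W1 a) (W2 a)"
          using w elim x0 x by (auto intro: tsol_restrict)
        from tsol_unique[OF this, of x0] have "w x0 = W a x0" "w1 x0 = W1 a x0" "w2 x0 = W2 a x0"
          using elim x0 x by auto
        then show "w1 x < - c * x"
          using tsol_energy_barrier[OF w x0(1) _ c(1) _ _ x] elim x by auto
      qed
    qed
  qed
qed

text \<open>Beyond some \<open>x0\<close> the barrier keeps all nearby solutions decreasing. A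
  rebound before \<open>x0\<close> would still be visible at \<open>x0\<close>, because
  \<open>v1\<close> stays positive.\<close>

lemma prof_pos_slope_stable:
  assumes p: "prof b X v v1 v2" and pos: "0 < - v1 X"
  shows "\<forall>\<^sub>F a in nhds b. \<not> rebounds a"
proof -
  note X = profD(5)[OF p]
  define c where "c = - v1 X / (2 * X)"
  have c: "0 < c" "c * X < - v1 X" using pos X by (auto simp: c_def divide_neg_pos)
  have "\<forall>\<^sub>F x in at_left X. 0 < x"
    unfolding eventually_at_left[OF X] using X by auto
  with prof_uniform_barrier[OF p c] have "\<forall>\<^sub>F x0 in at_left X. 0 < x0 \<and> (\<forall>\<^sub>F a in nhds b. (\<exists>r w w1 w2. tsol n a r w w1 w2 \<and> x0 < r) \<and>
    (\<forall>r w w1 w2 x. tsol n a r w w1 w2 \<longrightarrow> x0 \<le> x \<longrightarrow> x < r \<longrightarrow> w1 x < - c * x))"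
    by eventually_elim simp
  then obtain x0 where x0: "0 < x0" "\<forall>\<^sub>F a in nhds b. (\<exists>r w w1 w2. tsol n a r w w1 w2 \<and> x0 < r) \<and>
    (\<forall>r w w1 w2 x. tsol n a r w w1 w2 \<longrightarrow> x0 \<le> x \<longrightarrow> x < r \<longrightarrow> w1 x < - c * x)"
    using eventually_happens'[OF trivial_limit_at_left_real] by blast
  from x0(2) show ?thesis
  proof eventually_elim
    case (elim a)
    then obtain \<rho> W W1 W2 where W: "tsol n a \<rho> W W1 W2" "x0 < \<rho>" by blast
    have neg: "w1 x < 0" if "tsol n a r w w1 w2" "x0 \<le> x" "x < r" for r w w1 w2 x
    proof -
      have "w1 x < - c * x" using elim that by blast
      also have "\<dots> < 0" using c x0 that by auto
      finally show ?thesis .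
    qed
    show ?case
    proof
      assume "rebounds a"
      then obtain r w w1 w2 x where w: "tsol n a r w w1 w2" "0 \<le> x" "x < r" "0 < w1 x"
        unfolding rebounds_def by blast
      show False
      proof (cases "x0 \<le> x")
        case True
        then show False using neg[OF w(1) True w(3)] w(4) by simp
      next
        case False
        then have x: "x < x0" by simp
        have "tsol n a (min r \<rho>) w w1 w2" "tsol n a (min r \<rho>) W W1 W2"
          using w W x0 by (auto intro: tsol_restrict)
        from tsol_unique(2)[OF this w(2)] have "0 < W1 x" using w W x by auto
        then have "0 < W1 x0" using tsol_v1_stays_pos[OF W(1) w(2)] x W(2) by auto
        then show False using neg[OF W(1) order_refl W(2)] by simp
      qed
    qed
  qed
qed

lemma rebounds_open:
  assumes "rebounds b"
  shows "\<forall>\<^sub>F a in nhds b. rebounds a"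
proof -
  obtain r v v1 v2 x where v: "tsol n b r v v1 v2" "0 \<le> x" "x < r" "0 < v1 x"
    using assms unfolding rebounds_def by blast
  have x: "0 < x" using v tsolD(3)[OF v(1)] by (cases "x = 0") auto
  obtain \<rho> W W1 W2 where W: "\<forall>\<^sub>F c in nhds b. x < \<rho> c \<and> tsol n c (\<rho> c) (W c) (W1 c) (W2 c)"
    "((\<lambda>c. W1 c x) \<longlongrightarrow> v1 x) (nhds b)"
    by (rule tsol_family[OF v(1) x v(3)])
  have "\<forall>\<^sub>F c in nhds b. 0 < W1 c x" using W(2) v(4) by (rule order_tendstoD)
  with W(1) show ?thesis
  proof eventually_elim
    case (elim c)
    then show ?case unfolding rebounds_def using x less_imp_le by blast
  qed
qed

text \<open>This is \<open>tsol_steep\<close> with \<open>c = 1\<close>.\<close>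

lemma rebounds_bounded:
  assumes "rebounds b"
  shows "b \<le> 1 / (3 - n) + 1"
proof (rule ccontr)
  assume "\<not> b \<le> 1 / (3 - n) + 1"
  then have b: "1 / (1 * (3 - n)) + 1 < b" by simp
  obtain r v v1 v2 x where v: "tsol n b r v v1 v2" "0 \<le> x" "x < r" "0 < v1 x"
    using assms unfolding rebounds_def by blast
  have x: "0 < x" using v tsolD(3)[OF v(1)] by (cases "x = 0") auto
  show False using tsol_steep[OF v(1) zero_less_one b x v(3)] v(4) x by simp
qed

definition b_crit :: real where "b_crit = Sup {b. rebounds b}"

lemma bdd_above_rebounds: "bdd_above {b. rebounds b}"
  using rebounds_bounded by (intro bdd_aboveI) auto

text \<open>The rebounding curvatures form an open set, so none of them is its supremum or lies
  above it.\<close>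

lemma not_rebounds_ge_crit:
  assumes "b_crit \<le> b"
  shows "\<not> rebounds b"
proof
  assume r: "rebounds b"
  then obtain d where d: "0 < d" "\<And>a. dist a b < d \<Longrightarrow> rebounds a"
    using rebounds_open by (auto simp: eventually_nhds_metric)
  have "rebounds (b + d / 2)" using d by (auto simp: dist_real_def)
  then have "b + d / 2 \<le> b_crit"
    unfolding b_crit_def by (intro cSup_upper bdd_above_rebounds) auto
  then show False using assms d by simp
qed

text \<open>A nonzero slope would exclude rebounds in a whole neighbourhood of
  \<open>b_crit\<close>, although rebounding curvatures approach it.\<close>

lemma prof_crit_slope:
  assumes p: "prof b_crit X v v1 v2"
  shows "v1 X = 0"
proof (rule ccontr)
  assume "v1 X \<noteq> 0"
  then have "0 < - v1 X" using prof_v1_end_nonpos[OF p] by simp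
  then obtain d where d: "0 < d" "\<And>a. dist a b_crit < d \<Longrightarrow> \<not> rebounds a"
    using prof_pos_slope_stable[OF p] by (auto simp: eventually_nhds_metric)
  have "b_crit - d < Sup {b. rebounds b}" using d by (simp add: b_crit_def)
  then obtain a where a: "rebounds a" "b_crit - d < a"
    using less_cSup_iff[OF _ bdd_above_rebounds] rebounds_nonpos by blast
  then have "a \<le> b_crit" unfolding b_crit_def by (intro cSup_upper bdd_above_rebounds) auto
  then show False using d(2)[of a] a by (auto simp: dist_real_def)
qed

section \<open>The friction coefficient as a function of the curvature\<close>

text \<open>The contact law \<open>- A * X * v1 X = D * B powr tf_alpha n\<close> of the rescaled
  profile solved for \<open>D\<close>, with \<open>A\<close> and \<open>B\<close> expressed through
  \<open>X\<close> and the mass; \<open>friction_scale\<close> carries out the elimination.\<close>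

definition friction :: "real \<Rightarrow> (real \<Rightarrow> real) \<Rightarrow> (real \<Rightarrow> real) \<Rightarrow> real" where
  "friction X v v1 = - v1 X * integral {0..X} v powr (- ((3 - n) / (n + 3))) * X powr (- (2 / (n + 3)))"

lemma prof_mass_pos:
  assumes p: "prof b X v v1 v2"
  shows "0 < integral {0..X} v"
proof -
  note X = profD(5)[OF p]
  have c: "continuous_on {0..X/2} v" using profD(2)[OF p] X by (auto intro: continuous_on_subset)
  have "0 < X / 2 * v (X / 2)" using tsolD(5)[OF profD(1)[OF p], of "X / 2"] X by auto
  also have "\<dots> = integral {0..X/2} (\<lambda>_. v (X / 2))" using X by simp
  also have "\<dots> \<le> integral {0..X/2} v"
  proof (intro integral_le integrable_continuous_real c continuous_intros)
    fix x assume "x \<in> {0..X/2}"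
    then show "v (X / 2) \<le> v x"
      using prof_strict_antimono[OF p, of x "X / 2"] X by (cases "x = X / 2") auto
  qed
  also have "\<dots> \<le> integral {0..X} v"
    using X prof_range(1)[OF p]
    by (intro integral_subset_le integrable_continuous_real c profD(2)[OF p]) auto
  finally show ?thesis .
qed

lemma prof_mass_split:
  assumes p: "prof b X v v1 v2" and x: "0 \<le> x" "x \<le> X"
  shows "integral {0..x} v \<le> integral {0..X} v" "integral {0..X} v \<le> integral {0..x} v + (X - x)"
proof -
  have i: "v integrable_on {0..X}" by (intro integrable_continuous_real profD(2)[OF p])
  have i2: "v integrable_on {x..X}" by (rule integrable_subinterval_real[OF i]) (use x in auto)
  have split: "integral {0..X} v = integral {0..x} v + integral {x..X} v"
    using Henstock_Kurzweil_Integration.integral_combine[OF x i] by simp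
  have "0 \<le> integral {x..X} v"
    using prof_range(1)[OF p] x by (intro integral_nonneg i2) auto
  then show "integral {0..x} v \<le> integral {0..X} v" using split by simp
  have "integral {x..X} v \<le> integral {x..X} (\<lambda>_. 1)"
    using prof_range(2)[OF p] x by (intro integral_le i2) auto
  then show "integral {0..X} v \<le> integral {0..x} v + (X - x)" using split x by simp
qed

lemma prof_near:
  assumes p: "prof b X v v1 v2" and x0: "0 < x0" "x0 < X" and eta: "0 < \<eta>"
  shows "\<forall>\<^sub>F c in nhds b. \<forall>Y w w1 w2. prof c Y w w1 w2 \<longrightarrow> x0 < Y \<and>
    (\<forall>x\<in>{0..x0}. \<bar>w x - v x\<bar> < \<eta> \<and> \<bar>w1 x - v1 x\<bar> < \<eta>)"
proof -
  obtain \<delta> where d: "0 < \<delta>" "\<And>c. \<bar>c - b\<bar> < \<delta> \<Longrightarrow> \<exists>r w w1 w2. x0 < r \<and> tsol n c r w w1 w2 \<and>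
       (\<forall>x\<in>{0..x0}. \<bar>w x - v x\<bar> < \<eta> \<and> \<bar>w1 x - v1 x\<bar> < \<eta> \<and> \<bar>w2 x - v2 x\<bar> < \<eta>)"
    by (rule tsol_cont_dep[OF profD(1)[OF p] x0 eta]) blast
  show ?thesis
    unfolding eventually_nhds_metric
  proof (intro exI[of _ \<delta>] conjI allI impI d(1))
    fix c Y w w1 w2 assume "dist c b < \<delta>" and q: "prof c Y w w1 w2"
    then obtain r u u1 u2 where u: "x0 < r" "tsol n c r u u1 u2"
      "\<forall>x\<in>{0..x0}. \<bar>u x - v x\<bar> < \<eta> \<and> \<bar>u1 x - v1 x\<bar> < \<eta> \<and> \<bar>u2 x - v2 x\<bar> < \<eta>"
      using d(2)[of c] unfolding dist_real_def by blast
    have r: "r \<le> Y" by (rule tsol_prof_length[OF q u(2)])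
    then show "x0 < Y" using u by simp
    have "w x = u x" "w1 x = u1 x" if "x \<in> {0..x0}" for x
      using tsol_unique[OF tsol_restrict[OF profD(1)[OF q], of r] u(2), of x] r that u(1) x0 by auto
    then show "\<forall>x\<in>{0..x0}. \<bar>w x - v x\<bar> < \<eta> \<and> \<bar>w1 x - v1 x\<bar> < \<eta>" using u(3) by auto
  qed
qed

section \<open>Continuity of contact point, slope, mass and friction along a family of
  profiles\<close>

context
  fixes S :: "real set" and b :: real and X :: "real \<Rightarrow> real" and V V1 V2 :: "real \<Rightarrow> real \<Rightarrow> real"
  assumes fam: "\<And>c. c \<in> S \<Longrightarrow> prof c (X c) (V c) (V1 c) (V2 c)"
    and b: "b \<in> S"
    and side: "0 < - V1 b (X b) \<or> S \<subseteq> {b..}"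
begin

lemma fam_ev: "\<forall>\<^sub>F c in at b within S. prof c (X c) (V c) (V1 c) (V2 c)"
  using fam by (auto simp: eventually_at_filter)

lemma ev_within: "\<forall>\<^sub>F c in nhds b. P c \<Longrightarrow> \<forall>\<^sub>F c in at b within S. P c"
  by (auto simp: eventually_at_filter elim: eventually_mono)

lemma fam_near:
  assumes "0 < x0" "x0 < X b" "0 < \<eta>"
  shows "\<forall>\<^sub>F c in at b within S. x0 < X c \<and> (\<forall>x\<in>{0..x0}. \<bar>V c x - V b x\<bar> < \<eta> \<and> \<bar>V1 c x - V1 b x\<bar> < \<eta>)"
  using ev_within[OF prof_near[OF fam[OF b] assms]] fam_ev by eventually_elim blast

lemma fam_pointwise:
  assumes x0: "0 < x0" "x0 < X b"
  shows "((\<lambda>c. V c x0) \<longlongrightarrow> V b x0) (at b within S)" "((\<lambda>c. V1 c x0) \<longlongrightarrow> V1 b x0) (at b within S)"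
    "((\<lambda>c. integral {0..x0} (V c)) \<longlongrightarrow> integral {0..x0} (V b)) (at b within S)"
proof -
  have ev0: "\<forall>\<^sub>F c in at b within S. dist (V c x0) (V b x0) < \<eta> \<and> dist (V1 c x0) (V1 b x0) < \<eta>" if "0 < \<eta>" for \<eta>
    using fam_near[OF x0 that] by eventually_elim (use x0 in \<open>auto simp: dist_real_def\<close>)
  show "((\<lambda>c. V c x0) \<longlongrightarrow> V b x0) (at b within S)" "((\<lambda>c. V1 c x0) \<longlongrightarrow> V1 b x0) (at b within S)"
    by (rule tendstoI, drule ev0, elim eventually_mono, blast)+
  have i: "V c integrable_on {0..x0}" if "prof c (X c) (V c) (V1 c) (V2 c)" "x0 < X c" for c
    by (intro integrable_continuous_real continuous_on_subset[OF profD(2)[OF that(1)]]) (use that in auto)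
  show "((\<lambda>c. integral {0..x0} (V c)) \<longlongrightarrow> integral {0..x0} (V b)) (at b within S)"
  proof (rule tendstoI)
    fix e :: real assume e: "0 < e"
    define \<eta> where "\<eta> = e / (2 * x0)"
    have eta: "0 < \<eta>" "\<eta> * x0 < e" using e x0 by (auto simp: \<eta>_def)
    show "\<forall>\<^sub>F c in at b within S. dist (integral {0..x0} (V c)) (integral {0..x0} (V b)) < e"
      using fam_near[OF x0 eta(1)] fam_ev
    proof eventually_elim
      case (elim c)
      note ic = i[OF elim(2)] and ib = i[OF fam[OF b] x0(2)]
      have "norm (integral {0..x0} (\<lambda>x. V c x - V b x)) \<le> integral {0..x0} (\<lambda>_. \<eta>)"
      proof (rule integral_norm_bound_integral)
        show "(\<lambda>x. V c x - V b x) integrable_on {0..x0}" using ic ib elim by (intro integrable_diff) auto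
        show "norm (V c x - V b x) \<le> \<eta>" if "x \<in> {0..x0}" for x
          using elim that by force
      qed auto
      also have "\<dots> = \<eta> * x0" using x0 by simp
      also have "\<dots> < e" by (rule eta)
      finally show ?case
        using integral_diff[OF ic ib] elim by (simp add: dist_real_def)
    qed
  qed
qed

lemma ev_left: "\<forall>\<^sub>F x in at_left (X b). 0 < x \<and> x < X b"
  unfolding eventually_at_left[OF profD(5)[OF fam[OF b]]] using profD(5)[OF fam[OF b]] by auto

lemma left_obtain:
  assumes "\<forall>\<^sub>F x in at_left (X b). P x"
  obtains x where "0 < x" "x < X b" "P x"
proof -
  have "\<forall>\<^sub>F x in at_left (X b). 0 < x \<and> x < X b \<and> P x"
    using ev_left assms by eventually_elim simp
  then show ?thesis using that eventually_happens'[OF trivial_limit_at_left_real] by blast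
qed

text \<open>Continuous dependence on \<open>{0..x0}\<close> keeps \<open>X c\<close> from being much
  smaller than \<open>X b\<close>. If only curvatures \<open>c \<ge> b\<close> occur, comparison
  gives \<open>X c \<le> X b\<close>. Otherwise the slope at \<open>b\<close> is nonzero, and the
  barrier makes nearby profiles fall at rate at least \<open>k * x0\<close> beyond
  \<open>x0\<close>, which leaves at most the distance \<open>V c x0 / (k * x0)\<close> to the
  contact point.\<close>

lemma fam_X: "(X \<longlongrightarrow> X b) (at b within S)"
proof (rule order_tendstoI)
  note p = fam[OF b]
  note Xb = profD(5)[OF p]
  fix a assume "a < X b"
  then have "max 0 a < X b" using Xb by auto
  then obtain x0 where "max 0 a < x0" "x0 < X b" using dense by blast
  then have x0: "0 < x0" "a < x0" "x0 < X b" by auto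
  show "\<forall>\<^sub>F c in at b within S. a < X c"
    using fam_near[OF x0(1,3) zero_less_one] by eventually_elim (use x0 in auto)
next
  note p = fam[OF b]
  note Xb = profD(5)[OF p]
  fix a assume a: "X b < a"
  from side show "\<forall>\<^sub>F c in at b within S. X c < a"
  proof
    assume le: "S \<subseteq> {b..}"
    have "X c \<le> X b" if c: "c \<in> S" for c
    proof (cases "c = b")
      case False
      then have "b < c" using le that by auto
      then show ?thesis using prof_compare(1)[OF fam[OF c] p] by simp
    qed simp
    then show ?thesis
      by (auto simp: eventually_at_filter intro!: always_eventually le_less_trans[OF _ a])
  next
    assume pos: "0 < - V1 b (X b)"
    define k where "k = - V1 b (X b) / (2 * X b)"
    have k: "0 < k" "k * X b < - V1 b (X b)" using pos Xb by (auto simp: k_def divide_neg_pos)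
    have "((\<lambda>x. x + V b x / (k * x)) \<longlongrightarrow> X b + 0 / (k * X b)) (at_left (X b))"
      using Xb k by (intro tendsto_intros prof_tendsto_end[OF p]) auto
    then have "\<forall>\<^sub>F x in at_left (X b). x + V b x / (k * x) < a"
      using a by (intro order_tendstoD) auto
    with prof_uniform_barrier[OF p k] have "\<forall>\<^sub>F x0 in at_left (X b). x0 + V b x0 / (k * x0) < a \<and>
      (\<forall>\<^sub>F a in nhds b. (\<exists>r w w1 w2. tsol n a r w w1 w2 \<and> x0 < r) \<and>
         (\<forall>r w w1 w2 x. tsol n a r w w1 w2 \<longrightarrow> x0 \<le> x \<longrightarrow> x < r \<longrightarrow> w1 x < - k * x))"
      by eventually_elim simp
    then obtain x0 where x0: "0 < x0" "x0 < X b" "x0 + V b x0 / (k * x0) < a"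
      and bar: "\<forall>\<^sub>F a in nhds b. (\<exists>r w w1 w2. tsol n a r w w1 w2 \<and> x0 < r) \<and>
         (\<forall>r w w1 w2 x. tsol n a r w w1 w2 \<longrightarrow> x0 \<le> x \<longrightarrow> x < r \<longrightarrow> w1 x < - k * x)"
      using left_obtain by blast
    have "((\<lambda>c. x0 + V c x0 / (k * x0)) \<longlongrightarrow> x0 + V b x0 / (k * x0)) (at b within S)"
      using x0 k by (intro tendsto_intros fam_pointwise) auto
    then have "\<forall>\<^sub>F c in at b within S. x0 + V c x0 / (k * x0) < a"
      using x0 by (intro order_tendstoD) auto
    then show ?thesis
      using ev_within[OF bar] fam_near[OF x0(1,2) zero_less_one] fam_ev
    proof eventually_elim
      case (elim c)
      note q = elim(4)
      have x: "x0 < X c" using elim by simp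
      have "V c (X c) + k * x0 * X c \<le> V c x0 + k * x0 * x0"
      proof (rule antimono_of_deriv_nonpos[where f = "\<lambda>x. V c x + k * x0 * x" and f' = "\<lambda>x. V1 c x + k * x0"])
        show "continuous_on {x0..X c} (\<lambda>x. V c x + k * x0 * x)"
          using profD(2)[OF q] x0 by (intro continuous_intros) (auto intro: continuous_on_subset)
        fix z assume z: "x0 < z" "z < X c"
        show "((\<lambda>x. V c x + k * x0 * x) has_real_derivative V1 c z + k * x0) (at z)"
          using tsolD(6)[OF profD(1)[OF q], of z] z x0 by (auto intro!: derivative_eq_intros)
        have "V1 c z < - k * z" using elim(2) profD(1)[OF q] z by (meson less_imp_le)
        moreover have "k * x0 \<le> k * z" using k z by auto
        ultimately show "V1 c z + k * x0 \<le> 0" by simp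
      qed (use x in auto)
      then have "k * x0 * (X c - x0) \<le> V c x0" using profD(4)[OF q] by (simp add: algebra_simps)
      then have "X c - x0 \<le> V c x0 / (k * x0)" using k x0 by (simp add: pos_le_divide_eq mult_ac)
      then show ?case using elim(1) by simp
    qed
  qed
qed

text \<open>The steepness at contact is bounded from below by the barrier, with
  \<open>k * X b\<close> just under the limiting steepness. It is bounded from above because
  \<open>V1 c x + c * x\<close> increases, so that beyond \<open>x0\<close> the steepness grows by
  at most \<open>c * (X c - x0)\<close>.\<close>

lemma fam_slope: "((\<lambda>c. - V1 c (X c)) \<longlongrightarrow> - V1 b (X b)) (at b within S)"
proof (rule order_tendstoI)
  note p = fam[OF b]
  note Xb = profD(5)[OF p]
  fix a assume a: "a < - V1 b (X b)"
  show "\<forall>\<^sub>F c in at b within S. a < - V1 c (X c)"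
  proof (cases "a < 0")
    case True
    show ?thesis using fam_ev
    proof eventually_elim
      case (elim c)
      then show ?case using prof_v1_end_nonpos[OF elim] True by simp
    qed
  next
    case False
    obtain s where s: "a < s" "s < - V1 b (X b)" using dense[OF a] by blast
    define k where "k = s / X b"
    have k: "0 < k" "k * X b < - V1 b (X b)" "a < k * X b" using s False Xb by (auto simp: k_def)
    obtain x0 where x0: "0 < x0" "x0 < X b"
      and bar: "\<forall>\<^sub>F a in nhds b. (\<exists>r w w1 w2. tsol n a r w w1 w2 \<and> x0 < r) \<and>
         (\<forall>r w w1 w2 x. tsol n a r w w1 w2 \<longrightarrow> x0 \<le> x \<longrightarrow> x < r \<longrightarrow> w1 x < - k * x)"
      using left_obtain[OF prof_uniform_barrier[OF p k(1,2)]] by blast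
    have "((\<lambda>c. k * X c) \<longlongrightarrow> k * X b) (at b within S)" by (intro tendsto_intros fam_X)
    then have "\<forall>\<^sub>F c in at b within S. a < k * X c" using k by (intro order_tendstoD) auto
    then show ?thesis
      using ev_within[OF bar] fam_near[OF x0 zero_less_one] fam_ev
    proof eventually_elim
      case (elim c)
      note q = elim(4)
      have "V1 c (X c) \<le> - k * X c"
      proof (rule le_at_endpoint[of x0 "X c" "V1 c" "\<lambda>x. - k * x"])
        show "continuous_on {x0..X c} (V1 c)" using profD(3)[OF q] x0 by (auto intro: continuous_on_subset)
        show "V1 c x \<le> - k * x" if "x0 < x" "x < X c" for x
          using elim(2) profD(1)[OF q] that by (meson less_imp_le)
      qed (use elim in \<open>auto intro!: continuous_intros\<close>)
      then show ?case using elim(1) by simp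
    qed
  qed
next
  note p = fam[OF b]
  note Xb = profD(5)[OF p]
  fix a assume a: "- V1 b (X b) < a"
  have "((\<lambda>x. - V1 b x + b * (X b - x)) \<longlongrightarrow> - V1 b (X b) + b * (X b - X b)) (at_left (X b))"
    by (intro tendsto_intros prof_tendsto_end[OF p])
  then have "\<forall>\<^sub>F x in at_left (X b). - V1 b x + b * (X b - x) < a"
    using a by (intro order_tendstoD) auto
  then obtain x0 where x0: "0 < x0" "x0 < X b" "- V1 b x0 + b * (X b - x0) < a"
    using left_obtain by blast
  have "((\<lambda>c. - V1 c x0 + c * (X c - x0)) \<longlongrightarrow> - V1 b x0 + b * (X b - x0)) (at b within S)"
    by (intro tendsto_intros fam_pointwise(2) fam_X x0(1,2))
  then have "\<forall>\<^sub>F c in at b within S. - V1 c x0 + c * (X c - x0) < a" using x0(3) by (rule order_tendstoD)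
  then show "\<forall>\<^sub>F c in at b within S. - V1 c (X c) < a"
    using fam_near[OF x0(1,2) zero_less_one] fam_ev
  proof eventually_elim
    case (elim c)
    then show ?case using prof_v1_plus_mono[of c "X c" "V c" "V1 c" "V2 c" x0] x0 by (simp add: algebra_simps)
  qed
qed

text \<open>Heights lie between 0 and 1, so the part of the mass beyond \<open>x0\<close> is at most
  \<open>X c - x0\<close>; up to \<open>x0\<close> convergence is uniform.\<close>

lemma fam_mass: "((\<lambda>c. integral {0..X c} (V c)) \<longlongrightarrow> integral {0..X b} (V b)) (at b within S)"
proof (rule order_tendstoI)
  note p = fam[OF b]
  note Xb = profD(5)[OF p]
  fix a assume a: "a < integral {0..X b} (V b)"
  have "((\<lambda>x. integral {0..X b} (V b) - (X b - x)) \<longlongrightarrow> integral {0..X b} (V b) - (X b - X b)) (at_left (X b))"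
    by (intro tendsto_intros)
  then have "\<forall>\<^sub>F x in at_left (X b). a < integral {0..X b} (V b) - (X b - x)"
    using a by (intro order_tendstoD) auto
  then obtain x0 where x0: "0 < x0" "x0 < X b" "a < integral {0..X b} (V b) - (X b - x0)"
    using left_obtain by blast
  then have "a < integral {0..x0} (V b)" using prof_mass_split(2)[OF p, of x0] by auto
  then have "\<forall>\<^sub>F c in at b within S. a < integral {0..x0} (V c)"
    using fam_pointwise(3)[OF x0(1,2)] by (intro order_tendstoD)
  then show "\<forall>\<^sub>F c in at b within S. a < integral {0..X c} (V c)"
    using fam_near[OF x0(1,2) zero_less_one] fam_ev
  proof eventually_elim
    case (elim c)
    then show ?case using prof_mass_split(1)[OF elim(3), of x0] x0 by auto
  qed
next
  note p = fam[OF b]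
  note Xb = profD(5)[OF p]
  fix a assume a: "integral {0..X b} (V b) < a"
  have "((\<lambda>x. integral {0..X b} (V b) + (X b - x)) \<longlongrightarrow> integral {0..X b} (V b) + (X b - X b)) (at_left (X b))"
    by (intro tendsto_intros)
  then have "\<forall>\<^sub>F x in at_left (X b). integral {0..X b} (V b) + (X b - x) < a"
    using a by (intro order_tendstoD) auto
  then obtain x0 where x0: "0 < x0" "x0 < X b" "integral {0..X b} (V b) + (X b - x0) < a"
    using left_obtain by blast
  then have l: "integral {0..x0} (V b) + (X b - x0) < a" using prof_mass_split(1)[OF p, of x0] by auto
  have "((\<lambda>c. integral {0..x0} (V c) + (X c - x0)) \<longlongrightarrow> integral {0..x0} (V b) + (X b - x0)) (at b within S)"
    by (intro tendsto_intros fam_pointwise fam_X x0)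
  then have "\<forall>\<^sub>F c in at b within S. integral {0..x0} (V c) + (X c - x0) < a"
    using l by (rule order_tendstoD)
  then show "\<forall>\<^sub>F c in at b within S. integral {0..X c} (V c) < a"
    using fam_near[OF x0(1,2) zero_less_one] fam_ev
  proof eventually_elim
    case (elim c)
    then show ?case using prof_mass_split(2)[OF elim(3), of x0] x0 by auto
  qed
qed

lemma fam_friction:
  "((\<lambda>c. friction (X c) (V c) (V1 c)) \<longlongrightarrow> friction (X b) (V b) (V1 b)) (at b within S)"
  unfolding friction_def
  using prof_mass_pos[OF fam[OF b]] profD(5)[OF fam[OF b]]
  by (intro tendsto_mult fam_slope tendsto_powr fam_mass fam_X tendsto_const) auto

end

section \<open>Every nonnegative friction coefficient is attained\<close>

text \<open>The second condition on \<open>b\<close> is that of \<open>tsol_steep\<close> with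
  \<open>c = b / 4\<close>, so the final steepness is at least \<open>b * X / 4\<close>. The mass is
  at most \<open>X\<close>, which leaves \<open>b / 4 * X powr (1 - k - l)\<close>. Finally
  \<open>v \<ge> 1 - b * x^2 / 2\<close> forces \<open>X^2 \<ge> 2 / b\<close>.\<close>

lemma prof_friction_large:
  assumes p: "prof b X v v1 v2" and b: "2 \<le> b" "1 / (b / 4 * (3 - n)) + b / 4 < b"
  shows "sqrt b / 4 \<le> friction X v v1"
proof -
  note s = profD(1)[OF p] and X = profD(5)[OF p]
  define k where "k = (3 - n) / (n + 3)"
  define l where "l = 2 / (n + 3)"
  have slope: "v1 X \<le> - (b / 4) * X"
    by (rule le_at_endpoint[of 0 X v1 "\<lambda>x. - (b / 4) * x"])
      (use X profD(3)[OF p] tsol_steep[OF s _ b(2)] b in \<open>auto intro!: continuous_intros less_imp_le\<close>)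
  have "v 0 + b * 0\<^sup>2 / 2 \<le> v X + b * X\<^sup>2 / 2"
  proof (rule mono_of_deriv_nonneg[where f = "\<lambda>x. v x + b * x\<^sup>2 / 2" and f' = "\<lambda>x. v1 x + b * x"])
    show "continuous_on {0..X} (\<lambda>x. v x + b * x\<^sup>2 / 2)" by (intro continuous_intros profD(2)[OF p]) auto
    show "((\<lambda>x. v x + b * x\<^sup>2 / 2) has_real_derivative v1 z + b * z) (at z)" if "0 < z" "z < X" for z
      using tsolD(6)[OF s that] by (auto intro!: derivative_eq_intros)
    show "0 \<le> v1 z + b * z" if "0 < z" "z < X" for z using tsol_v1_ge[OF s, of z] that by auto
  qed (use X in auto)
  then have X2: "2 / b \<le> X\<^sup>2"
    using profD(4)[OF p] tsolD(2)[OF s] b by (simp add: field_simps)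
  have m: "0 < integral {0..X} v" "integral {0..X} v \<le> X"
    using prof_mass_pos[OF p] prof_mass_split(2)[OF p, of 0] X by auto
  have k: "0 \<le> k" "0 \<le> l" using n1 n3 by (auto simp: k_def l_def)
  have "k + l = (5 - n) / (n + 3)" by (simp add: k_def l_def flip: add_divide_distrib)
  then have "1 - k - l = 1 - (5 - n) / (n + 3)" by simp
  then have kl: "1 - k - l = (2 * n - 2) / (n + 3)" using n1 by (simp add: field_simps)
  have kl': "0 \<le> 1 - k - l" "1 - k - l \<le> 1" unfolding kl using n1 n3 by (auto simp: divide_simps)
  have "(b / 4 * X) * X powr (- k) * X powr (- l) \<le> friction X v v1"
    unfolding friction_def k_def[symmetric] l_def[symmetric]
    using slope m k b X prof_v1_end_nonpos[OF p]
    by (intro mult_mono powr_mono2') (auto intro: mult_nonpos_nonneg)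
  moreover have "(b / 4 * X) * X powr (- k) * X powr (- l) = b / 4 * X powr (1 - k - l)"
  proof -
    have "X powr (1 - k - l) = X powr (1 + - k + - l)" by simp
    also have "\<dots> = X powr 1 * X powr (- k) * X powr (- l)" by (simp only: powr_add)
    finally show ?thesis using X by simp
  qed
  moreover have "(2 / b) powr (1 / 2) \<le> X powr (1 - k - l)"
  proof -
    \<comment> \<open>The base is at most 1 because \<open>2 \<le> b\<close>, so the larger exponent
      gives the smaller power.\<close>
    have "(2 / b) powr (1 / 2) \<le> (2 / b) powr ((1 - k - l) / 2)"
      using b kl' by (intro powr_mono') auto
    also have "\<dots> \<le> (X\<^sup>2) powr ((1 - k - l) / 2)"
      using X2 b kl' by (intro powr_mono2) auto
    also have "X\<^sup>2 = X powr 2" using X by simp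
    also have "(X powr 2) powr ((1 - k - l) / 2) = X powr (2 * ((1 - k - l) / 2))" by (rule powr_powr)
    also have "2 * ((1 - k - l) / 2) = 1 - k - l" by simp
    finally show ?thesis .
  qed
  then have "b / 4 * (2 / b) powr (1 / 2) \<le> b / 4 * X powr (1 - k - l)"
    using b by (intro mult_left_mono) auto
  moreover have "sqrt b / 4 \<le> b / 4 * (2 / b) powr (1 / 2)"
  proof -
    have "sqrt b * 1 \<le> sqrt b * sqrt 2" using b by (intro mult_left_mono) auto
    also have "\<dots> = b * (sqrt 2 / sqrt b)" using b by (simp add: field_simps flip: power2_eq_square)
    also have "\<dots> = b * (2 / b) powr (1 / 2)" using b by (simp add: powr_half_sqrt real_sqrt_divide)
    finally show ?thesis by simp
  qed
  ultimately show ?thesis by linarith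
qed

lemma prof_exists_friction:
  assumes D: "0 \<le> D"
  obtains b X v v1 v2 where "prof b X v v1 v2" "friction X v v1 = D"
proof -
  define S where "S = {b_crit..}"
  have "\<exists>X v v1 v2. prof c X v v1 v2" if "c \<in> S" for c
    by (rule not_rebounds_prof[OF not_rebounds_ge_crit[of c]]) (use that in \<open>auto simp: S_def\<close>)
  then obtain X V V1 V2 where fam: "\<And>c. c \<in> S \<Longrightarrow> prof c (X c) (V c) (V1 c) (V2 c)"
    by metis
  define f where "f = (\<lambda>c. friction (X c) (V c) (V1 c))"
  have crit: "b_crit \<in> S" by (simp add: S_def)
  have cont: "continuous_on S f"
    unfolding continuous_on_def f_def
  proof
    fix c assume c: "c \<in> S"
    \<comment> \<open>At \<open>b_crit\<close> the slope vanishes, but \<open>S\<close> lies to its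
      right; any larger curvature has a strictly steeper contact by comparison.\<close>
    have side: "0 < - V1 c (X c) \<or> S \<subseteq> {c..}"
    proof (cases "c = b_crit")
      case False
      then have "b_crit < c" using c by (simp add: S_def)
      then show ?thesis
        using prof_compare(2)[OF fam[OF c] fam[OF crit]] prof_crit_slope[OF fam[OF crit]] by simp
    qed (simp add: S_def)
    show "((\<lambda>c. friction (X c) (V c) (V1 c)) \<longlongrightarrow> friction (X c) (V c) (V1 c)) (at c within S)"
      using fam_friction[of S X V V1 V2 c] fam c side by blast
  qed
  have f0: "f b_crit = 0" using prof_crit_slope[OF fam[OF crit]] by (simp add: f_def friction_def)
  \<comment> \<open>The last two entries make \<open>1 / (B / 4 * (3 - n)) \<le> 1\<close> and
    \<open>D \<le> sqrt B / 4\<close>; the first two are the remaining requirements of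
    \<open>prof_friction_large\<close> and membership in \<open>S\<close>.\<close>
  define B where "B = max (max b_crit 2) (max (4 / (3 - n)) ((4 * D)\<^sup>2))"
  have B: "b_crit \<le> B" "2 \<le> B" "4 / (3 - n) \<le> B" "(4 * D)\<^sup>2 \<le> B" by (auto simp: B_def)
  have "1 / (B / 4 * (3 - n)) + B / 4 < B"
  proof -
    have "1 / (B / 4 * (3 - n)) = (4 / (3 - n)) / B" by simp
    also have "\<dots> \<le> 1" using B by (subst pos_divide_le_eq) auto
    finally show ?thesis using B by simp
  qed
  then have "sqrt B / 4 \<le> f B"
    unfolding f_def using B by (intro prof_friction_large[OF fam]) (auto simp: S_def)
  moreover have "4 * D \<le> sqrt B" using B(4) by (rule real_le_rsqrt)
  ultimately have "D \<le> f B" by simp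
  then obtain c where c: "b_crit \<le> c" "c \<le> B" "f c = D"
    using IVT'[of f b_crit D B] f0 D B(1) continuous_on_subset[OF cont, of "{b_crit..B}"]
    by (auto simp: S_def)
  then show ?thesis using that[OF fam[of c]] by (auto simp: S_def f_def)
qed

section \<open>Rescaling to the unit interval\<close>

text \<open>A larger curvature gives a steeper contact and no larger mass and length. The latter two
  enter with nonpositive exponents, so all three effects point the same way.\<close>

lemma friction_less:
  assumes p: "prof b X v v1 v2" and q: "prof c Y w w1 w2" and bc: "c < b"
  shows "friction Y w w1 < friction X v v1"
proof -
  define k where "k = (3 - n) / (n + 3)"
  define l where "l = 2 / (n + 3)"
  have k: "0 \<le> k" "0 \<le> l" using n1 n3 by (auto simp: k_def l_def)
  note cmp = prof_compare[OF p q bc] and m = prof_mass_pos[OF p] and X = profD(5)[OF p]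
  define P where "P = integral {0..X} v powr (- k) * X powr (- l)"
  have "integral {0..Y} w powr (- k) * Y powr (- l) \<le> P"
    unfolding P_def using k m X cmp by (intro mult_mono powr_mono2') auto
  then have "- w1 Y * (integral {0..Y} w powr (- k) * Y powr (- l)) \<le> - w1 Y * P"
    using prof_v1_end_nonpos[OF q] by (intro mult_left_mono) auto
  also have "\<dots> < - v1 X * P"
    using cmp(2) m X by (intro mult_strict_right_mono) (auto simp: P_def)
  finally show ?thesis
    unfolding friction_def P_def k_def l_def by (simp add: mult_ac)
qed

text \<open>With \<open>A = exp a\<close> and \<open>X = exp x\<close> the claim becomes a linear
  identity between exponents: with \<open>\<alpha> = 4 / (n + 3)\<close> they add up to
  \<open>a + x\<close>.\<close>

lemma friction_scale:
  assumes A: "0 < A" and X: "0 < X" and B: "B = A powr (n / 2) * X\<^sup>2"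
  shows "A * X = (X / A) powr (- ((3 - n) / (n + 3))) * X powr (- (2 / (n + 3))) * B powr tf_alpha n"
proof -
  obtain a x where a: "A = exp a" and x: "X = exp x" using A X by (metis exp_ln)
  have "(exp x)\<^sup>2 = exp (2 * x)" by (simp add: exp_double)
  then have hB: "B = exp (a * (n / 2) + 2 * x)" unfolding B a x by (simp add: exp_powr_real exp_add)
  have hXA: "X / A = exp (x - a)" unfolding a x by (simp add: exp_diff)
  have "(X / A) powr (- ((3 - n) / (n + 3))) * X powr (- (2 / (n + 3))) * B powr tf_alpha n
    = exp ((x - a) * (- ((3 - n) / (n + 3))) + x * (- (2 / (n + 3))) + (a * (n / 2) + 2 * x) * tf_alpha n)"
    unfolding hXA hB unfolding x exp_powr_real by (simp only: exp_add)
  also have "(x - a) * (- ((3 - n) / (n + 3))) + x * (- (2 / (n + 3))) + (a * (n / 2) + 2 * x) * tf_alpha n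
    = ((x - a) * (n - 3) - 2 * x + 4 * (a * (n / 2) + 2 * x)) / (n + 3)"
    by (simp add: tf_alpha_def add_divide_distrib diff_divide_distrib algebra_simps)
  also have "\<dots> = a + x" using n1 by (simp add: field_simps)
  finally show ?thesis unfolding a x by (simp add: exp_add)
qed

lemma tf_solution_of_prof:
  assumes p: "prof b X v v1 v2"
  shows "\<exists>B H. tf_solution n (friction X v v1) B H"
proof -
  note s = profD(1)[OF p] and X = profD(5)[OF p]
  define m where "m = integral {0..X} v"
  have m: "0 < m" unfolding m_def by (rule prof_mass_pos[OF p])
  \<comment> \<open>The height factor is fixed by unit mass; \<open>B\<close> below is then fixed by
    the equation, since the rescaled profile satisfies it with coefficient
    \<open>A powr n * X ^ 4\<close>.\<close>
  define A where "A = X / m"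
  have A: "0 < A" "X / A = m" using X m by (auto simp: A_def)
  define B where "B = A powr (n / 2) * X\<^sup>2"
  have B: "0 < B" using A X by (simp add: B_def)
  have B2: "B\<^sup>2 = A powr n * X ^ 4"
  proof -
    have "(A powr (n / 2))\<^sup>2 = A powr n" by (simp add: power2_eq_square flip: powr_add)
    then show ?thesis by (simp add: B_def power_mult_distrib)
  qed
  define H where "H = (\<lambda>x. A * v (X * x))"
  define H1 where "H1 = (\<lambda>x. A * X * v1 (X * x))"
  define H2 where "H2 = (\<lambda>x. A * X\<^sup>2 * v2 (X * x))"
  define H3 where "H3 = (\<lambda>x. A * X ^ 3 * (X * x * v (X * x) powr (1 - n)))"
  have Xx: "0 < X * x" "X * x < X" if "0 < x" "x < 1" for x using that X by auto
  have chain: "((\<lambda>x. K * f (X * x)) has_real_derivative K * X * f') (at x)"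
    if "(f has_real_derivative f') (at (X * x))" for f f' K x
    using DERIV_cmult[OF DERIV_chain2[OF that DERIV_cmult_Id[of X x UNIV]], of K] by (simp add: mult_ac)
  have cH: "continuous_on {0..1} H" unfolding H_def
    by (intro continuous_intros continuous_on_compose2[OF profD(2)[OF p]]) (use X in auto)
  have cH1: "continuous_on {0..1} H1" unfolding H1_def
    by (intro continuous_intros continuous_on_compose2[OF profD(3)[OF p]]) (use X in auto)
  have dH: "(H has_real_derivative H1 x) (at x)" if "0 < x" "x < 1" for x
    unfolding H_def H1_def by (rule chain[OF tsolD(6)[OF s Xx[OF that]]])
  have dH1: "(H1 has_real_derivative H2 x) (at x)" if "0 < x" "x < 1" for x
    unfolding H1_def H2_def
    using chain[OF tsolD(7)[OF s Xx[OF that]], of "A * X"] by (simp add: power2_eq_square mult_ac)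
  have dH2: "(H2 has_real_derivative H3 x) (at x)" if "0 < x" "x < 1" for x
    unfolding H2_def H3_def
    using chain[OF tsolD(8)[OF s Xx[OF that]], of "A * X\<^sup>2"]
    by (simp add: power2_eq_square power3_eq_cube mult_ac)
  have pos: "0 < v (X * x)" if "0 \<le> x" "x < 1" for x using tsolD(5)[OF s, of "X * x"] that X by auto
  have cH3: "continuous_on {0<..<1} H3"
    unfolding H3_def
  proof (intro continuous_intros continuous_on_compose2[OF profD(2)[OF p]] ballI disjI1)
    fix x :: real assume "x \<in> {0<..<1}"
    then show "v (X * x) \<noteq> 0" using pos[of x] by auto
  qed (use X in \<open>auto simp: mult_le_cancel_left1\<close>)
  have ode: "H x powr (n - 1) * H3 x = B\<^sup>2 * x" if "0 < x" "x < 1" for x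
  proof -
    have vx: "0 < v (X * x)" using pos that by auto
    have "H x powr (n - 1) * H3 x
      = (A powr (n - 1) * A) * X ^ 4 * x * (v (X * x) powr (n - 1) * v (X * x) powr (1 - n))"
      unfolding H_def H3_def using A vx by (simp add: powr_mult power_def eval_nat_numeral mult_ac)
    also have "v (X * x) powr (n - 1) * v (X * x) powr (1 - n) = 1"
      using vx by (simp flip: powr_add)
    also have "A powr (n - 1) * A = A powr n"
      using A powr_mult_base[of A "n - 1"] by (simp add: mult.commute)
    finally show ?thesis by (simp add: B2)
  qed
  have slope: "(H1 1)\<^sup>2 = (friction X v v1)\<^sup>2 * B powr (2 * tf_alpha n)"
  proof -
    have "- H1 1 = - v1 X * (A * X)" by (simp add: H1_def)
    also have "\<dots> = friction X v v1 * B powr tf_alpha n"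
      unfolding friction_scale[OF A(1) X B_def] A(2) friction_def m_def by (simp add: mult_ac)
    finally have "(- H1 1)\<^sup>2 = (friction X v v1)\<^sup>2 * (B powr tf_alpha n)\<^sup>2"
      by (simp add: power_mult_distrib)
    also have "(B powr tf_alpha n)\<^sup>2 = B powr (2 * tf_alpha n)"
      by (simp add: power2_eq_square flip: powr_add)
    finally show ?thesis by simp
  qed
  have int: "(H has_integral 1) {0..1}"
  proof -
    have "(v has_integral m) {0..X}"
      unfolding m_def by (intro integrable_integral integrable_continuous_real profD(2)[OF p])
    from has_integral_stretch_real[OF this, of X]
    have "((\<lambda>x. v (X * x)) has_integral m / X) ((\<lambda>x. x / X) ` {0..X})" using X by simp
    moreover have "(\<lambda>x. x / X) ` {0..X} = {0..1}"
      using X image_divide_atLeastAtMost[of X 0 X] by simp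
    ultimately have "((\<lambda>x. v (X * x)) has_integral m / X) {0..1}" by simp
    then have "((\<lambda>x. A * v (X * x)) has_integral A * (m / X)) {0..1}"
      by (rule has_integral_mult_right)
    then show ?thesis using X m by (simp add: H_def A_def)
  qed
  have "tf_solution n (friction X v v1) B H"
  proof (rule tf_solutionI[where P = H1 and Q = H2 and R = H3])
    show "(H has_real_derivative H1 x) (at x within {0..1})" if "0 \<le> x" "x \<le> 1" for x
      by (rule has_real_derivative_closed_interval[OF _ cH cH1 dH]) (use that in auto)
    show "0 < H x" if "0 \<le> x" "x < 1" for x using pos[of x] A that by (simp add: H_def)
    show "H1 0 = 0" "H 1 = 0" using tsolD(3)[OF s] profD(4)[OF p] by (auto simp: H_def H1_def)
  qed (use B cH1 dH1 dH2 cH3 ode slope int in auto)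
  then show ?thesis by blast
qed

text \<open>For \<open>B = 0\<close> the third derivative vanishes, so the slope is linear. It is 0
  at both ends by symmetry and the contact law, hence \<open>H\<close> is constant, contradicting
  \<open>H 0 > 0 = H 1\<close>.\<close>

lemma tf_solution_B_pos:
  assumes "tf_solution n D B H"
  shows "0 < B"
proof (rule ccontr)
  assume "\<not> 0 < B"
  then have B: "B = 0" using assms by (simp add: tf_solution_def)
  obtain H1 H2 H3 where pos: "\<And>x. 0 \<le> x \<Longrightarrow> x < 1 \<Longrightarrow> 0 < H x"
    and d: "\<And>x. 0 \<le> x \<Longrightarrow> x \<le> 1 \<Longrightarrow> (H has_real_derivative H1 x) (at x within {0..1})"
    and c1: "continuous_on {0..1} H1"
    and d1: "\<And>x. 0 < x \<Longrightarrow> x < 1 \<Longrightarrow> (H1 has_real_derivative H2 x) (at x)"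
    and d2: "\<And>x. 0 < x \<Longrightarrow> x < 1 \<Longrightarrow> (H2 has_real_derivative H3 x) (at x)"
    and ode: "\<And>x. 0 < x \<Longrightarrow> x < 1 \<Longrightarrow> H x powr (n - 1) * H3 x = B\<^sup>2 * x"
    and h: "H1 0 = 0" "(H1 1)\<^sup>2 = D\<^sup>2 * B powr (2 * tf_alpha n)" "H 1 = 0"
    and int: "(H has_integral 1) {0..1}"
    by (rule tf_solutionE[OF assms], rule that, assumption+)
  have H3: "H3 x = 0" if "0 < x" "x < 1" for x
    using ode[OF that] pos[of x] that B by auto
  have H2: "H2 x = H2 (1/2)" if x: "0 < x" "x < 1" for x
  proof (rule DERIV_isconst3[of 0 1 x "1/2" H2])
    show "(H2 has_real_derivative 0) (at z)" if "z \<in> {0<..<1}" for z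
      using d2[of z] H3[of z] that by auto
  qed (use x in auto)
  have lin: "((\<lambda>x. H1 x - H2 (1/2) * x) has_real_derivative 0) (at x)" if "0 < x" "x < 1" for x
    using d1[OF that] H2[OF that] by (auto intro!: derivative_eq_intros)
  have H1: "H1 x - H2 (1/2) * x = H1 0 - H2 (1/2) * 0" if x: "0 \<le> x" "x \<le> 1" for x
    by (rule DERIV_isconst2[OF zero_less_one _ lin x]) (auto intro!: continuous_intros c1)
  \<comment> \<open>Here \<open>0 powr (2 * tf_alpha n) = 0\<close> makes the right-hand side of the
    contact law vanish for every \<open>D\<close>.\<close>
  have "H1 1 = 0" using h B by simp
  then have "H2 (1/2) = 0" using H1[of 1] h by simp
  then have H10: "H1 x = 0" if "0 \<le> x" "x \<le> 1" for x using H1[OF that] h by simp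
  have "H 1 = H 0"
  proof (rule DERIV_isconst_end[OF zero_less_one])
    show "continuous_on {0..1} H" using d by (intro DERIV_continuous_on) auto
    show "(H has_real_derivative 0) (at x)" if "0 < x" "x < 1" for x
    proof -
      have "at x within {0..1} = at x" using that by (intro at_within_interior) auto
      then show ?thesis using d[of x] H10[of x] that by auto
    qed
  qed
  then show False using pos[of 0] h by simp
qed

text \<open>The scaling is inverted: \<open>A\<close> is the central height, \<open>X\<close> is
  determined by \<open>B = A powr (n / 2) * X^2\<close>, and the curvature is read off at the
  centre. Unit mass then says that \<open>A = X / integral {0..X} v\<close>.\<close>

lemma prof_of_tf_solution:
  assumes sol: "tf_solution n D B H" and D: "0 \<le> D"
  obtains b X v v1 v2 A where "prof b X v v1 v2" "friction X v v1 = D" "A = X / integral {0..X} v"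
    "B = A powr (n / 2) * X\<^sup>2" "\<And>x. x \<in> {0..1} \<Longrightarrow> H x = A * v (X * x)"
proof -
  have B: "0 < B" by (rule tf_solution_B_pos[OF sol])
  obtain H1 H2 H3 where pos: "\<And>x. 0 \<le> x \<Longrightarrow> x < 1 \<Longrightarrow> 0 < H x"
    and d': "\<And>x. 0 \<le> x \<Longrightarrow> x \<le> 1 \<Longrightarrow> (H has_real_derivative H1 x) (at x within {0..1})"
    and c1: "continuous_on {0..1} H1"
    and d1: "\<And>x. 0 < x \<Longrightarrow> x < 1 \<Longrightarrow> (H1 has_real_derivative H2 x) (at x)"
    and d2: "\<And>x. 0 < x \<Longrightarrow> x < 1 \<Longrightarrow> (H2 has_real_derivative H3 x) (at x)"
    and ode: "\<And>x. 0 < x \<Longrightarrow> x < 1 \<Longrightarrow> H x powr (n - 1) * H3 x = B\<^sup>2 * x"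
    and h: "H1 0 = 0" "(H1 1)\<^sup>2 = D\<^sup>2 * B powr (2 * tf_alpha n)" "H 1 = 0"
    and int: "(H has_integral 1) {0..1}"
    by (rule tf_solutionE[OF sol], rule that, assumption+)
  have d: "(H has_real_derivative H1 x) (at x)" if "0 < x" "x < 1" for x
  proof -
    have "at x within {0..1} = at x" using that by (intro at_within_interior) auto
    then show ?thesis using d'[of x] that by auto
  qed
  have c0: "continuous_on {0..1} H" using d' by (intro DERIV_continuous_on) auto
  define g where "g = (\<lambda>x. B\<^sup>2 * x * H x powr (1 - n))"
  have H3: "H3 x = g x" if x: "0 < x" "x < 1" for x
  proof -
    have "H x powr (1 - n) * H x powr (n - 1) = 1" using pos[of x] x by (simp flip: powr_add)
    then have "H3 x = H x powr (1 - n) * (H x powr (n - 1) * H3 x)" by simp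
    then show ?thesis unfolding ode[OF x] by (simp add: g_def)
  qed
  have cg: "continuous_on {0..y} g" if "y < 1" for y
    unfolding g_def
  proof (intro continuous_intros continuous_on_subset[OF c0] ballI disjI1)
    fix x assume "x \<in> {0..y}"
    then show "H x \<noteq> 0" using pos[of x] that by auto
  qed (use that in auto)
  text \<open>The hypotheses control \<open>H2\<close> only inside the interval; this is its continuous extension to 0.\<close>
  define G where "G = (\<lambda>x. H2 (1/2) - integral {0..1/2} g + integral {0..x} g)"
  have dG: "(G has_real_derivative g x) (at x within {0..y})" if "x \<in> {0..y}" "y < 1" for x y
    unfolding G_def by (auto intro!: derivative_eq_intros integral_has_real_derivative cg that)
  have cG: "continuous_on {0..<1} G"
    by (rule continuous_on_Ico_if_Icc) (rule DERIV_continuous_on[OF dG])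
  have dG': "(G has_real_derivative g x) (at x)" if x: "0 < x" "x < 1" for x
  proof -
    have "at x within {0..(x + 1) / 2} = at x" using x by (intro at_within_interior) auto
    then show ?thesis using dG[of x "(x + 1) / 2"] x by auto
  qed
  have G: "G x = H2 x" if x: "0 < x" "x < 1" for x
  proof -
    have "H2 x - G x = H2 (1/2) - G (1/2)"
    proof (rule DERIV_isconst3[of 0 1 x "1/2" "\<lambda>x. H2 x - G x"])
      fix z :: real assume "z \<in> {0<..<1}"
      then have z: "0 < z" "z < 1" by auto
      show "((\<lambda>x. H2 x - G x) has_real_derivative 0) (at z)"
        using DERIV_diff[OF d2[OF z] dG'[OF z]] H3[OF z] by simp
    qed (use x in auto)
    then show ?thesis by (simp add: G_def)
  qed
  define A where "A = H 0"
  have A: "0 < A" using pos[of 0] by (simp add: A_def)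
  define X where "X = sqrt (B / A powr (n / 2))"
  have X: "0 < X" using A B by (simp add: X_def)
  have "X\<^sup>2 = B / A powr (n / 2)" using A B by (simp add: X_def)
  then have BX: "B = A powr (n / 2) * X\<^sup>2" using A by (simp add: field_simps)
  have B2: "B\<^sup>2 = A powr n * X ^ 4"
  proof -
    have "(A powr (n / 2))\<^sup>2 = A powr n" by (simp add: power2_eq_square flip: powr_add)
    then show ?thesis by (simp add: BX power_mult_distrib)
  qed
  define v where "v = (\<lambda>x. 1 / A * H (1 / X * x))"
  define v1 where "v1 = (\<lambda>x. 1 / (A * X) * H1 (1 / X * x))"
  define v2 where "v2 = (\<lambda>x. 1 / (A * X\<^sup>2) * G (1 / X * x))"
  have chain: "((\<lambda>x. K * f (1 / X * x)) has_real_derivative K * (1 / X) * f') (at x)"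
    if "(f has_real_derivative f') (at (1 / X * x))" for f f' K x
    using DERIV_cmult[OF DERIV_chain2[OF that DERIV_cmult_Id[of "1 / X" x UNIV]], of K] by (simp add: mult_ac)
  have inX: "0 < 1 / X * x" "1 / X * x < 1" if "0 < x" "x < X" for x using that X by auto
  have cv: "continuous_on {0..X} v" unfolding v_def
    by (intro continuous_intros continuous_on_compose2[OF c0]) (use X in auto)
  have cv1: "continuous_on {0..X} v1" unfolding v1_def
    by (intro continuous_intros continuous_on_compose2[OF c1]) (use X in auto)
  have cv2: "continuous_on {0..<X} v2" unfolding v2_def
    by (intro continuous_intros continuous_on_compose2[OF cG]) (use X in auto)
  have p: "prof (- v2 0) X v v1 v2"
    unfolding prof_def tsol_def
  proof (intro conjI ballI)
    show "continuous_on {0..<X} v" "continuous_on {0..<X} v1"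
      using cv cv1 by (auto intro: continuous_on_subset)
    show "0 < v x" if "x \<in> {0..<X}" for x using pos[of "1 / X * x"] that X A by (auto simp: v_def)
    fix x assume "x \<in> {0<..<X}"
    then have x: "0 < x" "x < X" by auto
    note x' = inX[OF x]
    show "(v has_real_derivative v1 x) (at x)"
      unfolding v_def v1_def using chain[OF d[OF x'], of "1 / A"] by simp
    show "(v1 has_real_derivative v2 x) (at x)"
      unfolding v1_def v2_def using chain[OF d1[OF x'], of "1 / (A * X)"] G[OF x']
      by (simp add: power2_eq_square mult_ac)
    have "1 / (A * X\<^sup>2) * (1 / X) * g (1 / X * x) = x * v x powr (1 - n)"
    proof -
      have Hx: "0 < H (1 / X * x)" using pos x' by auto
      have "A powr n = A * (A powr (n - 1))" using powr_mult_base[of A "n - 1"] A by simp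
      moreover have "v x powr (1 - n) = A powr (n - 1) * H (1 / X * x) powr (1 - n)"
        unfolding v_def using A Hx by (simp add: powr_mult powr_divide powr_minus_divide[of A "n - 1"] powr_diff)
      ultimately show ?thesis
        unfolding g_def B2 using A X by (simp add: eval_nat_numeral)
    qed
    then show "(v2 has_real_derivative x * v x powr (1 - n)) (at x)"
      unfolding v2_def using chain[OF dG'[OF x'], of "1 / (A * X\<^sup>2)"] by (simp add: v_def)
  qed (use X A cv cv1 cv2 h in \<open>auto simp: v_def v1_def A_def[symmetric]\<close>)
  have m: "integral {0..X} v = X / A"
  proof -
    from has_integral_stretch_real[OF int, of "1 / X"]
    have "((\<lambda>x. H (1 / X * x)) has_integral X) ((\<lambda>x. x * X) ` {0..1})" using X by simp
    moreover have "(\<lambda>x. x * X) ` {0..1} = {0..X}"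
      using X image_mult_atLeastAtMost[of X 0 1] by (simp add: mult.commute)
    ultimately have "((\<lambda>x. H (1 / X * x)) has_integral X) {0..X}" by simp
    then have "(v has_integral 1 / A * X) {0..X}"
      unfolding v_def by (rule has_integral_mult_right)
    then show ?thesis by (simp add: integral_unique)
  qed
  \<comment> \<open>The contact law fixes only squares; the signs come from \<open>0 \<le> D\<close>
    and from the profile being nonincreasing at contact.\<close>
  have HD: "- H1 1 = D * B powr tf_alpha n"
  proof -
    have "B powr (2 * tf_alpha n) = (B powr tf_alpha n)\<^sup>2"
      by (simp add: power2_eq_square flip: powr_add)
    then have "(- H1 1)\<^sup>2 = (D * B powr tf_alpha n)\<^sup>2" using h by (simp add: power_mult_distrib)
    moreover have "0 \<le> - H1 1"
    proof -
      have "v1 X = 1 / (A * X) * H1 1" using X by (simp add: v1_def)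
      then show ?thesis using prof_v1_end_nonpos[OF p] mult_pos_pos[OF A X] by (auto simp: divide_le_0_iff)
    qed
    ultimately show ?thesis by (rule power2_eq_imp_eq) (use D in auto)
  qed
  have "friction X v v1 = D"
  proof -
    define q where "q = (X / A) powr (- ((3 - n) / (n + 3))) * X powr (- (2 / (n + 3)))"
    have q: "0 < q" using A X by (simp add: q_def)
    have AX: "A * X = q * B powr tf_alpha n" unfolding q_def by (rule friction_scale[OF A X BX])
    have "friction X v v1 = - v1 X * q" unfolding friction_def m q_def by simp
    also have "\<dots> = - H1 1 * q / (A * X)" using X by (simp add: v1_def)
    also have "\<dots> = D * (B powr tf_alpha n * q) / (A * X)" unfolding HD by simp
    also have "\<dots> = D" using q B by (simp add: AX mult.commute)
    finally show ?thesis .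
  qed
  moreover have "A = X / integral {0..X} v" unfolding m using X A by simp
  moreover have "H x = A * v (X * x)" if "x \<in> {0..1}" for x using X A by (simp add: v_def)
  ultimately show ?thesis using that p BX by blast
qed

text \<open>Both solutions come from profiles with the same friction. Strict monotonicity of the
  friction makes the curvatures equal, and the profile then determines \<open>A\<close>,
  \<open>B\<close> and \<open>H\<close>.\<close>

lemma tf_solution_unique:
  assumes "tf_solution n D B H" "tf_solution n D B' H'" and D: "0 \<le> D"
  shows "B' = B" "\<And>x. x \<in> {0..1} \<Longrightarrow> H' x = H x"
proof -
  obtain b X v v1 v2 A where p: "prof b X v v1 v2" "friction X v v1 = D" "A = X / integral {0..X} v"
    "B = A powr (n / 2) * X\<^sup>2" "\<And>x. x \<in> {0..1} \<Longrightarrow> H x = A * v (X * x)"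
    using prof_of_tf_solution[OF assms(1) D] by blast
  obtain c Y w w1 w2 A' where q: "prof c Y w w1 w2" "friction Y w w1 = D" "A' = Y / integral {0..Y} w"
    "B' = A' powr (n / 2) * Y\<^sup>2" "\<And>x. x \<in> {0..1} \<Longrightarrow> H' x = A' * w (Y * x)"
    using prof_of_tf_solution[OF assms(2) D] by blast
  have "b = c"
    using friction_less[OF p(1) q(1)] friction_less[OF q(1) p(1)] p(2) q(2) by (cases b c rule: linorder_cases) auto
  note u = prof_unique[OF p(1) q(1)[folded \<open>b = c\<close>]]
  have "integral {0..X} w = integral {0..X} v" using u(2) by (intro integral_cong) auto
  then have A: "A' = A" using p(3) q(3) u(1) by simp
  then show "B' = B" using p(4) q(4) u(1) by simp
  show "H' x = H x" if "x \<in> {0..1}" for x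
    using p(5)[OF that] q(5)[OF that] A u(1) u(2)[of "X * x"] that profD(5)[OF p(1)] by (simp add: mult_left_le)
qed

section \<open>Large friction\<close>

text \<open>With \<open>\<gamma> = - H1 1\<close>, the function
  \<open>\<phi> x = H1 x + \<gamma> * x\<close> vanishes at both ends and is convex, hence
  nonpositive; integrating from 1 places \<open>H\<close> above the parabola. This lower bound
  controls \<open>H3\<close> by \<open>C * (1 - x) powr (1 - n)\<close>, and the concave
  \<open>\<psi>\<close> has second derivative \<open>- C * (1 - x) powr (a - 2)\<close>. So
  \<open>- \<phi> - \<psi>\<close> is convex and nonpositive at the ends, which gives
  \<open>- \<phi> \<le> \<psi> \<le> M\<close>. The exponent \<open>a\<close> satisfies
  \<open>0 < a < 1\<close>, for \<open>\<psi>\<close> bounded and concave, and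
  \<open>a \<le> 3 - n\<close>, for the comparison of the powers.\<close>

lemma tf_solution_near_parabola:
  assumes sol: "tf_solution n D B H" and D: "0 < D"
    and a_def: "a = (3 - n) / 4" and g_def: "\<gamma> = D * B powr tf_alpha n"
    and M_def: "M = B\<^sup>2 * (\<gamma> / 2) powr (1 - n) / (a * (1 - a))"
  shows "\<And>x. x \<in> {0..1} \<Longrightarrow> 0 \<le> H x - \<gamma> / 2 * (1 - x\<^sup>2)"
    and "\<And>x. x \<in> {0..1} \<Longrightarrow> H x - \<gamma> / 2 * (1 - x\<^sup>2) \<le> M"
    and "0 \<le> 1 - \<gamma> / 3" and "1 - \<gamma> / 3 \<le> M"
proof -
  have B: "0 < B" by (rule tf_solution_B_pos[OF sol])
  then have g: "0 < \<gamma>" using D by (simp add: g_def)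
  have a: "0 < a" "a < 1" using n1 n3 by (auto simp: a_def)
  obtain H1 H2 H3 where pos: "\<And>x. 0 \<le> x \<Longrightarrow> x < 1 \<Longrightarrow> 0 < H x"
    and d': "\<And>x. 0 \<le> x \<Longrightarrow> x \<le> 1 \<Longrightarrow> (H has_real_derivative H1 x) (at x within {0..1})"
    and c1: "continuous_on {0..1} H1"
    and d1: "\<And>x. 0 < x \<Longrightarrow> x < 1 \<Longrightarrow> (H1 has_real_derivative H2 x) (at x)"
    and d2: "\<And>x. 0 < x \<Longrightarrow> x < 1 \<Longrightarrow> (H2 has_real_derivative H3 x) (at x)"
    and ode: "\<And>x. 0 < x \<Longrightarrow> x < 1 \<Longrightarrow> H x powr (n - 1) * H3 x = B\<^sup>2 * x"
    and h: "H1 0 = 0" "(H1 1)\<^sup>2 = D\<^sup>2 * B powr (2 * tf_alpha n)" "H 1 = 0"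
    and int: "(H has_integral 1) {0..1}"
    by (rule tf_solutionE[OF sol], rule that, assumption+)
  have d: "(H has_real_derivative H1 x) (at x)" if "0 < x" "x < 1" for x
  proof -
    have "at x within {0..1} = at x" using that by (intro at_within_interior) auto
    then show ?thesis using d'[of x] that by auto
  qed
  have c0: "continuous_on {0..1} H" using d' by (intro DERIV_continuous_on) auto
  have H3: "H3 x = B\<^sup>2 * x * H x powr (1 - n)" if x: "0 < x" "x < 1" for x
  proof -
    have "H x powr (1 - n) * H x powr (n - 1) = 1" using pos[of x] x by (simp flip: powr_add)
    then have "H3 x = H x powr (1 - n) * (H x powr (n - 1) * H3 x)" by simp
    then show ?thesis unfolding ode[OF x] by simp
  qed
  \<comment> \<open>The contact law leaves the sign of the slope open; positivity of
    \<open>H\<close> to the left of its zero at 1 decides it.\<close>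
  have H1_le: "H1 1 \<le> 0"
  proof (rule ccontr)
    assume "\<not> H1 1 \<le> 0"
    then obtain e where e: "0 < e" "\<And>k. 0 < k \<Longrightarrow> 1 - k \<in> {0..1} \<Longrightarrow> k < e \<Longrightarrow> H (1 - k) < H 1"
      using has_real_derivative_pos_inc_left[OF d'[of 1]] by auto
    define k where "k = min e 1 / 2"
    have "0 < k" "k < e" "k < 1" using e by (auto simp: k_def)
    then show False using e(2)[of k] pos[of "1 - k"] h by auto
  qed
  have "B powr (2 * tf_alpha n) = (B powr tf_alpha n)\<^sup>2"
    by (simp add: power2_eq_square flip: powr_add)
  then have "(- H1 1)\<^sup>2 = \<gamma>\<^sup>2"
    using h(2) by (simp add: g_def power_mult_distrib)
  then have H11: "- H1 1 = \<gamma>" by (rule power2_eq_imp_eq) (use g H1_le in auto)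
  define \<phi> where "\<phi> = (\<lambda>x. H1 x + \<gamma> * x)"
  have cphi: "continuous_on {0..1} \<phi>" unfolding \<phi>_def by (intro continuous_intros c1)
  have dphi: "(\<phi> has_real_derivative H2 x + \<gamma>) (at x)" if "0 < x" "x < 1" for x
    unfolding \<phi>_def using d1[OF that] by (auto intro!: derivative_eq_intros)
  have dphi': "((\<lambda>x. H2 x + \<gamma>) has_real_derivative H3 x) (at x)" if "0 < x" "x < 1" for x
    using d2[OF that] by (auto intro!: derivative_eq_intros)
  have phi01: "\<phi> 0 = 0" "\<phi> 1 = 0" using h H11 by (auto simp: \<phi>_def)
  have phi_le: "\<phi> x \<le> 0" if "x \<in> {0..1}" for x
  proof (rule nonpos_if_convex[OF cphi dphi dphi' _ _ _ that])
    show "0 \<le> H3 x" if "0 < x" "x < 1" for x using H3[OF that] that by simp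
  qed (use phi01 in auto)
  define w where "w = (\<lambda>x. H x - \<gamma> / 2 * (1 - x\<^sup>2))"
  have cw: "continuous_on {0..1} w" unfolding w_def by (intro continuous_intros c0)
  have dw: "(w has_real_derivative \<phi> x) (at x)" if "0 < x" "x < 1" for x
    unfolding w_def \<phi>_def using d[OF that] by (auto intro!: derivative_eq_intros)
  have w1: "w 1 = 0" using h by (simp add: w_def)
  have w_ge: "0 \<le> w x" if "x \<in> {0..1}" for x
  proof -
    have "w 1 \<le> w x"
    proof (rule antimono_of_deriv_nonpos[where f = w and f' = \<phi>])
      show "continuous_on {x..1} w" using cw that by (auto intro: continuous_on_subset)
    qed (use that dw phi_le in auto)
    then show ?thesis using w1 by simp
  qed
  have H_ge: "\<gamma> / 2 * (1 - x) \<le> H x" if x: "0 < x" "x < 1" for x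
  proof -
    have "x\<^sup>2 \<le> x" using x by (simp add: power2_eq_square mult_left_le)
    then have "\<gamma> / 2 * (1 - x) \<le> \<gamma> / 2 * (1 - x\<^sup>2)" using g by (intro mult_left_mono) auto
    then show ?thesis using w_ge[of x] x by (simp add: w_def)
  qed
  define C where "C = B\<^sup>2 * (\<gamma> / 2) powr (1 - n)"
  have C: "0 \<le> C" "M = C / (a * (1 - a))" by (auto simp: C_def M_def)
  define \<psi> where "\<psi> = (\<lambda>x. M * (1 - x) powr a)"
  have M: "0 \<le> M" using C a by simp
  have phi_ge: "- \<phi> x - \<psi> x \<le> 0" if x: "x \<in> {0..1}" for x
  proof (rule nonpos_if_convex[where f = "\<lambda>x. - \<phi> x - \<psi> x" and f' = "\<lambda>x. - (H2 x + \<gamma>) + M * (a * (1 - x) powr (a - 1))"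
        and f'' = "\<lambda>x. - H3 x + M * (a * (1 - a) * (1 - x) powr (a - 2))" and a = 0 and b = 1])
    show "continuous_on {0..1} (\<lambda>x. - \<phi> x - \<psi> x)"
      unfolding \<psi>_def using a
      by (intro continuous_intros cphi continuous_on_powr') auto
    fix x :: real assume x: "0 < x" "x < 1"
    have dp: "((\<lambda>x. (1 - x) powr p) has_real_derivative - (p * (1 - x) powr (p - 1))) (at x)" for p
    proof -
      have "((\<lambda>x. 1 - x) has_real_derivative - 1) (at x)" by (auto intro!: derivative_eq_intros)
      from DERIV_chain2[OF has_real_derivative_powr[of "1 - x" p] this] x show ?thesis by simp
    qed
    show "((\<lambda>x. - \<phi> x - \<psi> x) has_real_derivative - (H2 x + \<gamma>) + M * (a * (1 - x) powr (a - 1))) (at x)"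
      unfolding \<psi>_def
      using DERIV_diff[OF DERIV_minus[OF dphi[OF x]] DERIV_cmult[OF dp[of a], of M]] by simp
    show "((\<lambda>x. - (H2 x + \<gamma>) + M * (a * (1 - x) powr (a - 1))) has_real_derivative
       - H3 x + M * (a * (1 - a) * (1 - x) powr (a - 2))) (at x)"
    proof (rule DERIV_cong[OF DERIV_add[OF DERIV_minus[OF dphi'[OF x]] DERIV_cmult[OF DERIV_cmult[OF dp[of "a - 1"], of a], of M]]])
      have "a - 1 - 1 = a - 2" by simp
      then show "- H3 x + M * (a * - ((a - 1) * (1 - x) powr (a - 1 - 1))) = - H3 x + M * (a * (1 - a) * (1 - x) powr (a - 2))"
        by (simp only:) (simp add: algebra_simps)
    qed
    have "H3 x \<le> B\<^sup>2 * 1 * (\<gamma> / 2 * (1 - x)) powr (1 - n)"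
      unfolding H3[OF x] using x g n1 H_ge[OF x]
      by (intro mult_mono powr_mono2') auto
    also have "\<dots> = C * (1 - x) powr (1 - n)"
      unfolding C_def using g x by (subst powr_mult) auto
    also have "\<dots> \<le> C * (1 - x) powr (a - 2)"
      using C x n3 by (intro mult_left_mono powr_mono') (auto simp: a_def field_simps)
    also have "\<dots> = M * (a * (1 - a) * (1 - x) powr (a - 2))"
      using a by (simp add: C(2))
    finally show "0 \<le> - H3 x + M * (a * (1 - a) * (1 - x) powr (a - 2))" by simp
  qed (use x phi01 M a in \<open>auto simp: \<psi>_def\<close>)
  have w_le: "w x \<le> M" if x: "x \<in> {0..1}" for x
  proof -
    have "w x + M * x \<le> w 1 + M * 1"
    proof (rule mono_of_deriv_nonneg[where f = "\<lambda>x. w x + M * x" and f' = "\<lambda>x. \<phi> x + M"])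
      show "continuous_on {x..1} (\<lambda>x. w x + M * x)"
        using x by (intro continuous_intros continuous_on_subset[OF cw]) auto
      fix z assume "x < z" "z < 1"
      then have z: "0 < z" "z < 1" using x by auto
      show "((\<lambda>x. w x + M * x) has_real_derivative \<phi> z + M) (at z)"
        using dw[OF z] by (auto intro!: derivative_eq_intros)
      have "(1 - z) powr a \<le> 1" using z a by (intro powr_le1) auto
      then have "\<psi> z \<le> M" using M by (simp add: \<psi>_def mult_left_le)
      then show "0 \<le> \<phi> z + M" using phi_ge[of z] z by auto
    qed (use x in auto)
    then have "w x \<le> M - M * x" using w1 by simp
    also have "\<dots> \<le> M" using M x by simp
    finally show ?thesis .
  qed
  have "((\<lambda>x. \<gamma> / 2 * (1 - x\<^sup>2)) has_integral (\<gamma> / 2 * (1 - 1 ^ 3 / 3) - \<gamma> / 2 * (0 - 0 ^ 3 / 3))) {0..1}"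
    by (rule fundamental_theorem_of_calculus[where f = "\<lambda>x. \<gamma> / 2 * (x - x ^ 3 / 3)"])
      (auto simp flip: has_real_derivative_iff_has_vector_derivative intro!: derivative_eq_intros simp: field_simps)
  from has_integral_diff[OF int this] have wint: "(w has_integral 1 - \<gamma> / 3) {0..1}"
    by (simp add: w_def)
  show "0 \<le> H x - \<gamma> / 2 * (1 - x\<^sup>2)" "H x - \<gamma> / 2 * (1 - x\<^sup>2) \<le> M" if "x \<in> {0..1}" for x
    using w_ge[OF that] w_le[OF that] by (auto simp: w_def)
  show "0 \<le> 1 - \<gamma> / 3" by (rule has_integral_nonneg[OF wint w_ge])
  have "((\<lambda>_. M) has_integral M) {0..1::real}" using has_integral_const_real[of M 0 1] by simp
  then show "1 - \<gamma> / 3 \<le> M" by (rule has_integral_le[OF wint _ w_le])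
qed

text \<open>Since \<open>tf_alpha n * (n + 3) / 2 = 2\<close>, the relation
  \<open>\<gamma> = D * B powr tf_alpha n\<close> expresses \<open>B^2\<close> through
  \<open>\<gamma> / D\<close>. Then \<open>M\<close> is a constant times
  \<open>\<gamma> powr ((5 - n) / 2) * D powr (- ((n + 3) / 2))\<close>, and
  \<open>\<gamma> \<le> 3\<close> because the parabola below \<open>H\<close> has at most unit
  mass.\<close>

lemma tf_solution_large_D:
  obtains K where "0 \<le> K"
    "\<And>D B H x. tf_solution n D B H \<Longrightarrow> 0 < D \<Longrightarrow> x \<in> {0..1} \<Longrightarrow>
       \<bar>H x - 3 / 2 * (1 - x\<^sup>2)\<bar> \<le> K * D powr (- ((n + 3) / 2))"
    "\<And>D B H. tf_solution n D B H \<Longrightarrow> 0 < D \<Longrightarrow>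
       \<bar>D * B powr tf_alpha n - 3\<bar> \<le> K * D powr (- ((n + 3) / 2))"
proof -
  define a where "a = (3 - n) / 4"
  have a: "0 < a * (1 - a)" using n1 n3 by (auto simp: a_def)
  define K where "K = (1/2) powr (1 - n) / (a * (1 - a)) * 3 powr ((5 - n) / 2)"
  have K: "0 \<le> K" using a by (simp add: K_def)
  have main: "\<bar>H x - 3 / 2 * (1 - x\<^sup>2)\<bar> \<le> 3 * K * D powr (- ((n + 3) / 2))"
    "\<bar>D * B powr tf_alpha n - 3\<bar> \<le> 3 * K * D powr (- ((n + 3) / 2))"
    if sol: "tf_solution n D B H" and D: "0 < D" and x: "x \<in> {0..1}" for D B H x
  proof -
    define \<gamma> where "\<gamma> = D * B powr tf_alpha n"
    define M where "M = B\<^sup>2 * (\<gamma> / 2) powr (1 - n) / (a * (1 - a))"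
    note np = tf_solution_near_parabola[OF sol D a_def \<gamma>_def M_def]
    have B: "0 < B" by (rule tf_solution_B_pos[OF sol])
    have g: "0 < \<gamma>" "\<gamma> \<le> 3" using D B np(3) by (auto simp: \<gamma>_def)
    have "B powr tf_alpha n = \<gamma> / D" using D by (simp add: \<gamma>_def)
    then have "(\<gamma> / D) powr ((n + 3) / 2) = (B powr tf_alpha n) powr ((n + 3) / 2)" by simp
    also have "\<dots> = B powr (tf_alpha n * ((n + 3) / 2))" by (rule powr_powr)
    also have "tf_alpha n * ((n + 3) / 2) = 2" using n1 by (simp add: tf_alpha_def divide_eq_eq)
    finally have B2: "B\<^sup>2 = \<gamma> powr ((n + 3) / 2) * D powr (- ((n + 3) / 2))"
      using B g D by (simp add: powr_divide powr_minus_divide)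
    have "\<gamma> powr ((n + 3) / 2) * \<gamma> powr (1 - n) = \<gamma> powr ((n + 3) / 2 + (1 - n))"
      by (simp only: powr_add)
    also have "(n + 3) / 2 + (1 - n) = (5 - n) / 2" by (simp add: field_simps)
    also have "\<gamma> powr ((5 - n) / 2) \<le> 3 powr ((5 - n) / 2)" using g n3 by (intro powr_mono2) auto
    finally have gg: "\<gamma> powr ((n + 3) / 2) * \<gamma> powr (1 - n) \<le> 3 powr ((5 - n) / 2)" .
    have "M = (1/2) powr (1 - n) / (a * (1 - a)) * (\<gamma> powr ((n + 3) / 2) * \<gamma> powr (1 - n)) * D powr (- ((n + 3) / 2))"
      unfolding M_def B2 using g powr_mult[of \<gamma> "1/2" "1 - n"] by (simp add: mult_ac)
    also have "\<dots> \<le> K * D powr (- ((n + 3) / 2))"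
      unfolding K_def using a gg by (intro mult_right_mono mult_left_mono) auto
    finally have M: "M \<le> K * D powr (- ((n + 3) / 2))" .
    \<comment> \<open>The error of \<open>\<gamma>\<close> is at most \<open>3 * M\<close>. The
      profile differs from its own parabola by at most \<open>M\<close>, and the two parabolas by at
      most \<open>3 * M / 2\<close>, with opposite signs; this accounts for the factor 3.\<close>
    have g3: "0 \<le> 3 - \<gamma>" "3 - \<gamma> \<le> 3 * M" using np(3,4) by auto
    then show "\<bar>D * B powr tf_alpha n - 3\<bar> \<le> 3 * K * D powr (- ((n + 3) / 2))"
      using M unfolding \<gamma>_def[symmetric] by auto
    have x2: "0 \<le> 1 - x\<^sup>2" "1 - x\<^sup>2 \<le> 1" using x by (auto simp: power_le_one)
    have "(3 - \<gamma>) / 2 * (1 - x\<^sup>2) \<le> (3 - \<gamma>) / 2 * 1"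
      using g3 x2 by (intro mult_left_mono) auto
    moreover have "0 \<le> (3 - \<gamma>) / 2 * (1 - x\<^sup>2)" using g3 x2 by auto
    moreover have "H x - 3 / 2 * (1 - x\<^sup>2) = (H x - \<gamma> / 2 * (1 - x\<^sup>2)) - (3 - \<gamma>) / 2 * (1 - x\<^sup>2)"
      by (simp add: algebra_simps diff_divide_distrib)
    moreover have "\<bar>r - p\<bar> \<le> 3 * E" if "0 \<le> p" "p \<le> (3 - \<gamma>) / 2 * 1" "0 \<le> r" "r \<le> M" "M \<le> E" for p r E
      by (rule abs_leI) (use that g3 in simp_all)
    ultimately show "\<bar>H x - 3 / 2 * (1 - x\<^sup>2)\<bar> \<le> 3 * K * D powr (- ((n + 3) / 2))"
      using np(1,2)[OF x] M by (metis mult.assoc)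
  qed
  show ?thesis
  proof (rule that[of "3 * K"])
    show "\<bar>D * B powr tf_alpha n - 3\<bar> \<le> 3 * K * D powr (- ((n + 3) / 2))"
      if "tf_solution n D B H" "0 < D" for D B H
      \<comment> \<open>\<open>main\<close> is stated for a point of the interval; any point serves
        for this estimate, and 0 is taken.\<close>
      using main(2)[OF that, of 0] by simp
  qed (use K main(1) in auto)
qed

lemma tf_solution_limits:
  assumes sol: "\<And>D. 0 \<le> D \<Longrightarrow> tf_solution n D (BD D) (HD D)"
  shows "((\<lambda>D. D * BD D powr tf_alpha n) \<longlongrightarrow> 3) at_top"
    and "uniform_limit {0..1} HD (\<lambda>x. 3 / 2 * (1 - x\<^sup>2)) at_top"
proof -
  obtain K where K: "0 \<le> K"
    "\<And>D B H x. tf_solution n D B H \<Longrightarrow> 0 < D \<Longrightarrow> x \<in> {0..1} \<Longrightarrow>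
       \<bar>H x - 3 / 2 * (1 - x\<^sup>2)\<bar> \<le> K * D powr (- ((n + 3) / 2))"
    "\<And>D B H. tf_solution n D B H \<Longrightarrow> 0 < D \<Longrightarrow>
       \<bar>D * B powr tf_alpha n - 3\<bar> \<le> K * D powr (- ((n + 3) / 2))"
    using tf_solution_large_D by blast
  have "((\<lambda>D. K * D powr (- ((n + 3) / 2))) \<longlongrightarrow> K * 0) at_top"
    using n1 by (intro tendsto_mult tendsto_const tendsto_neg_powr filterlim_ident) auto
  then have lim: "((\<lambda>D. K * D powr (- ((n + 3) / 2))) \<longlongrightarrow> 0) at_top" by simp
  show "((\<lambda>D. D * BD D powr tf_alpha n) \<longlongrightarrow> 3) at_top"
  proof (rule Lim_transform_bound[where g = "\<lambda>D. K * D powr (- ((n + 3) / 2))", THEN LIM_zero_cancel, OF _ lim])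
    show "\<forall>\<^sub>F D in at_top. norm (D * BD D powr tf_alpha n - 3) \<le> norm (K * D powr (- ((n + 3) / 2)))"
      using eventually_gt_at_top[of 0]
    proof eventually_elim
      case (elim D)
      then show ?case using K(3)[OF sol, of D] by simp
    qed
  qed
  show "uniform_limit {0..1} HD (\<lambda>x. 3 / 2 * (1 - x\<^sup>2)) at_top"
  proof (rule uniform_limitI)
    fix e :: real assume "0 < e"
    with lim have "\<forall>\<^sub>F D in at_top. K * D powr (- ((n + 3) / 2)) < e" by (rule order_tendstoD)
    with eventually_gt_at_top[of 0]
    show "\<forall>\<^sub>F D in at_top. \<forall>x\<in>{0..1}. dist (HD D x) (3 / 2 * (1 - x\<^sup>2)) < e"
    proof eventually_elim
      case (elim D)
      then show ?case using K(2)[OF sol, of D] by (force simp: dist_real_def)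
    qed
  qed
qed

end

theorem theorem1:
  fixes n :: real
  assumes "1 \<le> n" and "n < 3"
  shows "(\<forall>D\<ge>0. \<exists>B H. tf_solution n D B H \<and>
            (\<forall>B' H'. tf_solution n D B' H' \<longrightarrow> B' = B \<and> (\<forall>x\<in>{0..1}. H' x = H x)))
    \<and> (\<forall>B H. tf_solution n 0 B H \<longrightarrow> B > 0)
    \<and> (\<forall>(BD :: real \<Rightarrow> real) (HD :: real \<Rightarrow> real \<Rightarrow> real).
          (\<forall>D\<ge>0. tf_solution n D (BD D) (HD D)) \<longrightarrow>
            ((\<lambda>D. D * BD D powr tf_alpha n) \<longlongrightarrow> 3) at_top \<and>
            uniform_limit {0..1} HD (\<lambda>x. 3 / 2 * (1 - x\<^sup>2)) at_top)"
proof -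
  interpret thin_film n by unfold_locales (use assms in auto)
  show ?thesis
  proof (intro conjI allI impI)
    fix D :: real assume D: "0 \<le> D"
    obtain b X v v1 v2 where "prof b X v v1 v2" "friction X v v1 = D"
      using prof_exists_friction[OF D] by blast
    then obtain B H where "tf_solution n D B H" using tf_solution_of_prof by blast
    then show "\<exists>B H. tf_solution n D B H \<and>
            (\<forall>B' H'. tf_solution n D B' H' \<longrightarrow> B' = B \<and> (\<forall>x\<in>{0..1}. H' x = H x))"
      using tf_solution_unique[OF _ _ D] by blast
  qed (use tf_solution_B_pos tf_solution_limits in blast)+
qed

end
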